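(* Let $\mathfrak{A}$ and $\mathfrak{B}$ be irreducible $C^*$-algebras acting on complex Hilbert spaces $\mathcal{H}$ and $\mathcal{K}$, respectively. Suppose that $\Phi:\mathfrak{S}_n(\mathfrak{A})\to\mathfrak{S}_n(\mathfrak{B})$ is a finite-homeomorphism. Then: (a) $\dim\mathcal{H}=\dim\mathcal{K}$ provided that either $\mathcal{H}$ or $\mathcal{K}$ is finite-dimensional. (b) If $\dim\mathcal{H}=\dim\mathcal{K}\ge3$, then there exist semilinear bijections $U$ and $V$ from $\mathcal{H}$ onto $\mathcal{K}$ such that either (i) $\Phi(\ker\omega_{x,y}\cap\mathfrak{A})=\ker\omega_{Ux,Vy}\cap\mathfrak{B}$ for all $x,y\in\mathcal{H}\setminus\{0\}$, or (ii) $\Phi(\ker\omega_{x,y}\cap\mathfrak{A})=\ker\omega_{Vy,Ux}\cap\mathfrak{B}$ for all $x,y\in\mathcal{H}\setminus\{0\}$. (c) If $\mathcal{H}$ and $\mathcal{K}$ are infinite-dimensional and $\Phi$ is continuous, then there exist bounded linear or conjugate-linear isomorphisms $U$ and $V$ from $\mathcal{H}$ onto $\mathcal{K}$ that satisfy either (i) or (ii), in which case $U$ is linear if and only if $V$ is, and $V^*\mathfrak{B}U\subset\mathfrak{A}$. In particular, $\dim\mathcal{H}=\dim\mathcal{K}$. If moreover $\Phi$ is a homeomorphism, then $V^*\mathfrak{B}U=\mathfrak{A}$.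
   Context: A closure space is a pair $(K,c)$ with $K$ a set and $c:2^K\to2^K$ satisfying $c(\emptyset)=\emptyset$, $S\subset c(S)$, $c(c(S))=c(S)$, and $c(S_1)\subset c(S_2)$ whenever $S_1\subset S_2$. A map $f:(K,c)\to(L,d)$ is continuous (resp. finitely continuous) if $f(c(S))\subset d(f(S))$ for all (resp. all finite) $S\subset K$; a homeomorphism (resp. finite-homeomorphism) is a bijection $f$ with $f$ and $f^{-1}$ continuous (resp. finitely continuous). A subset $A\subset K$ is a closure space (subspace) with $c_A(S)=c(S)\cap A$. For a nonzero $C^*$-algebra $\mathfrak{A}$, the geometric structure space is $\mathfrak{S}(\mathfrak{A})=\{\ker\rho:\rho\in\mathrm{ext}(B_{\mathfrak{A}^*})\}$ with closure operator $S^{=}=\{I\in\mathfrak{S}(\mathfrak{A}):\bigcap_{I'\in S}I'\subset I\}$ (empty intersection is $\mathfrak{A}$). An irreducible $C^*$-algebra acting on $\mathcal{H}$ is a (nonzero) $C^*$-subalgebra of $B(\mathcal{H})$ with no nontrivial invariant subspace. $\omega_{x,y}(A)=\langle Ax,y\rangle$ for $A\in B(\mathcal{H})$. For irreducible $\mathfrak{A}$ on $\mathcal{H}$, the normal part is $\mathfrak{S}_n(\mathfrak{A})=\{\ker\omega_{x,y}\cap\mathfrak{A}:x,y\in\mathcal{H}\setminus\{0\}\}\subset\mathfrak{S}(\mathfrak{A})$, regarded as a subspace of $\mathfrak{S}(\mathfrak{A})$. A map $T$ between complex vector spaces is semilinear if it is additive and $T(cx)=\sigma(c)Tx$ for some field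 automorphism $\sigma$ of $\mathbb{C}$. The adjoint $V^*:\mathcal{K}\to\mathcal{H}$ of a bounded conjugate-linear $V:\mathcal{H}\to\mathcal{K}$ is the bounded conjugate-linear operator with $\langle V^*w,y\rangle=\langle Vy,w\rangle$. $V^*\mathfrak{B}U=\{V^*BU:B\in\mathfrak{B}\}$. $\dim$ is Hilbert space dimension. *)

theory Defs
  imports "HOL-Analysis.Analysis"
begin

unbundle cardinal_syntax

section \<open>Closure spaces\<close>

text \<open>A closure space is represented by its underlying set together with its closure operator,
  which is only meaningful on subsets of that set.\<close>

type_synonym 'a cspace = "'a set \<times> ('a set \<Rightarrow> 'a set)"

definition cs_subspace :: "'a cspace \<Rightarrow> 'a set \<Rightarrow> 'a cspace" where
  "cs_subspace X A = (A, \<lambda>S. snd X S \<inter> A)"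

definition cs_continuous :: "'a cspace \<Rightarrow> 'b cspace \<Rightarrow> ('a \<Rightarrow> 'b) \<Rightarrow> bool" where
  "cs_continuous X Y f \<longleftrightarrow> (\<forall>S. S \<subseteq> fst X \<longrightarrow> f ` snd X S \<subseteq> snd Y (f ` S))"

definition cs_finitely_continuous :: "'a cspace \<Rightarrow> 'b cspace \<Rightarrow> ('a \<Rightarrow> 'b) \<Rightarrow> bool" where
  "cs_finitely_continuous X Y f \<longleftrightarrow>
     (\<forall>S. S \<subseteq> fst X \<and> finite S \<longrightarrow> f ` snd X S \<subseteq> snd Y (f ` S))"

definition cs_homeomorphism :: "'a cspace \<Rightarrow> 'b cspace \<Rightarrow> ('a \<Rightarrow> 'b) \<Rightarrow> bool" where
  "cs_homeomorphism X Y f \<longleftrightarrow> bij_betw f (fst X) (fst Y) \<and>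
     cs_continuous X Y f \<and> cs_continuous Y X (inv_into (fst X) f)"

definition cs_finite_homeomorphism :: "'a cspace \<Rightarrow> 'b cspace \<Rightarrow> ('a \<Rightarrow> 'b) \<Rightarrow> bool" where
  "cs_finite_homeomorphism X Y f \<longleftrightarrow> bij_betw f (fst X) (fst Y) \<and>
     cs_finitely_continuous X Y f \<and> cs_finitely_continuous Y X (inv_into (fst X) f)"


section \<open>Complex normed spaces\<close>

class complex_normed_vector = real_normed_vector +
  fixes scaleC :: "complex \<Rightarrow> 'a \<Rightarrow> 'a"  (infixr "*\<^sub>C" 75)
  assumes scaleC_add_right: "c *\<^sub>C (x + y) = c *\<^sub>C x + c *\<^sub>C y"
    and scaleC_add_left: "(c + d) *\<^sub>C x = c *\<^sub>C x + d *\<^sub>C x"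
    and scaleC_scaleC: "c *\<^sub>C (d *\<^sub>C x) = (c * d) *\<^sub>C x"
    and scaleC_of_real: "complex_of_real r *\<^sub>C x = r *\<^sub>R x"
    and norm_scaleC: "norm (c *\<^sub>C x) = cmod c * norm x"

global_interpretation complex_vector:
  vector_space "scaleC :: complex \<Rightarrow> 'a \<Rightarrow> 'a :: complex_normed_vector"
  defines csubspace = complex_vector.subspace
    and cspan = complex_vector.span
proof
  fix x :: 'a
  show "1 *\<^sub>C x = x"
    using scaleC_of_real[of 1 x] by simp
qed (simp_all add: scaleC_add_right scaleC_add_left scaleC_scaleC)

text \<open>Bounded real-linear maps into a complex normed space form a complex normed space; their
  operator norm is the usual one.  The complex-linear and the conjugate-linear maps are singled
  out below by predicates.\<close>

instantiation blinfun :: (real_normed_vector, complex_normed_vector) complex_normed_vector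
begin

definition scaleC_blinfun ::
  "complex \<Rightarrow> ('a \<Rightarrow>\<^sub>L 'b) \<Rightarrow> ('a \<Rightarrow>\<^sub>L 'b)" where
  "scaleC_blinfun c f = Blinfun (\<lambda>x. c *\<^sub>C blinfun_apply f x)"

lemma blinfun_apply_scaleC: "blinfun_apply (c *\<^sub>C f) x = c *\<^sub>C blinfun_apply f x"
  for f :: "'a \<Rightarrow>\<^sub>L 'b"
proof -
  have "bounded_linear (\<lambda>x. c *\<^sub>C blinfun_apply f x)"
  proof (rule bounded_linear_intro)
    fix x y :: 'a and r :: real
    show "c *\<^sub>C blinfun_apply f (x + y) = c *\<^sub>C blinfun_apply f x + c *\<^sub>C blinfun_apply f y"
      by (simp add: blinfun.add_right scaleC_add_right)
    show "c *\<^sub>C blinfun_apply f (r *\<^sub>R x) = r *\<^sub>R (c *\<^sub>C blinfun_apply f x)"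
      by (simp add: blinfun.scaleR_right scaleC_scaleC mult.commute flip: scaleC_of_real)
    show "norm (c *\<^sub>C blinfun_apply f x) \<le> norm x * (cmod c * norm f)"
      using mult_left_mono[OF norm_blinfun[of f x], of "cmod c"]
      by (simp add: norm_scaleC mult_ac)
  qed
  then show ?thesis
    by (simp add: scaleC_blinfun_def bounded_linear_Blinfun_apply)
qed

instance
proof
  fix c d :: complex and r :: real and f g :: "'a \<Rightarrow>\<^sub>L 'b"
  show "c *\<^sub>C (f + g) = c *\<^sub>C f + c *\<^sub>C g"
    by (rule blinfun_eqI) (simp add: blinfun_apply_scaleC blinfun.add_left scaleC_add_right)
  show "(c + d) *\<^sub>C f = c *\<^sub>C f + d *\<^sub>C f"
    by (rule blinfun_eqI) (simp add: blinfun_apply_scaleC blinfun.add_left scaleC_add_left)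
  show "c *\<^sub>C d *\<^sub>C f = (c * d) *\<^sub>C f"
    by (rule blinfun_eqI) (simp add: blinfun_apply_scaleC scaleC_scaleC)
  show "complex_of_real r *\<^sub>C f = r *\<^sub>R f"
    by (rule blinfun_eqI) (simp add: blinfun_apply_scaleC scaleC_of_real blinfun.scaleR_left)
  have le: "norm (c *\<^sub>C f) \<le> cmod c * norm f" for c and f :: "'a \<Rightarrow>\<^sub>L 'b"
  proof (rule norm_blinfun_bound)
    fix x
    show "norm (blinfun_apply (c *\<^sub>C f) x) \<le> cmod c * norm f * norm x"
      using mult_left_mono[OF norm_blinfun[of f x], of "cmod c"]
      by (simp add: blinfun_apply_scaleC norm_scaleC mult_ac)
  qed simp
  show "norm (c *\<^sub>C f) = cmod c * norm f"
  proof (cases "c = 0")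
    case True
    then show ?thesis using le[of 0 f] by simp
  next
    case False
    have "inverse c *\<^sub>C c *\<^sub>C f = f"
      using False
      by (intro blinfun_eqI) (simp add: blinfun_apply_scaleC scaleC_scaleC)
    then have "norm f \<le> inverse (cmod c) * norm (c *\<^sub>C f)"
      using le[of "inverse c" "c *\<^sub>C f"] by (simp add: norm_inverse)
    then have "cmod c * norm f \<le> norm (c *\<^sub>C f)"
      using False by (simp add: field_simps)
    with le[of c f] show ?thesis by simp
  qed
qed

end

definition field_automorphism :: "('c::field \<Rightarrow> 'c) \<Rightarrow> bool" where
  "field_automorphism \<sigma> \<longleftrightarrow> bij \<sigma> \<and> \<sigma> 1 = 1 \<and>
     (\<forall>a b. \<sigma> (a + b) = \<sigma> a + \<sigma> b) \<and> (\<forall>a b. \<sigma> (a * b) = \<sigma> a * \<sigma> b)"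

definition semilinear_wrt ::
  "(complex \<Rightarrow> complex) \<Rightarrow> ('a::complex_normed_vector \<Rightarrow> 'b::complex_normed_vector) \<Rightarrow> bool" where
  "semilinear_wrt \<sigma> T \<longleftrightarrow>
     (\<forall>x y. T (x + y) = T x + T y) \<and> (\<forall>c x. T (c *\<^sub>C x) = \<sigma> c *\<^sub>C T x)"

definition semilinear :: "('a::complex_normed_vector \<Rightarrow> 'b::complex_normed_vector) \<Rightarrow> bool" where
  "semilinear T \<longleftrightarrow> (\<exists>\<sigma>. field_automorphism \<sigma> \<and> semilinear_wrt \<sigma> T)"

abbreviation clinear :: "('a::complex_normed_vector \<Rightarrow> 'b::complex_normed_vector) \<Rightarrow> bool" where
  "clinear T \<equiv> semilinear_wrt (\<lambda>c. c) T"

abbreviation conjugate_linear ::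
  "('a::complex_normed_vector \<Rightarrow> 'b::complex_normed_vector) \<Rightarrow> bool" where
  "conjugate_linear T \<equiv> semilinear_wrt cnj T"


section \<open>Complex Hilbert spaces\<close>

text \<open>The inner product is linear in its first argument.  Positive definiteness and completeness
  with respect to the induced norm come from the real inner product, its real part.\<close>

class complex_hilbert = complex_normed_vector + real_inner + complete_space +
  fixes cinner :: "'a \<Rightarrow> 'a \<Rightarrow> complex"
  assumes cinner_commute: "cinner x y = cnj (cinner y x)"
    and cinner_add_left: "cinner (x + y) z = cinner x z + cinner y z"
    and cinner_scaleC_left: "cinner (c *\<^sub>C x) y = c * cinner x y"
    and Re_cinner: "Re (cinner x y) = inner x y"

definition is_orthonormal_basis :: "'a::complex_hilbert set \<Rightarrow> bool" where
  "is_orthonormal_basis E \<longleftrightarrow>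
     (\<forall>e\<in>E. norm e = 1) \<and> (\<forall>e\<in>E. \<forall>f\<in>E. e \<noteq> f \<longrightarrow> cinner e f = 0) \<and> closure (cspan E) = UNIV"

text \<open>The Hilbert space dimension, as a cardinal.  The space is determined by the result type.\<close>

definition hilbert_dim :: "'a::complex_hilbert rel" where
  "hilbert_dim = |SOME E. is_orthonormal_basis E|"

definition finite_dimensional :: "'a::complex_hilbert itself \<Rightarrow> bool" where
  "finite_dimensional _ \<longleftrightarrow> (hilbert_dim :: 'a rel) <o natLeq"

text \<open>The two adjoints below are meaningful for complex-linear and for conjugate-linear \<open>V\<close>,
  respectively; \<open>adj\<close> selects the appropriate one.\<close>

definition linear_adjoint ::
  "('h::complex_hilbert \<Rightarrow>\<^sub>L 'k::complex_hilbert) \<Rightarrow> ('k \<Rightarrow>\<^sub>L 'h)" where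
  "linear_adjoint V = (THE W. \<forall>w y.
     cinner (blinfun_apply W w) y = cinner w (blinfun_apply V y))"

definition conjugate_linear_adjoint ::
  "('h::complex_hilbert \<Rightarrow>\<^sub>L 'k::complex_hilbert) \<Rightarrow> ('k \<Rightarrow>\<^sub>L 'h)" where
  "conjugate_linear_adjoint V = (THE W. \<forall>w y.
     cinner (blinfun_apply W w) y = cinner (blinfun_apply V y) w)"

definition adj :: "('h::complex_hilbert \<Rightarrow>\<^sub>L 'k::complex_hilbert) \<Rightarrow> ('k \<Rightarrow>\<^sub>L 'h)" where
  "adj V = (if clinear (blinfun_apply V) then linear_adjoint V else conjugate_linear_adjoint V)"

text \<open>The inverse of a bounded bijection between Hilbert spaces is bounded by the open mapping
  theorem, so boundedness of the inverse is not required separately.\<close>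

definition bounded_isomorphism ::
  "('h::complex_hilbert \<Rightarrow>\<^sub>L 'k::complex_hilbert) \<Rightarrow> bool" where
  "bounded_isomorphism U \<longleftrightarrow> bij (blinfun_apply U) \<and>
     (clinear (blinfun_apply U) \<or> conjugate_linear (blinfun_apply U))"


section \<open>Irreducible C*-algebras\<close>

definition cstar_subalgebra :: "('h::complex_hilbert \<Rightarrow>\<^sub>L 'h) set \<Rightarrow> bool" where
  "cstar_subalgebra A \<longleftrightarrow>
     (\<forall>a\<in>A. clinear (blinfun_apply a)) \<and> csubspace A \<and> closed A \<and>
     (\<forall>a\<in>A. \<forall>b\<in>A. a o\<^sub>L b \<in> A) \<and> (\<forall>a\<in>A. adj a \<in> A)"

text \<open>As usual for operators on a Hilbert space, invariant subspaces are understood to be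
  closed.\<close>

definition irreducible_cstar_algebra :: "('h::complex_hilbert \<Rightarrow>\<^sub>L 'h) set \<Rightarrow> bool" where
  "irreducible_cstar_algebra A \<longleftrightarrow> cstar_subalgebra A \<and> A \<noteq> {0} \<and>
     (\<forall>M. csubspace M \<and> closed M \<and> (\<forall>a\<in>A. blinfun_apply a ` M \<subseteq> M) \<longrightarrow> M = {0} \<or> M = UNIV)"


section \<open>Geometric structure space\<close>

definition kernel_on :: "'a set \<Rightarrow> ('a \<Rightarrow> complex) \<Rightarrow> 'a set" where
  "kernel_on A \<rho> = {a \<in> A. \<rho> a = 0}"

text \<open>The closed unit ball of the dual of a complex subspace \<open>A\<close>.  Functionals on \<open>A\<close> are
  represented by functions that vanish outside \<open>A\<close>, so that equality of functions is equality
  on \<open>A\<close>.\<close>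

definition dual_unit_ball :: "'a::complex_normed_vector set \<Rightarrow> ('a \<Rightarrow> complex) set" where
  "dual_unit_ball A = {\<rho>. (\<forall>a. a \<notin> A \<longrightarrow> \<rho> a = 0) \<and>
     (\<forall>a\<in>A. \<forall>b\<in>A. \<rho> (a + b) = \<rho> a + \<rho> b) \<and>
     (\<forall>c. \<forall>a\<in>A. \<rho> (c *\<^sub>C a) = c * \<rho> a) \<and>
     (\<forall>a\<in>A. cmod (\<rho> a) \<le> norm a)}"

text \<open>The extreme points of a set of complex functions; the library's notion is not available,
  as there is no vector space instance for function types.\<close>

definition extreme_functions :: "('a \<Rightarrow> complex) set \<Rightarrow> ('a \<Rightarrow> complex) set" where
  "extreme_functions B = {\<rho>\<in>B. \<forall>\<rho>1\<in>B. \<forall>\<rho>2\<in>B. \<forall>t::real.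
     0 < t \<and> t < 1 \<and> \<rho> = (\<lambda>a. (1 - t) *\<^sub>R \<rho>1 a + t *\<^sub>R \<rho>2 a) \<longrightarrow> \<rho>1 = \<rho> \<and> \<rho>2 = \<rho>}"

definition structure_set :: "'a::complex_normed_vector set \<Rightarrow> 'a set set" where
  "structure_set A = kernel_on A ` extreme_functions (dual_unit_ball A)"

text \<open>The intersection with \<open>A\<close> makes the empty intersection equal to \<open>A\<close>.\<close>

definition structure_space :: "'a::complex_normed_vector set \<Rightarrow> 'a set cspace" where
  "structure_space A = (structure_set A, \<lambda>S. {I \<in> structure_set A. A \<inter> \<Inter>S \<subseteq> I})"

definition omega :: "'h::complex_hilbert \<Rightarrow> 'h \<Rightarrow> ('h \<Rightarrow>\<^sub>L 'h) \<Rightarrow> complex" where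
  "omega x y a = cinner (blinfun_apply a x) y"

definition normal_part :: "('h::complex_hilbert \<Rightarrow>\<^sub>L 'h) set \<Rightarrow> ('h \<Rightarrow>\<^sub>L 'h) set set" where
  "normal_part A = {kernel_on A (omega x y) | x y. x \<noteq> 0 \<and> y \<noteq> 0}"

definition normal_part_space :: "('h::complex_hilbert \<Rightarrow>\<^sub>L 'h) set \<Rightarrow> ('h \<Rightarrow>\<^sub>L 'h) set cspace" where
  "normal_part_space A = cs_subspace (structure_space A) (normal_part A)"


definition implements ::
  "('h::complex_hilbert \<Rightarrow>\<^sub>L 'h) set \<Rightarrow> ('k::complex_hilbert \<Rightarrow>\<^sub>L 'k) set \<Rightarrow>
   (('h \<Rightarrow>\<^sub>L 'h) set \<Rightarrow> ('k \<Rightarrow>\<^sub>L 'k) set) \<Rightarrow> ('h \<Rightarrow> 'k) \<Rightarrow> ('h \<Rightarrow> 'k) \<Rightarrow> bool" where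
  "implements A B \<Phi> U V \<longleftrightarrow> (\<forall>x y. x \<noteq> 0 \<longrightarrow> y \<noteq> 0 \<longrightarrow>
     \<Phi> (kernel_on A (omega x y)) = kernel_on B (omega (U x) (V y)))"

definition implements_flipped ::
  "('h::complex_hilbert \<Rightarrow>\<^sub>L 'h) set \<Rightarrow> ('k::complex_hilbert \<Rightarrow>\<^sub>L 'k) set \<Rightarrow>
   (('h \<Rightarrow>\<^sub>L 'h) set \<Rightarrow> ('k \<Rightarrow>\<^sub>L 'k) set) \<Rightarrow> ('h \<Rightarrow> 'k) \<Rightarrow> ('h \<Rightarrow> 'k) \<Rightarrow> bool" where
  "implements_flipped A B \<Phi> U V \<longleftrightarrow> (\<forall>x y. x \<noteq> 0 \<longrightarrow> y \<noteq> 0 \<longrightarrow>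
     \<Phi> (kernel_on A (omega x y)) = kernel_on B (omega (V y) (U x)))"

definition sandwich ::
  "('h::complex_hilbert \<Rightarrow>\<^sub>L 'k::complex_hilbert) \<Rightarrow> ('k \<Rightarrow>\<^sub>L 'k) set \<Rightarrow> ('h \<Rightarrow>\<^sub>L 'k) \<Rightarrow>
   ('h \<Rightarrow>\<^sub>L 'h) set" where
  "sandwich V B U = (\<lambda>b. adj V o\<^sub>L b o\<^sub>L U) ` B"

end

theory Submission
  imports Defs
begin

text \<open>A point of the normal part is a pair of rays \<open>([x], [y])\<close>.  By Schur's lemma an irreducible algebra
  is dense on finitely many vectors, so the closure of two points contains a third one exactly when
  they share a coordinate.  Hence a finite homeomorphism is a bijection of grids that preserves the
  lines of the grid: a product of two bijections of projective spaces, up to a swap of the factors,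
  which amounts to \<open>I \<mapsto> I\<^sup>*\<close>.  Both bijections preserve collinearity and are therefore
  induced by semilinear maps in dimension at least three.

  Kaplansky's argument makes every vector functional extreme and every orbit \<open>A x\<close> the whole space, so
  that closures within a line of the grid are closed linear spans.  A semilinear bijection that
  preserves these is bounded in infinite dimensions.  Finally, for \<open>b \<in> B\<close> and \<open>T = V\<^sup>* b U\<close>, the pairs
  with \<open>\<langle>T x, y\<rangle> = 0\<close> are dense in the normal part unless \<open>T \<in> A\<close>, while \<open>b\<close> lies in all kernels of their
  images.\<close>

section \<open>Complex Hilbert spaces\<close>

text \<open>The obstacle throughout is that \<open>A\<close> may contain neither the identity nor
  any operator of finite rank, while the arguments about rays want rank-one operators. Density turns
  a finite linear relation between vector functionals on \<open>A\<close> into one valid for all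
  linear maps, where rank-one maps can be substituted. Infinite intersections of kernels are beyond
  density: there orbits must be attained exactly. Norm control is needed as well, since the
  structure space is defined by extreme points of a unit ball.

  On the projective line of a two-dimensional space every bijection respects collinearity; hence the
  bound three. Finite closures see only algebraic spans and so allow any automorphism of the complex
  field. In finite dimensions every intersection of kernels is already a finite one, so that
  continuity adds nothing and wild automorphisms persist; in infinite dimensions an orthonormal
  sequence leaves only the identity and conjugation. The two forms of the conclusion are exchanged
  by composing \<Phi> with the adjoint, so that only the first is treated.\<close>

instance complex_hilbert \<subseteq> banach ..

lemma cinner_add_right: "cinner x (y + z) = cinner x y + cinner x z"
  by (metis cinner_add_left cinner_commute complex_cnj_add)

lemma cinner_scaleC_right: "cinner x (c *\<^sub>C y) = cnj c * cinner x y"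
  by (metis cinner_scaleC_left cinner_commute complex_cnj_mult)

lemma cinner_zero_left [simp]: "cinner 0 y = 0"
  using cinner_add_left[of 0 0 y] by simp

lemma cinner_zero_right [simp]: "cinner x 0 = 0"
  using cinner_add_right[of x 0 0] by simp

lemma cinner_minus_left: "cinner (- x) y = - cinner x y"
  using cinner_add_left[of "- x" x y] by (simp add: eq_neg_iff_add_eq_0)

lemma cinner_minus_right: "cinner x (- y) = - cinner x y"
  using cinner_add_right[of x "- y" y] by (simp add: eq_neg_iff_add_eq_0)

lemma cinner_diff_left: "cinner (x - y) z = cinner x z - cinner y z"
  using cinner_add_left[of x "- y" z] by (simp add: cinner_minus_left)

lemma cinner_diff_right: "cinner x (y - z) = cinner x y - cinner x z"
  using cinner_add_right[of x y "- z"] by (simp add: cinner_minus_right)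

lemmas cinner_simps = cinner_add_left cinner_add_right cinner_diff_left cinner_diff_right
  cinner_scaleC_left cinner_scaleC_right cinner_minus_left cinner_minus_right

lemma Im_cinner: "Im (cinner x y) = inner x (\<i> *\<^sub>C y)"
  by (simp add: Re_cinner[symmetric] cinner_scaleC_right)

lemma cinner_eq_inner: "cinner x y = complex_of_real (inner x y) + \<i> * complex_of_real (inner x (\<i> *\<^sub>C y))"
  by (simp add: complex_eq_iff Re_cinner Im_cinner)

lemma cinner_self: "cinner x x = complex_of_real ((norm x)\<^sup>2)"
proof -
  have "Im (cinner x x) = 0"
    using cinner_commute[of x x] by (metis complex_cnj_cancel_iff complex_In_mult_cnj_zero Reals_cnj_iff complex_is_Real_iff)
  then show ?thesis
    by (simp add: complex_eq_iff Re_cinner power2_norm_eq_inner)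
qed

lemma cinner_self_eq_0_iff [simp]: "cinner x x = 0 \<longleftrightarrow> x = 0"
  by (simp add: cinner_self)

lemma cinner_eq_0_commute: "cinner x y = 0 \<longleftrightarrow> cinner y x = 0"
  by (metis cinner_commute complex_cnj_zero)

lemma inner_ii_left: "inner (\<i> *\<^sub>C x) y = - inner x (\<i> *\<^sub>C (y :: 'a :: complex_hilbert))"
  by (simp add: Re_cinner[symmetric] cinner_simps)

lemma scaleC_decomp: "c *\<^sub>C x = Re c *\<^sub>R x + Im c *\<^sub>R (\<i> *\<^sub>C (x :: 'a :: complex_normed_vector))"
  by (metis complex_eq mult.commute scaleC_add_left scaleC_of_real scaleC_scaleC)

text \<open>A unimodular factor \<open>c\<close> that turns \<open>cinner x y\<close> into its
  modulus reduces the claim to the real Cauchy-Schwarz inequality.\<close>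

lemma cinner_norm_le: "cmod (cinner x y) \<le> norm x * norm y"
proof (cases "cinner x y = 0")
  case False
  define c where "c = cnj (sgn (cinner x y))"
  have "cmod c = 1" using False by (simp add: c_def norm_sgn)
  have "c * cinner x y = complex_of_real (cmod (cinner x y))"
    using False by (simp add: c_def sgn_eq complex_norm_square[symmetric] power2_eq_square mult.commute)
  then have "cmod (cinner x y) = inner (c *\<^sub>C x) y"
    by (simp add: Re_cinner[symmetric] cinner_scaleC_left)
  also have "\<dots> \<le> norm (c *\<^sub>C x) * norm y" by (rule norm_cauchy_schwarz)
  finally show ?thesis by (simp add: norm_scaleC \<open>cmod c = 1\<close>)
qed simp

lemma bounded_bilinear_cinner: "bounded_bilinear (cinner :: 'a::complex_hilbert \<Rightarrow> 'a \<Rightarrow> complex)"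
proof
  fix r :: real and a b a' b' :: 'a
  show "cinner (r *\<^sub>R a) b = r *\<^sub>R cinner a b" "cinner a (r *\<^sub>R b) = r *\<^sub>R cinner a b"
    by (simp_all add: scaleC_of_real[symmetric] cinner_simps scaleR_conv_of_real)
  show "\<exists>K. \<forall>a b. cmod (cinner (a::'a) b) \<le> norm a * norm b * K"
    by (rule exI[of _ 1]) (simp add: cinner_norm_le)
qed (simp_all add: cinner_simps)

lemmas continuous_on_cinner [continuous_intros] = bounded_bilinear.continuous_on[OF bounded_bilinear_cinner]
lemmas tendsto_cinner [tendsto_intros] = bounded_bilinear.tendsto[OF bounded_bilinear_cinner]

lemma bounded_linear_scaleC: "bounded_linear (\<lambda>x :: 'a::complex_normed_vector. c *\<^sub>C x)"
  by (rule bounded_linear_intro[where K = "cmod c"])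
    (simp_all add: scaleC_add_right norm_scaleC mult.commute scaleC_scaleC flip: scaleC_of_real)

lemma cinner_ext: "(\<And>z. cinner x z = cinner y z) \<Longrightarrow> x = y"
  by (metis cinner_diff_left cinner_self_eq_0_iff diff_self eq_iff_diff_eq_0)

lemma clinear_add: "clinear T \<Longrightarrow> T (x + y) = T x + T y"
  and clinear_scale: "clinear T \<Longrightarrow> T (c *\<^sub>C x) = c *\<^sub>C T x"
  by (simp_all add: semilinear_wrt_def)

lemma closed_closure_csubspace:
  assumes "csubspace (M :: 'a::complex_normed_vector set)" shows "csubspace (closure M)"
proof (rule complex_vector.subspaceI)
  show "0 \<in> closure M"
    using assms closure_subset complex_vector.subspace_0 by blast
  fix x y assume "x \<in> closure M" "y \<in> closure M"
  then obtain f g where "\<forall>n. f n \<in> M" "f \<longlonglongrightarrow> x" "\<forall>n. g n \<in> M" "g \<longlonglongrightarrow> y"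
    by (auto simp: closure_sequential)
  then show "x + y \<in> closure M"
    unfolding closure_sequential using assms
    by (intro exI[of _ "\<lambda>n. f n + g n"]) (auto intro: tendsto_add complex_vector.subspace_add)
next
  fix c x assume "x \<in> closure M"
  then obtain f where "\<forall>n. f n \<in> M" "f \<longlonglongrightarrow> x"
    by (auto simp: closure_sequential)
  then show "c *\<^sub>C x \<in> closure M"
    unfolding closure_sequential using assms
    by (intro exI[of _ "\<lambda>n. c *\<^sub>C f n"])
      (auto intro: bounded_linear.tendsto[OF bounded_linear_scaleC] complex_vector.subspace_scale)
qed

section \<open>Orthogonal projections and adjoints\<close>

text \<open>A sequence minimizing the distance to \<open>M\<close> is Cauchy by the parallelogram
  law. The real setting lets the lemma serve the tuple type \<open>'h^'n\<close> and pairs of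
  vectors as well, where it is applied to closures of orbits.\<close>

lemma orthogonal_projection_exists:
  fixes M :: "'a::{real_inner,complete_space} set"
  assumes M: "subspace M" "closed M"
  obtains p where "p \<in> M" "\<And>m. m \<in> M \<Longrightarrow> inner (x - p) m = 0"
proof -
  define d where "d = infdist x M"
  have ne: "M \<noteq> {}" using M(1) subspace_0 by auto
  have dle: "d \<le> norm (x - m)" if "m \<in> M" for m
    using infdist_le[OF that, of x] by (simp add: d_def dist_norm)
  have d0: "d \<ge> 0" by (simp add: d_def infdist_nonneg)
  have "\<exists>m\<in>M. norm (x - m) < d + 1 / Suc n" for n
  proof (rule ccontr)
    assume "\<not> (\<exists>m\<in>M. norm (x - m) < d + 1 / Suc n)"
    then have "d + 1 / Suc n \<le> dist x m" if "m \<in> M" for m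
      using that by (force simp: dist_norm not_less)
    then have "d + 1 / Suc n \<le> (INF m\<in>M. dist x m)"
      by (intro cINF_greatest ne)
    then have "d + 1 / Suc n \<le> d"
      by (simp add: d_def infdist_def ne)
    then show False by simp
  qed
  then obtain f where f: "\<And>n. f n \<in> M" "\<And>n. norm (x - f n) < d + 1 / Suc n"
    by metis
  have par: "(norm (m - k))\<^sup>2 \<le> 2 * (norm (x - m))\<^sup>2 + 2 * (norm (x - k))\<^sup>2 - 4 * d\<^sup>2"
    if "m \<in> M" "k \<in> M" for m k
  proof -
    \<comment> \<open>The midpoint again lies in \<open>M\<close>, so its distance from
      \<open>x\<close> is at least \<open>d\<close>; this is the source of the term
      \<open>4 * d\<^sup>2\<close>.\<close>
    have "(1/2) *\<^sub>R (m + k) \<in> M"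
      using M(1) that by (auto simp: subspace_def)
    then have "d\<^sup>2 \<le> (norm (x - (1/2) *\<^sub>R (m + k)))\<^sup>2"
      using dle d0 by (simp add: power_mono)
    then show ?thesis
      unfolding power2_norm_eq_inner
      by (simp add: inner_simps inner_commute algebra_simps)
  qed
  have lim: "(\<lambda>n. d + 1 / Suc n) \<longlonglongrightarrow> d + 0"
    by (intro tendsto_intros LIMSEQ_Suc[OF lim_1_over_n])
  have limd: "(\<lambda>n. norm (x - f n)) \<longlonglongrightarrow> d"
    by (rule tendsto_sandwich[of "\<lambda>_. d" _ _ "\<lambda>n. d + 1 / Suc n"])
      (use lim f dle in \<open>auto intro!: always_eventually less_imp_le\<close>)
  have "Cauchy f"
  proof (rule metric_CauchyI)
    fix e :: real assume "e > 0"
    have "(\<lambda>n. (norm (x - f n))\<^sup>2) \<longlonglongrightarrow> d\<^sup>2" by (intro tendsto_intros limd)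
    then have "eventually (\<lambda>n. (norm (x - f n))\<^sup>2 < d\<^sup>2 + e\<^sup>2/4) sequentially"
      by (rule order_tendstoD) (use \<open>e > 0\<close> in simp)
    then obtain N where N: "\<And>n. n \<ge> N \<Longrightarrow> (norm (x - f n))\<^sup>2 < d\<^sup>2 + e\<^sup>2/4"
      by (auto simp: eventually_sequentially)
    have "dist (f m) (f n) < e" if "m \<ge> N" "n \<ge> N" for m n
    proof -
      have "(norm (f m - f n))\<^sup>2 < e\<^sup>2"
        using par[OF f(1)[of m] f(1)[of n]] N[OF that(1)] N[OF that(2)] by simp
      then show ?thesis
        using \<open>e > 0\<close> by (simp add: dist_norm power_less_imp_less_base)
    qed
    then show "\<exists>M. \<forall>m\<ge>M. \<forall>n\<ge>M. dist (f m) (f n) < e" by blast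
  qed
  then obtain p where p: "f \<longlonglongrightarrow> p"
    by (auto simp: Cauchy_convergent_iff convergent_def)
  have "p \<in> M" using closed_sequentially[OF M(2)] f(1) p by blast
  have "norm (x - p) = d"
    by (rule LIMSEQ_unique[OF _ limd]) (intro tendsto_intros p)
  have "inner (x - p) m = 0" if "m \<in> M" for m
  proof (cases "m = 0")
    case False
    \<comment> \<open>This \<open>t\<close> minimizes the distance from \<open>x\<close> along the
      line \<open>p + t *\<^sub>R m\<close>; a nonzero inner product would push that distance below
      \<open>d\<close>.\<close>
    define t where "t = inner (x - p) m / inner m m"
    have "p + t *\<^sub>R m \<in> M"
      using M(1) that \<open>p \<in> M\<close> by (auto simp: subspace_def)
    then have "(norm (x - p))\<^sup>2 \<le> (norm (x - (p + t *\<^sub>R m)))\<^sup>2"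
      using dle \<open>norm (x - p) = d\<close> d0 by (simp add: power_mono)
    also have "\<dots> = (norm (x - p))\<^sup>2 - 2 * t * inner (x - p) m + t * t * inner m m"
      unfolding power2_norm_eq_inner by (simp add: inner_simps inner_commute algebra_simps)
    also have "\<dots> = (norm (x - p))\<^sup>2 - (inner (x - p) m)\<^sup>2 / inner m m"
      using False by (simp add: t_def field_simps power2_eq_square)
    finally have "(inner (x - p) m)\<^sup>2 / inner m m \<le> 0" by simp
    moreover have "inner m m > 0" using False by simp
    ultimately show ?thesis by (simp add: divide_le_0_iff)
  qed simp
  then show ?thesis using that \<open>p \<in> M\<close> by blast
qed

lemma real_riesz:
  fixes f :: "'a::{real_inner,complete_space} \<Rightarrow> real"
  assumes "bounded_linear f"
  obtains y where "\<And>x. f x = inner x y"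
proof (cases "\<forall>x. f x = 0")
  case True then show ?thesis using that[of 0] by simp
next
  case False
  interpret bounded_linear f by fact
  obtain x where x: "f x \<noteq> 0" using False by auto
  have "subspace {x. f x = 0}" by (auto simp: subspace_def add scaleR)
  moreover have "closed {x. f x = 0}"
    by (intro closed_Collect_eq continuous_on continuous_on_const continuous_on_id)
  ultimately obtain p where p: "p \<in> {x. f x = 0}" "\<And>m. m \<in> {x. f x = 0} \<Longrightarrow> inner (x - p) m = 0"
    using orthogonal_projection_exists by blast
  define z where "z = x - p"
  have fz: "f z \<noteq> 0" using x p(1) by (simp add: z_def diff)
  have "f v = inner v ((f z / inner z z) *\<^sub>R z)" for v
  proof -
    have "inner z (v - (f v / f z) *\<^sub>R z) = 0"
      unfolding z_def by (rule p(2)) (use fz in \<open>simp add: z_def diff scaleR\<close>)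
    moreover have "inner z z \<noteq> 0" using fz zero by auto
    ultimately show ?thesis using fz by (simp add: inner_simps field_simps inner_commute)
  qed
  then show ?thesis using that by blast
qed

text \<open>One real construction serves both complex adjoints: for a linear or conjugate-linear
  \<open>V\<close> the identity for the real parts upgrades to one for \<open>cinner\<close>,
  because the imaginary part is a real inner product with \<open>\<i> *\<^sub>C y\<close>.\<close>

lemma real_adjoint_exists:
  fixes V :: "'a::{real_inner,complete_space} \<Rightarrow>\<^sub>L 'b::real_inner"
  obtains W :: "'b \<Rightarrow>\<^sub>L 'a" where "\<And>w y. inner (blinfun_apply W w) y = inner w (blinfun_apply V y)"
proof -
  have "\<exists>z. \<forall>y. inner w (blinfun_apply V y) = inner y z" for w
    by (rule real_riesz[of "\<lambda>y. inner w (blinfun_apply V y)"])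
      (auto intro: bounded_linear_compose[OF bounded_linear_inner_right blinfun.bounded_linear_right])
  then obtain g where g: "\<And>w y. inner w (blinfun_apply V y) = inner y (g w)" by metis
  have "bounded_linear g"
  proof (rule bounded_linear_intro[where K = "norm V"])
    show "g (x + y) = g x + g y" for x y
      by (rule iffD1[OF vector_eq_ldot]) (simp add: g[symmetric] inner_add_left inner_add_right)
    show "g (r *\<^sub>R x) = r *\<^sub>R g x" for r x
      by (rule iffD1[OF vector_eq_ldot]) (simp add: g[symmetric])
    show "norm (g x) \<le> norm x * norm V" for x
    proof (cases "g x = 0")
      case False
      have "(norm (g x))\<^sup>2 = inner x (blinfun_apply V (g x))" by (simp add: g power2_norm_eq_inner)
      also have "\<dots> \<le> norm x * (norm V * norm (g x))"
        by (rule order_trans[OF norm_cauchy_schwarz]) (intro mult_left_mono norm_blinfun norm_ge_zero)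
      finally show ?thesis using False by (simp add: power2_eq_square mult.assoc[symmetric])
    qed simp
  qed
  then show ?thesis
    using that[of "Blinfun g"] by (simp add: bounded_linear_Blinfun_apply g inner_commute)
qed

lemma linear_adjoint:
  assumes "clinear (blinfun_apply V)"
  shows "cinner (blinfun_apply (linear_adjoint V) w) y = cinner w (blinfun_apply V y)"
proof -
  obtain W where W: "\<And>w y. inner (blinfun_apply W w) y = inner w (blinfun_apply V y)"
    using real_adjoint_exists by blast
  have W': "\<forall>w y. cinner (blinfun_apply W w) y = cinner w (blinfun_apply V y)"
    using assms by (simp add: cinner_eq_inner W clinear_scale)
  moreover have "W' = W"
    if "\<forall>w y. cinner (blinfun_apply W' w) y = cinner w (blinfun_apply V y)" for W'
    using that W' by (intro blinfun_eqI cinner_ext) simp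
  ultimately have "\<exists>!W. \<forall>w y. cinner (blinfun_apply W w) y = cinner w (blinfun_apply V y)" by blast
  from theI'[OF this] show ?thesis by (simp add: linear_adjoint_def)
qed

lemma conjugate_linear_adjoint:
  assumes "conjugate_linear (blinfun_apply V)"
  shows "cinner (blinfun_apply (conjugate_linear_adjoint V) w) y = cinner (blinfun_apply V y) w"
proof -
  obtain W where W: "\<And>w y. inner (blinfun_apply W w) y = inner w (blinfun_apply V y)"
    using real_adjoint_exists by blast
  \<comment> \<open>The sign produced here conjugates the imaginary part, which is what exchanges
    the two arguments of \<open>cinner\<close> in the result.\<close>
  have "blinfun_apply V (\<i> *\<^sub>C y) = - (\<i> *\<^sub>C blinfun_apply V y)" for y
    using assms by (simp add: semilinear_wrt_def complex_vector.scale_minus_left)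
  then have W': "\<forall>w y. cinner (blinfun_apply W w) y = cinner (blinfun_apply V y) w"
    unfolding cinner_eq_inner W
    using inner_ii_left[of "blinfun_apply V _" _] by (auto simp: inner_commute[of _ "blinfun_apply V _"]
        inner_commute[of _ "\<i> *\<^sub>C blinfun_apply V _"])
  moreover have "W' = W"
    if "\<forall>w y. cinner (blinfun_apply W' w) y = cinner (blinfun_apply V y) w" for W'
    using that W' by (intro blinfun_eqI cinner_ext) simp
  ultimately have "\<exists>!W. \<forall>w y. cinner (blinfun_apply W w) y = cinner (blinfun_apply V y) w" by blast
  from theI'[OF this] show ?thesis by (simp add: conjugate_linear_adjoint_def)
qed

lemma cinner_adj_left:
  "clinear (blinfun_apply a) \<Longrightarrow> cinner (blinfun_apply (adj a) w) y = cinner w (blinfun_apply a y)"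
  by (simp add: adj_def linear_adjoint)

lemma cinner_adj_right:
  "clinear (blinfun_apply a) \<Longrightarrow> cinner w (blinfun_apply (adj a) y) = cinner (blinfun_apply a w) y"
  by (metis cinner_adj_left cinner_commute)

lemma inner_adj_left:
  "clinear (blinfun_apply a) \<Longrightarrow> inner (blinfun_apply (adj a) w) y = inner w (blinfun_apply a y)"
  by (metis cinner_adj_left Re_cinner)

lemma inner_adj_right:
  "clinear (blinfun_apply a) \<Longrightarrow> inner w (blinfun_apply (adj a) y) = inner (blinfun_apply a w) y"
  by (metis cinner_adj_right Re_cinner)

lemma clinear_adj: "clinear (blinfun_apply a) \<Longrightarrow> clinear (blinfun_apply (adj a))"
  unfolding semilinear_wrt_def[of "\<lambda>c. c" "blinfun_apply (adj a)"]
  by (intro conjI allI cinner_ext) (simp_all add: cinner_adj_left cinner_simps)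

lemma adj_adj: "clinear (blinfun_apply a) \<Longrightarrow> adj (adj a) = a"
  by (intro blinfun_eqI cinner_ext) (simp add: cinner_adj_left cinner_adj_right clinear_adj)

lemma norm_adj_le:
  assumes "clinear (blinfun_apply a)" shows "norm (adj a) \<le> norm a"
proof (rule norm_blinfun_bound)
  fix x
  show "norm (blinfun_apply (adj a) x) \<le> norm a * norm x"
  proof (cases "blinfun_apply (adj a) x = 0")
    case False
    have "(norm (blinfun_apply (adj a) x))\<^sup>2 = inner x (blinfun_apply a (blinfun_apply (adj a) x))"
      using assms by (simp add: power2_norm_eq_inner inner_adj_left)
    also have "\<dots> \<le> norm x * (norm a * norm (blinfun_apply (adj a) x))"
      by (rule order_trans[OF norm_cauchy_schwarz]) (intro mult_left_mono norm_blinfun norm_ge_zero)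
    finally show ?thesis using False by (simp add: power2_eq_square mult.assoc[symmetric] mult.commute)
  qed simp
qed simp

lemma norm_adj: "clinear (blinfun_apply a) \<Longrightarrow> norm (adj a) = norm a"
  using norm_adj_le[of a] norm_adj_le[of "adj a"] by (simp add: adj_adj clinear_adj)

section \<open>Irreducible algebras and Schur's lemma\<close>

lemma scaleC_scaleR: "c *\<^sub>C r *\<^sub>R x = r *\<^sub>R c *\<^sub>C (x :: 'a :: complex_normed_vector)"
  by (simp add: scaleC_scaleC mult.commute flip: scaleC_of_real)

section \<open>Square roots of bounded operators\<close>

lemma blinfun_compose_lim:
  assumes "X \<longlonglongrightarrow> a" "Y \<longlonglongrightarrow> b"
  shows "(\<lambda>n. X n o\<^sub>L Y n) \<longlonglongrightarrow> (a o\<^sub>L b)"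
  by (rule bounded_bilinear.tendsto[OF bounded_bilinear_blinfun_compose assms])

text \<open>With \<open>Y\<close> as below, \<open>1 - Y\<close> is a square root of \<open>1 - X\<close>.  The iteration is dominated by the
  same iteration for the number \<open>1\<close> in place of \<open>X\<close>.\<close>

lemma blinfun_sqrt:
  fixes X :: "'a::banach \<Rightarrow>\<^sub>L 'a"
  assumes "norm X \<le> 1"
  obtains Y where "norm Y \<le> 1" "2 *\<^sub>R Y = X + (Y o\<^sub>L Y)"
    "\<And>S. S o\<^sub>L X = X o\<^sub>L S \<Longrightarrow> S o\<^sub>L Y = Y o\<^sub>L S"
proof -
  define s where "s = rec_nat (0::real) (\<lambda>_ r. (1 + r * r) / 2)"
  define Z where "Z = rec_nat (0::'a \<Rightarrow>\<^sub>L 'a) (\<lambda>_ R. (1/2) *\<^sub>R (X + (R o\<^sub>L R)))"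
  have s0 [simp]: "s 0 = 0" and sS: "s (Suc n) = (1 + s n * s n) / 2" for n
    by (simp_all add: s_def)
  have Z0 [simp]: "Z 0 = 0" and ZS: "Z (Suc n) = (1/2) *\<^sub>R (X + (Z n o\<^sub>L Z n))" for n
    by (simp_all add: Z_def)
  have s_bd: "0 \<le> s n \<and> s n \<le> 1" for n
  proof (induction n)
    case (Suc n)
    then have "s n * s n \<le> 1" by (simp add: mult_le_one)
    with Suc show ?case by (simp add: sS)
  qed simp
  have comm: "S o\<^sub>L Z n = Z n o\<^sub>L S" if "S o\<^sub>L X = X o\<^sub>L S" for S n
  proof (induction n)
    case (Suc n)
    have "blinfun_apply S (blinfun_apply X x) = blinfun_apply X (blinfun_apply S x)" for x
      using that by (metis blinfun_apply_blinfun_compose)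
    moreover have "blinfun_apply S (blinfun_apply (Z n) x) = blinfun_apply (Z n) (blinfun_apply S x)" for x
      using Suc by (metis blinfun_apply_blinfun_compose)
    ultimately show ?case
      by (intro blinfun_eqI) (simp add: ZS blinfun.bilinear_simps)
  qed (simp add: blinfun_eqI)
  have commZ: "Z m o\<^sub>L Z n = Z n o\<^sub>L Z m" for m n
    by (intro comm comm[symmetric]) simp
  have Zs: "norm (Z n) \<le> s n" for n
  proof (induction n)
    case (Suc n)
    have "norm (Z n o\<^sub>L Z n) \<le> s n * s n"
      by (rule order_trans[OF norm_blinfun_compose]) (use Suc in \<open>auto intro!: mult_mono simp: s_bd\<close>)
    then have "norm (X + (Z n o\<^sub>L Z n)) \<le> 1 + s n * s n"
      using assms norm_triangle_ineq[of X "Z n o\<^sub>L Z n"] by linarith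
    then show ?case by (simp add: ZS sS)
  qed simp
  have diff: "norm (Z m - Z n) \<le> s m - s n" if "n \<le> m" for m n
    using that
  proof (induction n arbitrary: m)
    case 0 then show ?case using Zs by simp
  next
    case (Suc n)
    then obtain k where m: "m = Suc k" "n \<le> k" by (metis Suc_le_D Suc_le_mono)
    \<comment> \<open>All iterates commute, so the difference of squares factors, and each factor is
      bounded by its scalar counterpart. The increments of \<open>Z\<close> are thus dominated by
      those of the convergent sequence \<open>s\<close>.\<close>
    have "(Z k o\<^sub>L Z k) - (Z n o\<^sub>L Z n) = (Z k + Z n) o\<^sub>L (Z k - Z n)"
      using commZ[of k n]
      by (intro blinfun_eqI) (simp add: blinfun.bilinear_simps, metis blinfun_apply_blinfun_compose)
    moreover have "norm ((Z k + Z n) o\<^sub>L (Z k - Z n)) \<le> (s k + s n) * (s k - s n)"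
      by (rule order_trans[OF norm_blinfun_compose])
        (intro mult_mono Suc.IH m norm_ge_zero add_nonneg_nonneg norm_triangle_le add_mono Zs, auto simp: s_bd)
    ultimately have "norm ((Z k o\<^sub>L Z k) - (Z n o\<^sub>L Z n)) \<le> s k * s k - s n * s n"
      by (simp add: algebra_simps)
    moreover have "Z m - Z (Suc n) = (1/2) *\<^sub>R ((Z k o\<^sub>L Z k) - (Z n o\<^sub>L Z n))"
      by (simp add: m ZS scaleR_diff_right[symmetric])
    ultimately show ?case by (simp add: m sS diff_divide_distrib[symmetric])
  qed
  have "incseq s"
    unfolding incseq_def using order_trans[OF norm_ge_zero diff] by simp
  then have "convergent s"
    by (intro Bseq_monoseq_convergent BseqI'[where K = 1])
      (use s_bd in \<open>auto simp: incseq_imp_monoseq\<close>)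
  then have "Cauchy s" by (rule convergent_Cauchy)
  have "Cauchy Z"
  proof (rule metric_CauchyI)
    fix e :: real assume "e > 0"
    then obtain M where M: "\<And>m n. m \<ge> M \<Longrightarrow> n \<ge> M \<Longrightarrow> dist (s m) (s n) < e"
      using \<open>Cauchy s\<close> metric_CauchyD by blast
    have "dist (Z m) (Z n) < e" if mn: "m \<ge> M" "n \<ge> M" "n \<le> m" for m n
    proof -
      have "norm (Z m - Z n) \<le> s m - s n" by (rule diff[OF mn(3)])
      also have "\<dots> \<le> dist (s m) (s n)" by (simp add: dist_real_def)
      finally show ?thesis using M[OF mn(1,2)] by (simp add: dist_norm)
    qed
    then show "\<exists>M. \<forall>m\<ge>M. \<forall>n\<ge>M. dist (Z m) (Z n) < e"
      by (metis dist_commute nat_le_linear)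
  qed
  then obtain Y where Y: "Z \<longlonglongrightarrow> Y"
    by (auto simp: Cauchy_convergent_iff convergent_def)
  show ?thesis
  proof (rule that)
    show "norm Y \<le> 1"
      by (rule LIMSEQ_le_const2[OF tendsto_norm[OF Y]]) (use Zs s_bd order_trans in blast)
    have "(\<lambda>n. 2 *\<^sub>R Z (Suc n)) \<longlonglongrightarrow> 2 *\<^sub>R Y"
      by (intro tendsto_intros LIMSEQ_Suc Y)
    moreover have "(\<lambda>n. 2 *\<^sub>R Z (Suc n)) \<longlonglongrightarrow> X + (Y o\<^sub>L Y)"
      unfolding ZS by (simp, intro tendsto_intros blinfun_compose_lim Y)
    ultimately show "2 *\<^sub>R Y = X + (Y o\<^sub>L Y)" by (rule LIMSEQ_unique)
    show "S o\<^sub>L Y = Y o\<^sub>L S" if "S o\<^sub>L X = X o\<^sub>L S" for S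
    proof (rule LIMSEQ_unique)
      show "(\<lambda>n. S o\<^sub>L Z n) \<longlonglongrightarrow> (S o\<^sub>L Y)"
        by (intro blinfun_compose_lim tendsto_const Y)
      show "(\<lambda>n. S o\<^sub>L Z n) \<longlonglongrightarrow> (Y o\<^sub>L S)"
        unfolding comm[OF that] by (intro blinfun_compose_lim tendsto_const Y)
    qed
  qed
qed

section \<open>Elementary properties of irreducible algebras and their commutant\<close>

locale irreducible_algebra =
  fixes A :: "('h::complex_hilbert \<Rightarrow>\<^sub>L 'h) set"
  assumes irreducible: "irreducible_cstar_algebra A"
begin

lemma clinear_apply: "a \<in> A \<Longrightarrow> clinear (blinfun_apply a)"
  and csubspace_algebra: "csubspace A"
  and closed_A: "closed A"
  and comp_mem: "a \<in> A \<Longrightarrow> b \<in> A \<Longrightarrow> a o\<^sub>L b \<in> A"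
  and adj_mem: "a \<in> A \<Longrightarrow> adj a \<in> A"
  using irreducible unfolding irreducible_cstar_algebra_def cstar_subalgebra_def by simp_all

lemma invariant_trivial:
  assumes "csubspace M" "closed M" "\<And>a x. a \<in> A \<Longrightarrow> x \<in> M \<Longrightarrow> blinfun_apply a x \<in> M"
  shows "M = {0} \<or> M = UNIV"
proof -
  have "\<forall>a\<in>A. blinfun_apply a ` M \<subseteq> M" using assms(3) by auto
  then show ?thesis
    using irreducible assms(1,2) unfolding irreducible_cstar_algebra_def by simp
qed

lemma A_not_zero: "A \<noteq> {0}"
  using irreducible unfolding irreducible_cstar_algebra_def by blast

lemma add_mem: "a \<in> A \<Longrightarrow> b \<in> A \<Longrightarrow> a + b \<in> A"
  and diff_mem: "a \<in> A \<Longrightarrow> b \<in> A \<Longrightarrow> a - b \<in> A"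
  and scaleC_mem: "a \<in> A \<Longrightarrow> c *\<^sub>C a \<in> A"
  and zero_mem: "0 \<in> A"
  using csubspace_algebra complex_vector.subspace_add complex_vector.subspace_diff
    complex_vector.subspace_scale complex_vector.subspace_0 by blast+

lemma scaleR_mem: "a \<in> A \<Longrightarrow> r *\<^sub>R a \<in> A"
  using scaleC_mem[of a "complex_of_real r"] by (simp add: scaleC_of_real)

lemma complete_A: "complete A"
  using closed_A complete_eq_closed by blast

lemma apply_simps:
  assumes "a \<in> A"
  shows "blinfun_apply a (x + y) = blinfun_apply a x + blinfun_apply a y"
    "blinfun_apply a (x - y) = blinfun_apply a x - blinfun_apply a y"
    "blinfun_apply a (c *\<^sub>C x) = c *\<^sub>C blinfun_apply a x"
    "blinfun_apply a (- x) = - blinfun_apply a x"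
  using clinear_apply[OF assms] by (simp_all add: clinear_scale blinfun.bilinear_simps)

text \<open>The common null space of \<open>A\<close> is closed and invariant, and it is not the
  whole space because \<open>A\<close> is not \<open>{0}\<close>. This takes the place of an
  identity element.\<close>

lemma nondegenerate:
  assumes "\<And>a. a \<in> A \<Longrightarrow> blinfun_apply a v = 0"
  shows "v = 0"
proof -
  let ?M = "{v. \<forall>a\<in>A. blinfun_apply a v = 0}"
  have "?M = (\<Inter>a\<in>A. {v. blinfun_apply a v = 0})" by auto
  also have "closed \<dots>"
    by (intro closed_INT ballI closed_Collect_eq continuous_intros)
  finally have "closed ?M" .
  moreover have "csubspace ?M"
    by (rule complex_vector.subspaceI) (auto simp: apply_simps)
  ultimately have "?M = {0} \<or> ?M = UNIV"
    by (intro invariant_trivial) (auto simp: comp_mem blinfun_apply_blinfun_compose[symmetric]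
        simp del: blinfun_apply_blinfun_compose)
  moreover have "?M \<noteq> UNIV"
  proof
    assume "?M = UNIV"
    then have "a = 0" if "a \<in> A" for a
      using that by (intro blinfun_eqI) auto
    then show False using A_not_zero zero_mem by blast
  qed
  ultimately show ?thesis using assms by blast
qed

text \<open>Let \<open>S\<close> be \<open>T\<close> scaled into the unit ball and \<open>R\<close>
  the square root of its square. Then (R + S)(R - S) = 0, and \<open>R\<close> commutes with
  whatever commutes with \<open>S\<close>. The null space of R + S is therefore invariant under
  \<open>A\<close>: it is everything, and S = -R, or it is zero, and S = R. As \<open>R\<close> is
  positive, the quadratic form has constant sign.\<close>

lemma commuting_selfadjoint_definite:
  assumes lin: "clinear (blinfun_apply T)"
    and sa: "\<And>x y. inner (blinfun_apply T x) y = inner x (blinfun_apply T y)"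
    and comm: "\<And>a. a \<in> A \<Longrightarrow> a o\<^sub>L T = T o\<^sub>L a"
  shows "(\<forall>x. inner (blinfun_apply T x) x \<ge> 0) \<or> (\<forall>x. inner (blinfun_apply T x) x \<le> 0)"
proof -
  \<comment> \<open>Dividing by \<open>1 + norm T\<close> instead of \<open>norm T\<close> covers
    the case T = 0.\<close>
  define S where "S = inverse (1 + norm T) *\<^sub>R T"
  have pos: "inverse (1 + norm T) > 0" by (simp add: add_pos_nonneg)
  have "norm S = norm T / (1 + norm T)"
    using pos by (simp add: S_def divide_inverse mult.commute)
  then have Sle: "norm S \<le> 1"
    using pos by (simp add: divide_le_eq_1_pos)
  have Ssa: "inner (blinfun_apply S x) y = inner x (blinfun_apply S y)" for x y
    by (simp add: S_def blinfun.scaleR_left sa)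
  have Sbd: "norm (blinfun_apply S x) \<le> norm x" for x
    using norm_blinfun[of S x] mult_right_mono[OF Sle norm_ge_zero[of x]] by simp
  have Slin: "clinear (blinfun_apply S)"
    using lin by (simp add: S_def semilinear_wrt_def blinfun.bilinear_simps scaleR_add_right scaleC_scaleR)
  have Scomm: "a o\<^sub>L S = S o\<^sub>L a" if "a \<in> A" for a
    using comm[OF that]
    by (intro blinfun_eqI) (simp add: S_def blinfun.bilinear_simps, metis blinfun_apply_blinfun_compose)
  define X where "X = id_blinfun - (S o\<^sub>L S)"
  have "norm X \<le> 1"
  proof (rule norm_blinfun_bound)
    fix x
    let ?u = "blinfun_apply S x" and ?v = "blinfun_apply S (blinfun_apply S x)"
    have "(norm (x - ?v))\<^sup>2 = (norm x)\<^sup>2 - 2 * (norm ?u)\<^sup>2 + (norm ?v)\<^sup>2"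
      unfolding power2_norm_eq_inner
      by (simp add: inner_diff_left inner_diff_right inner_commute[of ?v x] Ssa[of x ?u])
    also have "\<dots> \<le> (norm x)\<^sup>2"
      using power_mono[OF Sbd[of ?u] norm_ge_zero, of 2] zero_le_power2[of "norm ?u"] by linarith
    finally have "norm (x - ?v) \<le> norm x" by (rule power2_le_imp_le) simp
    then show "norm (blinfun_apply X x) \<le> 1 * norm x"
      by (simp add: X_def blinfun.diff_left)
  qed simp
  then obtain Y where Y: "norm Y \<le> 1" "2 *\<^sub>R Y = X + (Y o\<^sub>L Y)"
    "\<And>S. S o\<^sub>L X = X o\<^sub>L S \<Longrightarrow> S o\<^sub>L Y = Y o\<^sub>L S"
    using blinfun_sqrt by blast
  have Xcomm: "a o\<^sub>L X = X o\<^sub>L a" if "a o\<^sub>L S = S o\<^sub>L a" for a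
  proof (rule blinfun_eqI)
    have "blinfun_apply a (blinfun_apply S x) = blinfun_apply S (blinfun_apply a x)" for x
      using that by (metis blinfun_apply_blinfun_compose)
    then show "blinfun_apply (a o\<^sub>L X) x = blinfun_apply (X o\<^sub>L a) x" for x
      by (simp add: X_def blinfun.bilinear_simps)
  qed
  define R where "R = id_blinfun - Y"
  have Rpos: "inner (blinfun_apply R x) x \<ge> 0" for x
  proof -
    have "inner (blinfun_apply Y x) x \<le> norm (blinfun_apply Y x) * norm x" by (rule norm_cauchy_schwarz)
    also have "norm (blinfun_apply Y x) \<le> 1 * norm x"
      using norm_blinfun[of Y x] mult_right_mono[OF Y(1) norm_ge_zero[of x]] by linarith
    finally show ?thesis
      by (simp add: R_def blinfun.diff_left inner_diff_left mult_right_mono power2_norm_eq_inner[symmetric] power2_eq_square)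
  qed
  have YR: "blinfun_apply Y v = v - blinfun_apply R v" for v
    by (simp add: R_def blinfun.diff_left)
  have RR: "blinfun_apply R (blinfun_apply R v) = blinfun_apply S (blinfun_apply S v)" for v
  proof -
    have "blinfun_apply (2 *\<^sub>R Y) v = blinfun_apply (X + (Y o\<^sub>L Y)) v" using Y(2) by simp
    then show ?thesis
      by (simp add: X_def YR blinfun.bilinear_simps scaleR_2 algebra_simps)
  qed
  have Rcomm: "blinfun_apply a (blinfun_apply R v) = blinfun_apply R (blinfun_apply a v)"
    if "a o\<^sub>L S = S o\<^sub>L a" for a v
  proof -
    have "blinfun_apply (a o\<^sub>L Y) v = blinfun_apply (Y o\<^sub>L a) v"
      by (simp add: Y(3)[OF Xcomm[OF that]])
    then show ?thesis by (simp add: YR blinfun.diff_right)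
  qed
  \<comment> \<open>The square root was formed among real-linear maps. Complex linearity of
    \<open>R\<close> follows because multiplication by \<open>\<i>\<close> commutes with
    \<open>S\<close> and hence with \<open>R\<close>.\<close>
  define J :: "'h \<Rightarrow>\<^sub>L 'h" where "J = Blinfun (\<lambda>x. \<i> *\<^sub>C x)"
  have J: "blinfun_apply J x = \<i> *\<^sub>C x" for x
    by (simp add: J_def bounded_linear_Blinfun_apply bounded_linear_scaleC)
  have JS: "J o\<^sub>L S = S o\<^sub>L J"
    by (rule blinfun_eqI) (simp add: J clinear_scale[OF Slin])
  have Rscale: "blinfun_apply R (c *\<^sub>C v) = c *\<^sub>C blinfun_apply R v" for c v
    using Rcomm[OF JS, of v, unfolded J, symmetric]
    by (subst (1 2) scaleC_decomp) (simp add: blinfun.bilinear_simps)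
  let ?M = "{v. blinfun_apply (R + S) v = 0}"
  have "csubspace ?M"
    by (rule complex_vector.subspaceI)
      (auto simp: blinfun.bilinear_simps Rscale clinear_scale[OF Slin] scaleC_add_right[symmetric] algebra_simps
        simp del: scaleC_add_right)
  moreover have "closed ?M"
    by (intro closed_Collect_eq continuous_intros)
  moreover have "blinfun_apply a v \<in> ?M" if "a \<in> A" "v \<in> ?M" for a v
  proof -
    have "blinfun_apply a (blinfun_apply S v) = blinfun_apply S (blinfun_apply a v)"
      using Scomm[OF that(1)] by (metis blinfun_apply_blinfun_compose)
    then have "blinfun_apply (R + S) (blinfun_apply a v) = blinfun_apply a (blinfun_apply (R + S) v)"
      by (simp add: blinfun.bilinear_simps Rcomm[OF Scomm[OF that(1)]])
    then show ?thesis using that(2) by simp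
  qed
  ultimately have "?M = {0} \<or> ?M = UNIV" by (rule invariant_trivial)
  then have "(\<forall>v. blinfun_apply R v = blinfun_apply S v) \<or> (\<forall>v. blinfun_apply S v = - blinfun_apply R v)"
  proof
    assume M: "?M = {0}"
    have "blinfun_apply (R + S) (blinfun_apply R v - blinfun_apply S v) = 0" for v
      using Rcomm[of S v] by (simp add: blinfun.bilinear_simps RR)
    then have "blinfun_apply R v - blinfun_apply S v = 0" for v using M by blast
    then show ?thesis by simp
  next
    assume "?M = UNIV"
    then have "blinfun_apply R v + blinfun_apply S v = 0" for v
      by (auto simp: blinfun.bilinear_simps)
    then show ?thesis by (metis add.commute eq_neg_iff_add_eq_0)
  qed
  then have "(\<forall>x. inner (blinfun_apply S x) x \<ge> 0) \<or> (\<forall>x. inner (blinfun_apply S x) x \<le> 0)"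
    using Rpos by (metis inner_minus_left neg_le_0_iff_le)
  then show ?thesis
    using pos unfolding S_def blinfun.scaleR_left inner_scaleR_left
    by (metis mult_le_0_iff not_less zero_le_mult_iff order_less_imp_le)
qed

text \<open>Each shift of \<open>T\<close> by a real multiple of the identity is semidefinite by the
  previous lemma, so every real number is a lower or an upper bound of the quadratic form on unit
  vectors. The greatest lower bound is then also an upper bound, and a symmetric map with vanishing
  quadratic form is zero.\<close>

lemma commuting_selfadjoint_scalar:
  assumes lin: "clinear (blinfun_apply T)"
    and sa: "\<And>x y. inner (blinfun_apply T x) y = inner x (blinfun_apply T y)"
    and comm: "\<And>a. a \<in> A \<Longrightarrow> a o\<^sub>L T = T o\<^sub>L a"
  obtains r :: real where "\<And>x. blinfun_apply T x = r *\<^sub>R x"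
proof -
  have shift: "(\<forall>x. inner (blinfun_apply T x) x \<ge> r * (norm x)\<^sup>2) \<or> (\<forall>x. inner (blinfun_apply T x) x \<le> r * (norm x)\<^sup>2)" for r
  proof -
    let ?T = "T - r *\<^sub>R id_blinfun"
    have "(\<forall>x. inner (blinfun_apply ?T x) x \<ge> 0) \<or> (\<forall>x. inner (blinfun_apply ?T x) x \<le> 0)"
    proof (rule commuting_selfadjoint_definite)
      show "clinear (blinfun_apply ?T)"
        using lin by (simp add: semilinear_wrt_def blinfun.bilinear_simps scaleR_add_right
            complex_vector.scale_right_diff_distrib scaleC_scaleR)
      show "inner (blinfun_apply ?T x) y = inner x (blinfun_apply ?T y)" for x y
        by (simp add: blinfun.bilinear_simps inner_simps sa)
      show "a o\<^sub>L ?T = ?T o\<^sub>L a" if "a \<in> A" for a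
        using comm[OF that]
        by (intro blinfun_eqI) (simp add: blinfun.bilinear_simps, metis blinfun_apply_blinfun_compose)
    qed
    then show ?thesis
      by (simp add: blinfun.bilinear_simps inner_simps power2_norm_eq_inner)
  qed
  \<comment> \<open>A nonzero vector bounds the set \<open>L\<close> of lower bounds from
    above.\<close>
  obtain a where "a \<in> A" "a \<noteq> 0" using A_not_zero zero_mem by blast
  then obtain z where "blinfun_apply a z \<noteq> 0" by (metis blinfun_eqI zero_blinfun.rep_eq)
  define z' where "z' = blinfun_apply a z"
  have z': "(norm z')\<^sup>2 > 0" using \<open>blinfun_apply a z \<noteq> 0\<close> by (simp add: z'_def)
  define L where "L = {r. \<forall>x. inner (blinfun_apply T x) x \<ge> r * (norm x)\<^sup>2}"
  have bnd: "\<bar>inner (blinfun_apply T x) x\<bar> \<le> norm T * (norm x)\<^sup>2" for x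
    by (rule order_trans[OF Cauchy_Schwarz_ineq2])
      (use mult_right_mono[OF norm_blinfun[of T x] norm_ge_zero[of x]] in \<open>simp add: power2_eq_square mult.assoc\<close>)
  have "- norm T \<in> L" using bnd by (auto simp: L_def abs_le_iff minus_le_iff)
  have ub: "r \<le> norm T" if "r \<in> L" for r
  proof -
    have "r * (norm z')\<^sup>2 \<le> inner (blinfun_apply T z') z'"
      using that by (simp add: L_def)
    also have "\<dots> \<le> norm T * (norm z')\<^sup>2" by (rule order_trans[OF abs_ge_self bnd])
    finally have "r * (norm z')\<^sup>2 \<le> norm T * (norm z')\<^sup>2" .
    then show ?thesis using z' by simp
  qed
  then have bdd: "bdd_above L" by (auto simp: bdd_above_def)
  define r where "r = Sup L"
  have lower: "inner (blinfun_apply T x) x \<ge> r * (norm x)\<^sup>2" for x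
  proof (cases "x = 0")
    case False
    have "r \<le> inner (blinfun_apply T x) x / (norm x)\<^sup>2"
      unfolding r_def
    proof (rule cSup_least)
      show "L \<noteq> {}" using \<open>- norm T \<in> L\<close> by blast
    qed (use False in \<open>auto simp: L_def field_simps\<close>)
    then show ?thesis using False by (simp add: field_simps)
  qed simp
  have upper: "inner (blinfun_apply T x) x \<le> r * (norm x)\<^sup>2" for x
  proof (rule field_le_epsilon)
    fix e :: real assume "e > 0"
    define d where "d = e / (1 + (norm x)\<^sup>2)"
    have n1: "1 + (norm x)\<^sup>2 > 0" by (simp add: add_pos_nonneg)
    have d: "d > 0" using \<open>e > 0\<close> n1 by (simp add: d_def)
    have "r + d \<notin> L" using d cSup_upper[OF _ bdd, of "r + d"] by (auto simp: r_def)
    then have "inner (blinfun_apply T x) x \<le> (r + d) * (norm x)\<^sup>2"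
      using shift[of "r + d"] by (auto simp: L_def)
    also have "\<dots> = r * (norm x)\<^sup>2 + d * (norm x)\<^sup>2" by (simp add: algebra_simps)
    also have "d * (norm x)\<^sup>2 \<le> d * (1 + (norm x)\<^sup>2)"
      using d by (intro mult_left_mono) auto
    also have "\<dots> = e" using n1 by (simp add: d_def)
    finally show "inner (blinfun_apply T x) x \<le> r * (norm x)\<^sup>2 + e" by simp
  qed
  define D where "D x = blinfun_apply T x - r *\<^sub>R x" for x
  have D0: "inner (D x) x = 0" for x
    using lower[of x] upper[of x] by (simp add: D_def inner_simps power2_norm_eq_inner)
  have Dsym: "inner (D x) y = inner x (D y)" for x y
    by (simp add: D_def inner_simps sa)
  have Dadd: "D (x + y) = D x + D y" for x y
    by (simp add: D_def blinfun.add_right algebra_simps)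
  \<comment> \<open>Polarization: the vanishing form is expanded at \<open>x + D x\<close>.\<close>
  have "inner (D x) (D x) = 0" for x
    using D0[of "x + D x"] D0[of x] D0[of "D x"] Dsym[of "D x" x]
    by (simp add: Dadd inner_simps)
  then have "D x = 0" for x by simp
  then show ?thesis using that[of r] by (simp add: D_def)
qed

text \<open>Since \<open>A\<close> contains the adjoints of its elements, \<open>adj T\<close>
  commutes with \<open>A\<close> too. So do the self-adjoint maps T + adj T and \<i>(T - adj T),
  which are therefore real scalars.\<close>

lemma schur:
  assumes lin: "clinear (blinfun_apply T)"
    and comm: "\<And>a. a \<in> A \<Longrightarrow> a o\<^sub>L T = T o\<^sub>L a"
  obtains c where "\<And>x. blinfun_apply T x = c *\<^sub>C x"
proof -
  have adj_app: "a \<in> A \<Longrightarrow> blinfun_apply a (blinfun_apply T x) = blinfun_apply T (blinfun_apply a x)" for a x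
    using comm by (metis blinfun_apply_blinfun_compose)
  have acomm: "a o\<^sub>L adj T = adj T o\<^sub>L a" if "a \<in> A" for a
  proof (intro blinfun_eqI cinner_ext)
    fix x z
    have "cinner (blinfun_apply a (blinfun_apply (adj T) x)) z
        = cinner x (blinfun_apply T (blinfun_apply (adj a) z))"
      using that by (metis adj_adj adj_mem cinner_adj_left clinear_apply lin)
    also have "\<dots> = cinner (blinfun_apply (adj T) (blinfun_apply a x)) z"
      using that adj_mem[OF that]
      by (simp add: adj_app[symmetric] cinner_adj_right cinner_adj_left lin clinear_apply)
    finally show "cinner (blinfun_apply (a o\<^sub>L adj T) x) z = cinner (blinfun_apply (adj T o\<^sub>L a) x) z" by simp
  qed
  have aapp: "a \<in> A \<Longrightarrow> blinfun_apply a (blinfun_apply (adj T) x) = blinfun_apply (adj T) (blinfun_apply a x)" for a x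
    using acomm by (metis blinfun_apply_blinfun_compose)
  note alin = clinear_adj[OF lin]
  have 1: "clinear (blinfun_apply (T + adj T))"
    using lin alin by (simp add: semilinear_wrt_def blinfun.bilinear_simps scaleC_add_right)
  have 2: "inner (blinfun_apply (T + adj T) x) y = inner x (blinfun_apply (T + adj T) y)" for x y
    by (simp add: blinfun.bilinear_simps inner_simps inner_adj_left inner_adj_right lin)
  have 3: "a o\<^sub>L (T + adj T) = (T + adj T) o\<^sub>L a" if "a \<in> A" for a
    by (rule blinfun_eqI) (simp add: blinfun.bilinear_simps adj_app aapp that)
  obtain r where r: "\<And>x. blinfun_apply (T + adj T) x = r *\<^sub>R x"
    by (rule commuting_selfadjoint_scalar[OF 1 2 3]) auto
  have 1: "clinear (blinfun_apply (\<i> *\<^sub>C (T - adj T)))"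
    using lin alin by (simp add: semilinear_wrt_def blinfun.bilinear_simps blinfun_apply_scaleC
        scaleC_add_right complex_vector.scale_right_diff_distrib scaleC_scaleC mult.commute)
  have 2: "inner (blinfun_apply (\<i> *\<^sub>C (T - adj T)) x) y = inner x (blinfun_apply (\<i> *\<^sub>C (T - adj T)) y)" for x y
    by (simp add: blinfun.bilinear_simps blinfun_apply_scaleC Re_cinner[symmetric] cinner_simps
        cinner_adj_left cinner_adj_right lin)
  have 3: "a o\<^sub>L (\<i> *\<^sub>C (T - adj T)) = (\<i> *\<^sub>C (T - adj T)) o\<^sub>L a" if "a \<in> A" for a
    by (rule blinfun_eqI) (simp add: blinfun.bilinear_simps blinfun_apply_scaleC apply_simps adj_app aapp that)
  obtain s where s: "\<And>x. blinfun_apply (\<i> *\<^sub>C (T - adj T)) x = s *\<^sub>R x"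
    by (rule commuting_selfadjoint_scalar[OF 1 2 3]) auto
  have "blinfun_apply T x = ((of_real r - \<i> * of_real s) / 2) *\<^sub>C x" for x
  proof -
    let ?u = "blinfun_apply T x" and ?v = "blinfun_apply (adj T) x"
    have 1: "?u + ?v = complex_of_real r *\<^sub>C x"
      using r[of x] by (simp add: blinfun.bilinear_simps scaleC_of_real)
    have "\<i> *\<^sub>C (?u - ?v) = complex_of_real s *\<^sub>C x"
      using s[of x] by (simp add: blinfun.bilinear_simps blinfun_apply_scaleC scaleC_of_real)
    then have "(- \<i>) *\<^sub>C \<i> *\<^sub>C (?u - ?v) = (- \<i>) *\<^sub>C complex_of_real s *\<^sub>C x" by simp
    then have 2: "?u - ?v = (- \<i> * of_real s) *\<^sub>C x"
      by (simp add: scaleC_scaleC)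
    have "(?u + ?v) + (?u - ?v) = (complex_of_real r - \<i> * of_real s) *\<^sub>C x"
      unfolding 1 2 by (simp add: complex_vector.scale_left_diff_distrib)
    then have "2 *\<^sub>C ?u = (complex_of_real r - \<i> * of_real s) *\<^sub>C x"
      using scaleC_add_left[of 1 1 ?u] by simp
    then have "(1/2) *\<^sub>C 2 *\<^sub>C ?u = (1/2) *\<^sub>C (complex_of_real r - \<i> * of_real s) *\<^sub>C x" by simp
    then show ?thesis by (simp add: scaleC_scaleC)
  qed
  then show ?thesis using that by blast
qed

end

section \<open>Density\<close>

lemmas cinner_scaleR = bounded_bilinear.scaleR_left[OF bounded_bilinear_cinner]
  bounded_bilinear.scaleR_right[OF bounded_bilinear_cinner]

lemma clinear_sum:
  assumes "clinear T" shows "T (\<Sum>i\<in>I. f i) = (\<Sum>i\<in>I. T (f i))"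
proof (induction I rule: infinite_finite_induct)
  have T0: "T 0 = 0" using clinear_add[OF assms, of 0 0] by simp
  { case (infinite A) then show ?case by (simp add: T0) }
  { case empty then show ?case by (simp add: T0) }
  case (insert x F) then show ?case by (simp add: clinear_add[OF assms])
qed

context irreducible_algebra
begin

text \<open>The projection onto the closure below commutes with the diagonal action of \<open>A\<close>, so that
  its matrix entries are scalars by Schur's lemma.\<close>

lemma density:
  fixes x :: "'h^'n"
  assumes T: "clinear T"
  shows "(\<chi> i. T (x $ i)) \<in> closure ((\<lambda>a. \<chi> i. blinfun_apply a (x $ i)) ` A)"
proof -
  define D :: "('h \<Rightarrow> 'h) \<Rightarrow> 'h^'n \<Rightarrow> 'h^'n" where "D f v = (\<chi> i. f (v $ i))" for f v
  have D_nth [simp]: "D f v $ i = f (v $ i)" for f v i by (simp add: D_def)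
  let ?O = "(\<lambda>a. D (blinfun_apply a) x) ` A"
  define M where "M = closure ?O"
  have contD: "continuous_on S (D f)" if "bounded_linear f" for f S
    unfolding D_def using that
    by (intro continuous_on_vec_lambda bounded_linear.continuous_on[OF that] continuous_intros)
  have OM: "?O \<subseteq> M" unfolding M_def by (rule closure_subset)
  have invM: "D f v \<in> M" if "bounded_linear f" "D f ` ?O \<subseteq> M" "v \<in> M" for f v
    using image_closure_subset[OF contD[OF that(1)] _ that(2)] that(3) by (auto simp: M_def)
  have inv_scale: "D (\<lambda>u. c *\<^sub>C u) v \<in> M" if "v \<in> M" for c v
  proof (rule invM[OF bounded_linear_scaleC _ that])
    have "D (\<lambda>u. c *\<^sub>C u) (D (blinfun_apply a) x) = D (blinfun_apply (c *\<^sub>C a)) x" for a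
      by (simp add: vec_eq_iff blinfun_apply_scaleC)
    then show "D (\<lambda>u. c *\<^sub>C u) ` ?O \<subseteq> M" using OM scaleC_mem by force
  qed
  have inv_A: "D (blinfun_apply b) v \<in> M" if "b \<in> A" "v \<in> M" for b v
  proof (rule invM[OF blinfun.bounded_linear_right _ that(2)])
    have "D (blinfun_apply b) (D (blinfun_apply a) x) = D (blinfun_apply (b o\<^sub>L a)) x" for a
      by (simp add: vec_eq_iff)
    then show "D (blinfun_apply b) ` ?O \<subseteq> M" using OM comp_mem[OF that(1)] by force
  qed
  have "subspace M"
    unfolding subspace_def
  proof (intro conjI ballI allI)
    show "0 \<in> M" using OM zero_mem by (force simp: vec_eq_iff intro: image_eqI[of _ _ 0])
    fix v assume v: "v \<in> M"
    fix r :: real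
    have "D (\<lambda>u. of_real r *\<^sub>C u) v = r *\<^sub>R v" by (simp add: vec_eq_iff scaleC_of_real)
    then show "r *\<^sub>R v \<in> M" using inv_scale[OF v, of "of_real r"] by simp
  next
    fix v w assume "v \<in> M" "w \<in> M"
    then obtain f g where "\<forall>n. f n \<in> ?O" "f \<longlonglongrightarrow> v" "\<forall>n. g n \<in> ?O" "g \<longlonglongrightarrow> w"
      unfolding M_def closure_sequential by blast
    moreover have "p + q \<in> ?O" if pq: "p \<in> ?O" "q \<in> ?O" for p q
    proof -
      obtain a b where "a \<in> A" "b \<in> A" "p = D (blinfun_apply a) x" "q = D (blinfun_apply b) x"
        using pq by blast
      then show ?thesis
        by (intro image_eqI[of _ _ "a + b"]) (auto simp: add_mem vec_eq_iff blinfun.add_left)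
    qed
    ultimately show "v + w \<in> M"
      unfolding M_def closure_sequential
      by (intro exI[of _ "\<lambda>n. f n + g n"]) (blast intro: tendsto_add)
  qed
  moreover have "closed M" by (simp add: M_def)
  ultimately have "\<forall>v. \<exists>p. p \<in> M \<and> (\<forall>m\<in>M. inner (v - p) m = 0)"
    using orthogonal_projection_exists by (metis (no_types, lifting))
  then obtain P where PM: "\<And>v. P v \<in> M" and Porth: "\<And>v m. m \<in> M \<Longrightarrow> inner (v - P v) m = 0"
    by metis
  have Puniq: "P v = p" if "p \<in> M" "\<And>m. m \<in> M \<Longrightarrow> inner (v - p) m = 0" for v p
  proof -
    have "P v - p \<in> M" using \<open>subspace M\<close> PM that(1) by (simp add: subspace_diff)
    then have "inner (v - p) (P v - p) - inner (v - P v) (P v - p) = 0"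
      using that(2) Porth by simp
    then have "inner (P v - p) (P v - p) = 0" by (simp add: inner_diff_left[symmetric])
    then show ?thesis by simp
  qed
  have Padd: "P (v + w) = P v + P w" for v w
  proof (rule Puniq)
    show "P v + P w \<in> M" by (rule subspace_add[OF \<open>subspace M\<close> PM PM])
    fix m assume m: "m \<in> M"
    have "v + w - (P v + P w) = (v - P v) + (w - P w)" by simp
    then show "inner (v + w - (P v + P w)) m = 0"
      by (simp only: inner_add_left Porth[OF m])
  qed
  have PscaleR: "P (r *\<^sub>R v) = r *\<^sub>R P v" for r v
  proof (rule Puniq)
    show "r *\<^sub>R P v \<in> M" by (rule subspace_scale[OF \<open>subspace M\<close> PM])
    fix m assume m: "m \<in> M"
    show "inner (r *\<^sub>R v - r *\<^sub>R P v) m = 0"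
      by (simp add: scaleR_diff_right[symmetric] Porth[OF m] del: scaleR_diff_right)
  qed
  have Pnorm: "norm (P v) \<le> norm v" for v
  proof -
    have "inner (v - P v) (P v) = 0" by (rule Porth[OF PM])
    then have "(norm v)\<^sup>2 = (norm (v - P v))\<^sup>2 + (norm (P v))\<^sup>2"
      unfolding power2_norm_eq_inner by (simp add: inner_simps inner_commute)
    then show ?thesis by (intro power2_le_imp_le[OF _ norm_ge_zero]) simp
  qed
  have innerD: "inner (D f v) w = inner v (D g w)"
    if "\<And>u u'. inner (f u) u' = inner u (g u')" for f g v w
    by (simp add: inner_vec_def that)
  \<comment> \<open>If \<open>f\<close> and its adjoint \<open>g\<close> both act within
    \<open>M\<close>, then \<open>f\<close> also preserves the orthogonal complement of
    \<open>M\<close> and so commutes with the projection.\<close>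
  have Pcomm: "P (D f v) = D f (P v)"
    if adj: "\<And>u u'. inner (f u) u' = inner u (g u')" and lin: "\<And>u u'. f (u - u') = f u - f u'"
      and f: "\<And>v. v \<in> M \<Longrightarrow> D f v \<in> M" and g: "\<And>v. v \<in> M \<Longrightarrow> D g v \<in> M" for f g v
  proof (rule Puniq)
    show "D f (P v) \<in> M" by (rule f[OF PM])
    fix m assume "m \<in> M"
    have "D f v - D f (P v) = D f (v - P v)" by (simp add: vec_eq_iff lin)
    then show "inner (D f v - D f (P v)) m = 0"
      using Porth[OF g[OF \<open>m \<in> M\<close>]] by (simp add: innerD[of f g, OF adj])
  qed
  have Pcomm_A: "P (D (blinfun_apply a) v) = D (blinfun_apply a) (P v)" if "a \<in> A" for a v
    by (rule Pcomm[of _ "blinfun_apply (adj a)"])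
      (use that in \<open>auto simp: inner_adj_right clinear_apply adj_mem inv_A blinfun.diff_right\<close>)
  have Pcomm_C: "P (D (\<lambda>u. c *\<^sub>C u) v) = D (\<lambda>u. c *\<^sub>C u) (P v)" for c v
    by (rule Pcomm[of _ "\<lambda>u. cnj c *\<^sub>C u"])
      (auto simp: inv_scale Re_cinner[symmetric] cinner_simps complex_vector.scale_right_diff_distrib)
  have norm_ax: "norm (axis j u :: 'h^'n) = norm u" for j u
    by (simp add: norm_eq_sqrt_inner inner_axis_axis)
  have D_axis: "D f (axis j u) = axis j (f u)" if "f 0 = 0" for f j u
    using that by (simp add: vec_eq_iff axis_def)
  have ax_add: "axis j (u + u') = (axis j u + axis j u' :: 'h^'n)" for j u u'
    by (simp add: vec_eq_iff axis_def)
  have ax_sc: "axis j (r *\<^sub>R u) = (r *\<^sub>R axis j u :: 'h^'n)" for j u r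
    by (simp add: vec_eq_iff axis_def)
  \<comment> \<open>A matrix entry of \<open>P\<close> inherits complex linearity and commutation
    with \<open>A\<close> from \<open>P\<close>, so that Schur's lemma applies to it.\<close>
  have ex_l: "\<exists>c. \<forall>u. P (axis j u) $ i = c *\<^sub>C u" for i j
  proof -
    define Q where "Q = Blinfun (\<lambda>u. P (axis j u) $ i)"
    have "bounded_linear (\<lambda>u. P (axis j u) $ i)"
    proof (rule bounded_linear_intro[where K = 1])
      show "norm (P (axis j u) $ i) \<le> norm u * 1" for u
        using order_trans[OF Finite_Cartesian_Product.norm_nth_le Pnorm[of "axis j u"]]
        by (simp add: norm_ax)
    qed (simp_all add: ax_add ax_sc Padd PscaleR)
    then have Q: "blinfun_apply Q u = P (axis j u) $ i" for u
      by (simp add: Q_def bounded_linear_Blinfun_apply)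
    have "clinear (blinfun_apply Q)"
      unfolding semilinear_wrt_def
      using Pcomm_C[of _ "axis j _"] by (auto simp: Q D_axis ax_add Padd vec_eq_iff)
    moreover have "a o\<^sub>L Q = Q o\<^sub>L a" if "a \<in> A" for a
      using Pcomm_A[OF that, of "axis j _"]
      by (intro blinfun_eqI) (auto simp: Q D_axis)
    ultimately obtain c where "\<And>u. blinfun_apply Q u = c *\<^sub>C u"
      using schur by blast
    then show ?thesis by (auto simp: Q)
  qed
  define l where "l i j = (SOME c. \<forall>u. P (axis j u) $ i = c *\<^sub>C u)" for i j
  have l: "P (axis j u) $ i = l i j *\<^sub>C u" for i j u
    unfolding l_def by (rule someI_ex[OF ex_l, THEN spec])
  have Psum: "P (\<Sum>j\<in>J. f j) = (\<Sum>j\<in>J. P (f j))" for J and f :: "'n \<Rightarrow> 'h^'n"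
    using linear_sum[of P f J] by (simp add: linear_iff Padd PscaleR)
  have expand: "(\<Sum>j\<in>UNIV. axis j (v $ j)) = v" for v :: "'h^'n"
    by (simp add: vec_eq_iff axis_def)
  have Pv: "P v $ i = (\<Sum>j\<in>UNIV. l i j *\<^sub>C (v $ j))" for v i
    by (subst expand[symmetric, of v]) (simp only: Psum sum_component l)
  \<comment> \<open>That \<open>x\<close> lies in the closure of its own orbit is not evident
    without an identity in \<open>A\<close>. It holds because every element of \<open>A\<close>
    annihilates all components of \<open>x - P x\<close>, and \<open>A\<close> is
    nondegenerate.\<close>
  have "P x = x"
  proof -
    have "blinfun_apply a ((x - P x) $ i) = 0" if "a \<in> A" for a i
    proof -
      have "D (blinfun_apply a) x \<in> M" using OM that by blast
      then have "P (D (blinfun_apply a) x) = D (blinfun_apply a) x"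
        by (intro Puniq) auto
      then have "D (blinfun_apply a) (P x) = D (blinfun_apply a) x"
        by (simp add: Pcomm_A[OF that])
      then show ?thesis by (simp add: vec_eq_iff blinfun.diff_right)
    qed
    then have "(x - P x) $ i = 0" for i by (rule nondegenerate)
    then show ?thesis by (simp add: vec_eq_iff)
  qed
  \<comment> \<open>A matrix of scalars commutes with the diagonal action of a linear map.\<close>
  have "D T x = P (D T x)"
  proof (rule vec_eq_iff[THEN iffD2], rule allI)
    fix i
    have "x $ i = (\<Sum>j\<in>UNIV. l i j *\<^sub>C (x $ j))" using Pv[of x i] \<open>P x = x\<close> by simp
    then have "T (x $ i) = (\<Sum>j\<in>UNIV. l i j *\<^sub>C T (x $ j))"
      using clinear_sum[OF T, of "\<lambda>j. l i j *\<^sub>C (x $ j)" UNIV] by (simp add: clinear_scale[OF T])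
    then show "D T x $ i = P (D T x) $ i" by (simp add: Pv)
  qed
  then show ?thesis using PM[of "D T x"] by (simp add: M_def D_def)
qed

text \<open>The tuples satisfying the relation form a closed set containing the orbit of
  \<open>x\<close>, and density puts the tuple of values of \<open>T\<close> into the closure of
  that orbit. With \<open>T\<close> of rank one, relations on \<open>A\<close> become statements
  about single vectors.\<close>

lemma annihilator_total:
  fixes x y :: "'h^'n"
  assumes "\<And>a. a \<in> A \<Longrightarrow> (\<Sum>i\<in>UNIV. cinner (blinfun_apply a (x $ i)) (y $ i)) = 0" and T: "clinear T"
  shows "(\<Sum>i\<in>UNIV. cinner (T (x $ i)) (y $ i)) = 0"
proof -
  let ?Z = "{w :: 'h^'n. (\<Sum>i\<in>UNIV. cinner (w $ i) (y $ i)) = 0}"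
  have "closed ?Z"
    by (intro closed_Collect_eq continuous_intros)
  moreover have "(\<lambda>a. \<chi> i. blinfun_apply a (x $ i)) ` A \<subseteq> ?Z" using assms(1) by auto
  ultimately have "closure ((\<lambda>a. \<chi> i. blinfun_apply a (x $ i)) ` A) \<subseteq> ?Z" by (rule closure_minimal[rotated])
  then show ?thesis using density[OF T, of x] by auto
qed

text \<open>Self-adjoint elements form only a real subspace, so density does not apply directly. The
  residual (u, v) of projecting (y, x) onto the closure of their orbit yields a relation of length
  four on all of \<open>A\<close>. Transferred to the self-adjoint reflection that exchanges
  \<open>x\<close> and \<open>y\<close>, it shows that the residual is orthogonal to (y, x). The
  reflection exists because \<open>cinner x y\<close> is real.\<close>

lemma selfadjoint_exchange:
  assumes xy: "norm x = 1" "norm y = 1" "Im (cinner x y) = 0" and "e > 0"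
  obtains c where "c \<in> A" "adj c = c" "norm (blinfun_apply c x - y) < e" "norm (blinfun_apply c y - x) < e"
proof -
  let ?S = "{c \<in> A. adj c = c}"
  let ?f = "\<lambda>c. (blinfun_apply c x, blinfun_apply c y)"
  have adj_add: "adj (a + b) = adj a + adj b" if "a \<in> A" "b \<in> A" for a b
    by (intro blinfun_eqI cinner_ext)
      (use that in \<open>simp add: cinner_adj_left clinear_apply add_mem blinfun.add_left cinner_simps\<close>)
  have adj_scale: "adj (r *\<^sub>R a) = r *\<^sub>R adj a" if "a \<in> A" for a r
    by (intro blinfun_eqI cinner_ext)
      (use that in \<open>simp add: cinner_adj_left clinear_apply scaleR_mem blinfun.scaleR_left cinner_scaleR\<close>)
  have adj_zero: "adj 0 = (0 :: 'h \<Rightarrow>\<^sub>L 'h)"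
    using adj_scale[OF zero_mem, of 0] by simp
  have sub: "subspace (closure (?f ` ?S))"
    unfolding subspace_def
  proof (intro conjI ballI allI)
    show "0 \<in> closure (?f ` ?S)"
      by (rule set_mp[OF closure_subset]) (use zero_mem adj_zero in \<open>auto intro!: image_eqI[of _ _ 0] simp: zero_prod_def\<close>)
    fix v w assume "v \<in> closure (?f ` ?S)" "w \<in> closure (?f ` ?S)"
    then obtain f g where fg: "\<forall>n. f n \<in> ?f ` ?S" "f \<longlonglongrightarrow> v" "\<forall>n. g n \<in> ?f ` ?S" "g \<longlonglongrightarrow> w"
      unfolding closure_sequential by blast
    have "p + q \<in> ?f ` ?S" if pq: "p \<in> ?f ` ?S" "q \<in> ?f ` ?S" for p q
    proof -
      obtain a b where "a \<in> ?S" "b \<in> ?S" "p = ?f a" "q = ?f b" using pq by blast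
      then show ?thesis
        by (intro image_eqI[of _ _ "a + b"]) (auto simp: add_mem adj_add blinfun.add_left)
    qed
    then show "v + w \<in> closure (?f ` ?S)"
      unfolding closure_sequential using fg
      by (intro exI[of _ "\<lambda>n. f n + g n"]) (blast intro: tendsto_add)
  next
    fix r :: real and v assume "v \<in> closure (?f ` ?S)"
    then obtain f where f: "\<forall>n. f n \<in> ?f ` ?S" "f \<longlonglongrightarrow> v"
      unfolding closure_sequential by blast
    have "r *\<^sub>R p \<in> ?f ` ?S" if p: "p \<in> ?f ` ?S" for p
    proof -
      obtain a where "a \<in> ?S" "p = ?f a" using p by blast
      then show ?thesis
        by (intro image_eqI[of _ _ "r *\<^sub>R a"]) (auto simp: scaleR_mem adj_scale blinfun.scaleR_left)
    qed
    then show "r *\<^sub>R v \<in> closure (?f ` ?S)"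
      unfolding closure_sequential using f
      by (intro exI[of _ "\<lambda>n. r *\<^sub>R f n"]) (blast intro: tendsto_scaleR[OF tendsto_const])
  qed
  have "closed (closure (?f ` ?S))" by simp
  from orthogonal_projection_exists[OF sub this, of "(y, x)"] obtain p
    where p: "p \<in> closure (?f ` ?S)" "\<And>m. m \<in> closure (?f ` ?S) \<Longrightarrow> inner ((y, x) - p) m = 0"
    by blast
  define u where "u = fst ((y, x) - p)"
  define v where "v = snd ((y, x) - p)"
  have uv: "(y, x) - p = (u, v)" unfolding u_def v_def by (rule prod.collapse[symmetric])
  have orth: "inner u (blinfun_apply c x) + inner v (blinfun_apply c y) = 0" if "c \<in> ?S" for c
  proof -
    have "?f c \<in> closure (?f ` ?S)" by (rule set_mp[OF closure_subset]) (use that in blast)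
    from p(2)[OF this] show ?thesis by (simp only: uv inner_Pair)
  qed
  \<comment> \<open>The real part of \<open>F\<close> at \<open>a\<close> is the pairing of the
    self-adjoint element \<open>a + adj a\<close> with the residual, hence zero; replacing
    \<open>a\<close> by \<open>\<i> *\<^sub>C a\<close> disposes of the imaginary part.\<close>
  define F where "F t = cinner (t x) u + cinner (t y) v + cinner (t u) x + cinner (t v) y" for t
  have ReF: "Re (F (blinfun_apply a)) = 0" if "a \<in> A" for a
  proof -
    have "adj (a + adj a) = a + adj a"
      using that adj_add[OF that adj_mem[OF that]] by (simp add: adj_adj clinear_apply add.commute)
    then have "inner u (blinfun_apply (a + adj a) x) + inner v (blinfun_apply (a + adj a) y) = 0"
      using that by (intro orth) (auto simp: add_mem adj_mem)
    then show ?thesis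
      using that by (simp add: F_def Re_cinner blinfun.add_left inner_simps inner_adj_right clinear_apply inner_commute)
  qed
  have F0: "F (blinfun_apply a) = 0" if "a \<in> A" for a
  proof -
    have "F (blinfun_apply (\<i> *\<^sub>C a)) = \<i> * F (blinfun_apply a)"
      by (simp add: F_def blinfun_apply_scaleC cinner_simps algebra_simps)
    then show ?thesis using ReF[OF that] ReF[OF scaleC_mem[OF that, of \<i>]]
      by (simp add: complex_eq_iff)
  qed
  define X :: "'h^4" where "X = (\<chi> i. if i = 1 then x else if i = 2 then y else if i = 3 then u else v)"
  define Y :: "'h^4" where "Y = (\<chi> i. if i = 1 then u else if i = 2 then v else if i = 3 then x else y)"
  have sumF: "(\<Sum>i\<in>UNIV. cinner (t (X $ i)) (Y $ i)) = F t" for t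
    by (simp add: sum_4 X_def Y_def F_def)
  define d where "d = x - y"
  \<comment> \<open>The reflection along \<open>x - y\<close>. For x = y the division by zero yields
    the identity, as required.\<close>
  define T where "T w = w - (2 * cinner w d / of_real ((norm d)\<^sup>2)) *\<^sub>C d" for w
  have T: "clinear T"
    by (simp add: semilinear_wrt_def T_def cinner_simps complex_vector.scale_right_diff_distrib
        scaleC_scaleC algebra_simps add_divide_distrib complex_vector.scale_left_distrib)
  have yx: "cinner y x = cinner x y" "cnj (cinner x y) = cinner x y"
    using xy(3) cinner_commute[of y x] by (simp_all add: complex_eq_iff)
  have nd: "of_real ((norm d)\<^sup>2) = 2 - 2 * cinner x y"
  proof -
    have "cinner d d = cinner x x - cinner x y - (cinner y x - cinner y y)"
      by (simp add: d_def cinner_diff_left cinner_diff_right del: cinner_self_eq_0_iff)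
    then show ?thesis by (simp add: cinner_self xy yx)
  qed
  have Tx: "T x = y" "T y = x"
  proof -
    define k where "k = 2 - 2 * cinner x y"
    have xd: "2 * cinner x d = k" and yd: "2 * cinner y d = - k"
      by (simp_all add: d_def k_def cinner_diff_right cinner_self xy yx)
    have Tk: "T w = w - (2 * cinner w d / k) *\<^sub>C d" for w
      by (simp only: T_def nd k_def)
    have "d = 0 \<or> k \<noteq> 0" using nd by (auto simp: k_def)
    then show "T x = y" "T y = x"
      by (auto simp: Tk xd yd complex_vector.scale_minus_left) (simp_all add: d_def)
  qed
  have Tsa: "cinner (T w) z = cinner w (T z)" for w z
    using cinner_commute[of d z] by (simp add: T_def cinner_simps)
  have "F T = 0"
    using annihilator_total[of X Y, OF _ T] F0 by (simp add: sumF)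
  then have "inner y u + inner x v = 0"
  proof -
    assume "F T = 0"
    then have "Re (F T) = 0" by simp
    then show ?thesis
      by (simp add: F_def Tsa Tx Re_cinner inner_commute[of u y] inner_commute[of v x])
  qed
  then have "inner ((y, x) - p) (y, x) = 0" by (simp only: uv inner_Pair inner_commute)
  moreover have "inner ((y, x) - p) p = 0" by (rule p(2)[OF p(1)])
  ultimately have "inner ((y, x) - p) ((y, x) - p) = 0" by (simp only: inner_diff_right)
  then have "(y, x) \<in> closure (?f ` ?S)" using p(1) by (simp only: inner_eq_zero_iff right_minus_eq)
  then obtain c where c: "c \<in> ?S" "dist (?f c) (y, x) < e"
    using \<open>e > 0\<close> unfolding closure_approachable by blast
  have "norm (blinfun_apply c x - y) \<le> dist (?f c) (y, x)" "norm (blinfun_apply c y - x) \<le> dist (?f c) (y, x)"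
    using dist_fst_le[of "?f c" "(y, x)"] dist_snd_le[of "?f c" "(y, x)"] by (simp_all add: dist_norm)
  then show ?thesis using that c by auto
qed

section \<open>Transitivity with norm control\<close>

text \<open>Kaplansky's contraction \<open>2 c / (1 + c\<^sup>2)\<close>.\<close>

lemma bounded_transform:
  assumes c: "c \<in> A" "adj c = c"
  obtains F where "F \<in> A" "norm F \<le> 1" "F + (c o\<^sub>L (c o\<^sub>L F)) = 2 *\<^sub>R c"
proof -
  have sa: "inner (blinfun_apply c u) v = inner u (blinfun_apply c v)" for u v
    using c inner_adj_left[OF clinear_apply[OF c(1)], of u v] by simp
  define K where "K = (norm c)\<^sup>2"
  have K0: "K \<ge> 0" by (simp add: K_def)
  have cK: "(norm (blinfun_apply c v))\<^sup>2 \<le> K * (norm v)\<^sup>2" for v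
    using power_mono[OF norm_blinfun[of c v] norm_ge_zero, of 2] by (simp add: K_def power_mult_distrib)
  have arith: "p - 2 * K * r + q \<le> p" if "q \<le> K * r" "0 \<le> K * r" for p q r :: real
    using that by (simp only: mult.assoc)
  \<comment> \<open>The fixed points of \<open>G\<close> are the solutions of the equation for
    \<open>F\<close>. With \<open>K\<close> added on both sides the map is a contraction with factor
    \<open>K / (1 + K)\<close>, as \<open>K - c\<^sup>2\<close> has norm at most \<open>K\<close>.
    Completeness of \<open>A\<close> keeps the solution in \<open>A\<close>, which need not contain
    the inverse of \<open>1 + c\<^sup>2\<close>.\<close>
  define G where "G F = (1 / (1 + K)) *\<^sub>R (2 *\<^sub>R c + (K *\<^sub>R F - (c o\<^sub>L (c o\<^sub>L F))))" for F
  have bd: "norm (K *\<^sub>R F - (c o\<^sub>L (c o\<^sub>L F))) \<le> K * norm F" for F :: "'h \<Rightarrow>\<^sub>L 'h"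
  proof (rule norm_blinfun_bound)
    fix v0
    define v where "v = blinfun_apply F v0"
    have "(norm (K *\<^sub>R v - blinfun_apply c (blinfun_apply c v)))\<^sup>2
      = K\<^sup>2 * (norm v)\<^sup>2 - 2 * K * (norm (blinfun_apply c v))\<^sup>2 + (norm (blinfun_apply c (blinfun_apply c v)))\<^sup>2"
      unfolding power2_norm_eq_inner
      by (simp add: inner_diff_left inner_diff_right inner_commute[of "blinfun_apply c (blinfun_apply c v)" v]
          sa[of v "blinfun_apply c v"] power2_eq_square algebra_simps)
    also have "\<dots> \<le> K\<^sup>2 * (norm v)\<^sup>2"
      by (rule arith[OF cK mult_nonneg_nonneg[OF K0 zero_le_power2]])
    also have "\<dots> = (K * norm v)\<^sup>2" by (simp only: power_mult_distrib)
    finally have "norm (K *\<^sub>R v - blinfun_apply c (blinfun_apply c v)) \<le> K * norm v"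
      by (rule power2_le_imp_le) (intro mult_nonneg_nonneg K0 norm_ge_zero)
    also have "\<dots> \<le> K * (norm F * norm v0)"
      unfolding v_def by (intro mult_left_mono norm_blinfun K0)
    finally show "norm (blinfun_apply (K *\<^sub>R F - (c o\<^sub>L (c o\<^sub>L F))) v0) \<le> K * norm F * norm v0"
      by (simp add: blinfun.bilinear_simps v_def mult.assoc)
  qed (simp add: K0)
  have "\<exists>!F\<in>A. G F = F"
  proof (rule Banach_fix[where c = "K / (1 + K)"])
    show "complete A" by (rule complete_A)
    show "A \<noteq> {}" using c by blast
    show "0 \<le> K / (1 + K)" "K / (1 + K) < 1" using K0 by simp_all
    show "G ` A \<subseteq> A"
      unfolding G_def using c by (auto intro!: scaleR_mem add_mem diff_mem comp_mem)
    show "dist (G x) (G y) \<le> K / (1 + K) * dist x y" if "x \<in> A" "y \<in> A" for x y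
    proof -
      have "G x - G y = (1 / (1 + K)) *\<^sub>R (K *\<^sub>R (x - y) - (c o\<^sub>L (c o\<^sub>L (x - y))))"
        by (rule blinfun_eqI) (simp add: G_def blinfun.bilinear_simps algebra_simps)
      then show ?thesis
        using bd[of "x - y"] K0 by (simp add: dist_norm divide_simps)
    qed
  qed
  then obtain F where F: "F \<in> A" "G F = F" by blast
  have "(1 + K) *\<^sub>R G F = 2 *\<^sub>R c + (K *\<^sub>R F - (c o\<^sub>L (c o\<^sub>L F)))"
    using K0 by (simp add: G_def)
  then have eq: "F + (c o\<^sub>L (c o\<^sub>L F)) = 2 *\<^sub>R c"
    unfolding F(2) by (simp add: scaleR_add_left algebra_simps)
  have "norm F \<le> 1"
  proof (rule norm_blinfun_bound)
    fix v
    define w where "w = blinfun_apply F v"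
    have w: "w + blinfun_apply c (blinfun_apply c w) = 2 *\<^sub>R blinfun_apply c v"
      using arg_cong[OF eq, of "\<lambda>t. blinfun_apply t v"] by (simp add: w_def blinfun.bilinear_simps)
    have "(norm w)\<^sup>2 + (norm (blinfun_apply c w))\<^sup>2 = inner (w + blinfun_apply c (blinfun_apply c w)) w"
      unfolding power2_norm_eq_inner using sa[of "blinfun_apply c w" w] by (simp add: inner_simps)
    also have "\<dots> = 2 * inner v (blinfun_apply c w)" unfolding w by (simp add: sa)
    also have "\<dots> \<le> 2 * (norm v * norm (blinfun_apply c w))"
      by (intro mult_left_mono norm_cauchy_schwarz) simp
    \<comment> \<open>The inequality between the means is just sharp enough: the terms with
      \<open>c w\<close> cancel, and the remaining constant is one.\<close>
    also have "\<dots> \<le> (norm v)\<^sup>2 + (norm (blinfun_apply c w))\<^sup>2"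
      unfolding mult.assoc[symmetric] by (rule sum_squares_bound)
    finally have "(norm w)\<^sup>2 \<le> (norm v)\<^sup>2" by (rule add_le_imp_le_right)
    then have "norm w \<le> norm v" by (rule power2_le_imp_le) simp
    then show "norm (blinfun_apply F v) \<le> 1 * norm v" by (simp add: w_def)
  qed simp
  then show ?thesis using that F(1) eq by blast
qed

text \<open>If \<open>c\<close> exchanged \<open>x\<close> and \<open>z\<close> exactly, Kaplansky's
  contraction would map \<open>x\<close> to \<open>z\<close>. In general the error \<open>v\<close>
  solves \<open>v + c c v = e1 - c e2\<close>, and testing this with \<open>v\<close> bounds it by
  \<open>e1\<close> and \<open>e2\<close> alone, however large \<open>c\<close> may be.\<close>

lemma contraction_near_unit:
  assumes xy: "norm x = 1" "norm y = 1" and "e > 0"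
  obtains a where "a \<in> A" "norm a \<le> 1" "norm (blinfun_apply a x - y) < e"
proof -
  \<comment> \<open>The phase makes \<open>cinner x z\<close> real, as the exchange of
    \<open>x\<close> and \<open>z\<close> requires; it is removed at the end by
    \<open>cnj s\<close>.\<close>
  define s where "s = (if cinner x y = 0 then 1 else sgn (cinner x y))"
  have s1: "cmod s = 1" by (simp add: s_def norm_sgn)
  define z where "z = s *\<^sub>C y"
  have nz: "norm z = 1" by (simp add: z_def norm_scaleC s1 xy)
  have "cinner x z = complex_of_real (cmod (cinner x y))"
    by (simp add: z_def cinner_scaleC_right s_def sgn_eq complex_norm_square[symmetric] power2_eq_square mult.commute)
  then have "Im (cinner x z) = 0" by simp
  \<comment> \<open>Half of \<open>e\<close> suffices, since the squared error will be at most the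
    sum of the two squares.\<close>
  then obtain c where c: "c \<in> A" "adj c = c" "norm (blinfun_apply c x - z) < e / 2" "norm (blinfun_apply c z - x) < e / 2"
    using selfadjoint_exchange[OF xy(1) nz, of "e/2"] \<open>e > 0\<close> by auto
  obtain F where F: "F \<in> A" "norm F \<le> 1" "F + (c o\<^sub>L (c o\<^sub>L F)) = 2 *\<^sub>R c"
    using bounded_transform[OF c(1,2)] by blast
  have sa: "inner (blinfun_apply c u) v = inner u (blinfun_apply c v)" for u v
    using c inner_adj_left[OF clinear_apply[OF c(1)], of u v] by simp
  define v where "v = blinfun_apply F x - z"
  define e1 where "e1 = blinfun_apply c x - z"
  define e2 where "e2 = blinfun_apply c z - x"
  have "blinfun_apply F x + blinfun_apply c (blinfun_apply c (blinfun_apply F x)) = 2 *\<^sub>R blinfun_apply c x"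
    using arg_cong[OF F(3), of "\<lambda>t. blinfun_apply t x"] by (simp add: blinfun.bilinear_simps)
  then have v: "v + blinfun_apply c (blinfun_apply c v) = e1 - blinfun_apply c e2"
    by (simp add: v_def e1_def e2_def blinfun.bilinear_simps scaleR_2 algebra_simps)
  have "(norm v)\<^sup>2 + (norm (blinfun_apply c v))\<^sup>2 = inner (v + blinfun_apply c (blinfun_apply c v)) v"
    unfolding power2_norm_eq_inner using sa[of "blinfun_apply c v" v] by (simp add: inner_simps)
  also have "\<dots> = inner e1 v - inner e2 (blinfun_apply c v)" unfolding v by (simp add: inner_simps sa)
  also have "\<dots> \<le> (norm e1 * norm v) + (norm e2 * norm (blinfun_apply c v))"
    using norm_cauchy_schwarz[of e1 v] norm_cauchy_schwarz[of "- e2" "blinfun_apply c v"] by simp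
  also have "\<dots> \<le> ((norm e1)\<^sup>2 + (norm v)\<^sup>2) / 2 + ((norm e2)\<^sup>2 + (norm (blinfun_apply c v))\<^sup>2) / 2"
    using sum_squares_bound[of "norm e1" "norm v"] sum_squares_bound[of "norm e2" "norm (blinfun_apply c v)"]
    by (simp add: field_simps)
  finally have le: "(norm v)\<^sup>2 + (norm (blinfun_apply c v))\<^sup>2
      \<le> ((norm e1)\<^sup>2 + (norm v)\<^sup>2) / 2 + ((norm e2)\<^sup>2 + (norm (blinfun_apply c v))\<^sup>2) / 2" .
  have "p \<le> r + t" if "p + q \<le> (r + p) / 2 + (t + q) / 2" "0 \<le> q" for p q r t :: real
    using that by (simp add: field_simps)
  from this[OF le] have "(norm v)\<^sup>2 \<le> (norm e1)\<^sup>2 + (norm e2)\<^sup>2" by simp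
  also have "\<dots> \<le> (e/2)\<^sup>2 + (e/2)\<^sup>2"
    using c(3,4) by (intro add_mono power_mono) (auto simp: e1_def e2_def)
  also have "\<dots> < e\<^sup>2" using \<open>e > 0\<close> by (simp add: power2_eq_square field_simps)
  finally have ve: "norm v < e" using \<open>e > 0\<close> by (simp add: power_less_imp_less_base)
  have "cnj s * s = 1" using complex_norm_square[of s] s1 by (simp add: mult.commute)
  then have "blinfun_apply (cnj s *\<^sub>C F) x - y = cnj s *\<^sub>C v"
    by (simp add: v_def z_def blinfun_apply_scaleC complex_vector.scale_right_diff_distrib scaleC_scaleC)
  then show ?thesis
    by (intro that[of "cnj s *\<^sub>C F"]) (use F ve s1 in \<open>auto simp: scaleC_mem norm_scaleC\<close>)
qed

lemma approximate_transitivity: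
  assumes "x \<noteq> 0" and "e > 0"
  obtains a where "a \<in> A" "norm a \<le> norm z / norm x" "norm (blinfun_apply a x - z) < e"
proof (cases "z = 0")
  case True then show ?thesis using that[of 0] zero_mem \<open>e > 0\<close> by simp
next
  case False
  define x' where "x' = inverse (norm x) *\<^sub>R x"
  define z' where "z' = inverse (norm z) *\<^sub>R z"
  have n: "norm x' = 1" "norm z' = 1" using False assms by (simp_all add: x'_def z'_def)
  obtain a where a: "a \<in> A" "norm a \<le> 1" "norm (blinfun_apply a x' - z') < e / norm z"
    using contraction_near_unit[OF n, of "e / norm z"] False \<open>e > 0\<close> by auto
  let ?a = "(norm z / norm x) *\<^sub>R a"
  have "blinfun_apply ?a x - z = norm z *\<^sub>R (blinfun_apply a x' - z')"
    using False assms by (simp add: x'_def z'_def blinfun.bilinear_simps scaleR_diff_right divide_inverse)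
  then have "norm (blinfun_apply ?a x - z) = norm z * norm (blinfun_apply a x' - z')" by simp
  also have "\<dots> < e" using a(3) False by (simp add: field_simps)
  finally show ?thesis
    using a(1,2) by (intro that[of ?a]) (auto simp: scaleR_mem divide_right_mono mult_left_le)
qed

text \<open>Successive approximation: each element corrects the remainder left by its predecessors.
  The norm bound on the approximants makes the series converge in norm within \<open>A\<close>, and
  all terms after the first together cost at most \<open>e\<close>.\<close>

lemma transitivity:
  assumes "x \<noteq> 0" and "e > 0"
  obtains a where "a \<in> A" "blinfun_apply a x = z" "norm a \<le> norm z / norm x + e"
proof -
  \<comment> \<open>With this \<open>d\<close> the correction number \<open>n + 1\<close> has norm
    at most \<open>(e / 2) * (1 / 2) ^ n\<close>, and these bounds sum to \<open>e\<close>.\<close>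
  define d where "d = e * norm x / 2"
  have d: "d > 0" using assms by (simp add: d_def)
  have "\<forall>z n. \<exists>a. a \<in> A \<and> norm a \<le> norm z / norm x \<and> norm (blinfun_apply a x - z) < d / 2 ^ n"
    using approximate_transitivity[OF assms(1)] d by (metis divide_pos_pos zero_less_numeral zero_less_power)
  then obtain g where g: "\<And>z n. g z n \<in> A" "\<And>z n. norm (g z n) \<le> norm z / norm x"
    "\<And>z n. norm (blinfun_apply (g z n) x - z) < d / 2 ^ n" by metis
  define r where "r = rec_nat z (\<lambda>n v. v - blinfun_apply (g v n) x)"
  have r0: "r 0 = z" and rS: "r (Suc n) = r n - blinfun_apply (g (r n) n) x" for n by (simp_all add: r_def)
  define f where "f n = g (r n) n" for n
  have rn: "norm (r (Suc n)) < d / 2 ^ n" for n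
    using g(3)[of "r n" n] by (simp add: rS norm_minus_commute)
  have fA: "f n \<in> A" for n by (simp add: f_def g)
  have fS: "norm (f (Suc n)) \<le> (e / 2) * (1 / 2) ^ n" for n
  proof -
    have "norm (f (Suc n)) \<le> norm (r (Suc n)) / norm x" by (simp add: f_def g)
    also have "\<dots> \<le> (d / 2 ^ n) / norm x" using rn[of n] by (intro divide_right_mono) auto
    also have "\<dots> = (e / 2) * (1 / 2) ^ n" using assms by (simp add: d_def power_divide)
    finally show ?thesis .
  qed
  have geo: "(\<lambda>n. (e / 2) * (1 / 2) ^ n) sums e"
    using sums_mult[OF geometric_sums[of "1/2 :: real"], of "e/2"] by simp
  have sumS: "summable (\<lambda>n. norm (f (Suc n)))"
    by (rule summable_comparison_test'[OF sums_summable[OF geo], of 0]) (use fS in simp)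
  then have sumn: "summable (\<lambda>n. norm (f n))" by (subst (asm) summable_Suc_iff)
  then have sumf: "summable f" by (rule summable_norm_cancel)
  define a where "a = suminf f"
  have lim: "(\<lambda>n. \<Sum>k<n. f k) \<longlonglongrightarrow> a" unfolding a_def by (rule summable_LIMSEQ[OF sumf])
  have part: "(\<Sum>k<n. f k) \<in> A" for n by (induction n) (auto simp: zero_mem add_mem fA)
  then have "a \<in> A" using closed_sequentially[OF closed_A, of "\<lambda>n. \<Sum>k<n. f k" a] lim by simp
  moreover have "blinfun_apply a x = z"
  proof -
    have "blinfun_apply (\<Sum>k<n. f k) x = z - r n" for n
      by (induction n) (simp_all add: r0 rS f_def blinfun.add_left)
    moreover have "r \<longlonglongrightarrow> 0"
    proof -
      have "(\<lambda>n. r (Suc n)) \<longlonglongrightarrow> 0"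
      proof (rule Lim_null_comparison)
        show "\<forall>\<^sub>F n in sequentially. norm (r (Suc n)) \<le> d * (1 / 2) ^ n"
          using rn by (auto intro!: always_eventually less_imp_le simp: power_divide)
        show "(\<lambda>n. d * (1 / 2) ^ n) \<longlonglongrightarrow> 0"
          by (intro tendsto_mult_right_zero LIMSEQ_power_zero) simp
      qed
      then show ?thesis by (rule LIMSEQ_imp_Suc)
    qed
    ultimately have "(\<lambda>n. blinfun_apply (\<Sum>k<n. f k) x) \<longlonglongrightarrow> z - 0" by (simp only:) (intro tendsto_intros)
    moreover have "(\<lambda>n. blinfun_apply (\<Sum>k<n. f k) x) \<longlonglongrightarrow> blinfun_apply a x"
      by (intro tendsto_intros lim)
    ultimately show ?thesis using LIMSEQ_unique by fastforce
  qed
  moreover have "norm a \<le> norm z / norm x + e"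
  proof -
    have "norm a \<le> (\<Sum>n. norm (f n))" unfolding a_def by (rule summable_norm[OF sumn])
    also have "\<dots> = norm (f 0) + (\<Sum>n. norm (f (Suc n)))"
      using suminf_split_head[OF sumn] by simp
    also have "\<dots> \<le> norm z / norm x + e"
    proof (rule add_mono)
      show "norm (f 0) \<le> norm z / norm x" using g(2)[of z 0] by (simp add: f_def r0)
      show "(\<Sum>n. norm (f (Suc n))) \<le> e"
        using suminf_le[OF fS sumS sums_summable[OF geo]] sums_unique[OF geo] by simp
    qed
    finally show ?thesis .
  qed
  ultimately show ?thesis using that by blast
qed

end

section \<open>Vector functionals are extreme\<close>

text \<open>The right-hand side exceeds 1 only to second order in \<open>s\<close>, so that no
  linear gain is possible. In this form a functional that attains its norm in one direction is shown
  to vanish in an orthogonal one.\<close>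

lemma slope_nonpos:
  fixes r K :: real
  assumes "\<And>s. s > 0 \<Longrightarrow> 1 + s * r \<le> sqrt (1 + s\<^sup>2 * K)" "K \<ge> 0"
  shows "r \<le> 0"
proof (rule ccontr)
  assume "\<not> r \<le> 0"
  then have r: "r > 0" by simp
  define s where "s = r / (1 + K)"
  have s: "s > 0" using r assms(2) by (simp add: s_def)
  have "(1 + s * r)\<^sup>2 \<le> (sqrt (1 + s\<^sup>2 * K))\<^sup>2"
    using assms(1)[OF s] s r by (intro power_mono) auto
  also have "\<dots> = 1 + s\<^sup>2 * K" using assms(2) by simp
  finally have "2 * (s * r) + s * r * (s * r) \<le> s * (s * K)"
    by (simp add: power2_eq_square algebra_simps)
  moreover have "s * r * (s * r) \<ge> 0" by simp
  ultimately have "s * (2 * r) \<le> s * (s * K)" by (simp add: algebra_simps)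
  then have "2 * r \<le> s * K" using s by simp
  also have "s * K \<le> r"
    using r assms(2) by (simp add: s_def field_simps)
  finally show False using r by simp
qed

lemma dual_ballD:
  assumes "\<rho> \<in> dual_unit_ball A"
  shows "a \<in> A \<Longrightarrow> b \<in> A \<Longrightarrow> \<rho> (a + b) = \<rho> a + \<rho> b" "a \<in> A \<Longrightarrow> \<rho> (c *\<^sub>C a) = c * \<rho> a"
    "a \<in> A \<Longrightarrow> cmod (\<rho> a) \<le> norm a" "a \<notin> A \<Longrightarrow> \<rho> a = 0"
  using assms by (auto simp: dual_unit_ball_def)

text \<open>The map \<open>1 - adj c c\<close> not only contracts but loses at least the square of
  the norm of \<open>c v\<close>; over its iterates these losses telescope.\<close>

lemma contraction_step:
  assumes c: "clinear (blinfun_apply c)" "norm c \<le> 1"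
  shows "(norm (v - blinfun_apply (adj c) (blinfun_apply c v)))\<^sup>2 \<le> (norm v)\<^sup>2 - (norm (blinfun_apply c v))\<^sup>2"
proof -
  let ?w = "blinfun_apply (adj c) (blinfun_apply c v)"
  have "norm ?w \<le> norm (adj c) * norm (blinfun_apply c v)" by (rule norm_blinfun)
  also have "\<dots> \<le> 1 * norm (blinfun_apply c v)"
    using c by (intro mult_right_mono) (auto simp: norm_adj)
  finally have w: "(norm ?w)\<^sup>2 \<le> (norm (blinfun_apply c v))\<^sup>2" by (intro power_mono) auto
  have "inner v ?w = (norm (blinfun_apply c v))\<^sup>2"
    using c by (simp add: inner_adj_right power2_norm_eq_inner)
  then have "(norm (v - ?w))\<^sup>2 = (norm v)\<^sup>2 - 2 * (norm (blinfun_apply c v))\<^sup>2 + (norm ?w)\<^sup>2"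
    unfolding power2_norm_eq_inner by (simp add: inner_diff_left inner_diff_right inner_commute[of ?w v])
  with w show ?thesis by linarith
qed

lemma sgn_multiple: "\<exists>l. cmod l \<le> 1 \<and> l * z = complex_of_real (cmod z)"
proof (cases "z = 0")
  case False
  have "cnj (sgn z) * z = complex_of_real (cmod z)"
    using False by (simp add: sgn_eq complex_norm_square[symmetric] power2_eq_square mult.commute)
  then show ?thesis by (intro exI[of _ "cnj (sgn z)"]) (simp add: norm_sgn)
qed (auto intro: exI[of _ 0])

context irreducible_algebra
begin

text \<open>The elements \<open>w n = u (1 - c\<^sup>* c)\<^sup>n\<close> satisfy \<open>w n x = u x\<close>, while \<open>c (w n)\<^sup>*\<close> tends to zero
  in norm, so that the norm of \<open>w n + l c\<close> is at most about \<open>sqrt (1 + \<bar>l\<bar>\<^sup>2)\<close>.\<close>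

lemma convex_component_vanishes_contraction:
  assumes x: "norm x = 1" and y: "norm y = 1" and t: "0 < t" "t < (1::real)"
    and \<rho>: "\<rho>1 \<in> dual_unit_ball A" "\<rho>2 \<in> dual_unit_ball A"
    and conv: "\<And>a. a \<in> A \<Longrightarrow> cinner (blinfun_apply a x) y = of_real (1 - t) * \<rho>1 a + of_real t * \<rho>2 a"
    and c: "c \<in> A" "norm c \<le> 1" "blinfun_apply c x = 0"
  shows "\<rho>1 c = 0"
proof -
  obtain l where l: "cmod l \<le> 1" "l * \<rho>1 c = complex_of_real (cmod (\<rho>1 c))"
    using sgn_multiple by blast
  note cl = clinear_apply[OF c(1)]
  \<comment> \<open>The functional with vectors \<open>x\<close>, \<open>y\<close> takes the value
    \<open>1 - d\<close> at \<open>w n\<close>, so its component \<open>\<rho>1\<close> is nearly 1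
    there because \<open>\<rho>2\<close> is at most 1. Adding a multiple of \<open>c\<close> raises
    \<open>\<rho>1\<close> linearly in \<open>s\<close>, but the norm only to second order once
    \<open>n\<close> is large.\<close>
  have bound: "1 - d / (1 - t) + s * cmod (\<rho>1 c) \<le> sqrt (1 + s\<^sup>2 + 2 * s / sqrt (real (Suc n)))"
    if s: "s > 0" and d: "0 < d" "d < 1" for s d n
  proof -
    \<comment> \<open>Transitivity overshoots the norm by an arbitrarily small amount; aiming at
      \<open>(1 - d) *\<^sub>R y\<close> leaves room for it.\<close>
    obtain u where u: "u \<in> A" "blinfun_apply u x = (1 - d) *\<^sub>R y" "norm u \<le> 1"
      using transitivity[of x d "(1 - d) *\<^sub>R y"] x y d by force
    define w where "w = rec_nat u (\<lambda>_ v. v - (v o\<^sub>L (adj c o\<^sub>L c)))"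
    have w0: "w 0 = u" and wS: "w (Suc k) = w k - (w k o\<^sub>L (adj c o\<^sub>L c))" for k by (simp_all add: w_def)
    have wA: "w k \<in> A" for k
      by (induction k) (auto simp: w0 wS u c diff_mem comp_mem adj_mem)
    have wx: "blinfun_apply (w k) x = (1 - d) *\<^sub>R y" for k
      by (induction k) (simp_all add: w0 wS u c blinfun.diff_left)
    define l' where "l' = of_real s * l"
    define g where "g = w n + l' *\<^sub>C c"
    have gA: "g \<in> A" by (simp add: g_def add_mem wA scaleC_mem c)
    have l's: "cmod l' \<le> s" using l s by (simp add: l'_def norm_mult mult_left_le)
    \<comment> \<open>The adjoint is estimated because there the powers of
      \<open>1 - adj c c\<close> act last, after \<open>adj u\<close>, so that the iterates
      \<open>p k\<close> of a single vector can be followed.\<close>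
    have "norm (adj g) \<le> sqrt (1 + s\<^sup>2 + 2 * s / sqrt (real (Suc n)))"
    proof (rule norm_blinfun_bound)
      fix v
      define p where "p k = blinfun_apply (adj (w k)) v" for k
      have pS: "p (Suc k) = p k - blinfun_apply (adj c) (blinfun_apply c (p k))" for k
      proof (rule cinner_ext)
        fix z
        show "cinner (p (Suc k)) z = cinner (p k - blinfun_apply (adj c) (blinfun_apply c (p k))) z"
          using wA[of k] wA[of "Suc k"] cl
          by (simp add: p_def cinner_adj_left clinear_apply cinner_diff_left)
            (simp add: wS blinfun.diff_left cinner_diff_right cinner_adj_left[symmetric] cinner_adj_right clinear_apply clinear_adj adj_adj
              del: cinner_adj_left)
      qed
      have pn: "(norm (p (Suc k)))\<^sup>2 \<le> (norm (p k))\<^sup>2 - (norm (blinfun_apply c (p k)))\<^sup>2" for k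
        unfolding pS by (rule contraction_step[OF cl c(2)])
      have cpn: "(norm (blinfun_apply c (p (Suc k))))\<^sup>2 \<le> (norm (blinfun_apply c (p k)))\<^sup>2" for k
      proof -
        have "(norm (blinfun_apply c (p k) - blinfun_apply (adj (adj c)) (blinfun_apply (adj c) (blinfun_apply c (p k)))))\<^sup>2
          \<le> (norm (blinfun_apply c (p k)))\<^sup>2 - (norm (blinfun_apply (adj c) (blinfun_apply c (p k))))\<^sup>2"
          by (rule contraction_step) (simp_all add: clinear_adj cl norm_adj c)
        then show ?thesis
          using zero_le_power2[of "norm (blinfun_apply (adj c) (blinfun_apply c (p k)))"]
          unfolding pS blinfun.diff_right adj_adj[OF cl] by linarith
      qed
      have p0: "(norm (p 0))\<^sup>2 \<le> (norm v)\<^sup>2"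
      proof (intro power_mono norm_ge_zero)
        have "norm (p 0) \<le> norm (adj u) * norm v" by (simp add: p_def w0 norm_blinfun)
        also have "\<dots> \<le> 1 * norm v" using u by (intro mult_right_mono) (auto simp: norm_adj clinear_apply)
        finally show "norm (p 0) \<le> norm v" by simp
      qed
      \<comment> \<open>The losses do not increase with \<open>k\<close>, so \<open>k\<close> copies
        of the current one are covered by the telescoping sum.\<close>
      have key: "(norm (p k))\<^sup>2 + real k * (norm (blinfun_apply c (p k)))\<^sup>2 \<le> (norm v)\<^sup>2" for k
      proof (induction k)
        case 0 then show ?case using p0 by simp
      next
        case (Suc k)
        have "real (Suc k) * (norm (blinfun_apply c (p (Suc k))))\<^sup>2 \<le> real (Suc k) * (norm (blinfun_apply c (p k)))\<^sup>2"
          by (intro mult_left_mono cpn) simp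
        also have "\<dots> = real k * (norm (blinfun_apply c (p k)))\<^sup>2 + (norm (blinfun_apply c (p k)))\<^sup>2"
          by (simp add: algebra_simps)
        finally show ?case using Suc pn[of k] by linarith
      qed
      have "real n * (norm (blinfun_apply c (p n)))\<^sup>2 \<ge> 0" by simp
      then have "(norm (p n))\<^sup>2 \<le> (norm v)\<^sup>2" using key[of n] by linarith
      then have "norm (p n) \<le> norm v" by (rule power2_le_imp_le) simp
      \<comment> \<open>One further copy comes from the bound of \<open>c (p n)\<close> by
        \<open>p n\<close>. With \<open>Suc n\<close> in the denominator, n = 0 is no
        exception.\<close>
      have cp_le: "norm (blinfun_apply c (p n)) \<le> norm v / sqrt (real (Suc n))"
      proof (rule power2_le_imp_le)
        have "real (Suc n) * (norm (blinfun_apply c (p n)))\<^sup>2 = real n * (norm (blinfun_apply c (p n)))\<^sup>2 + (norm (blinfun_apply c (p n)))\<^sup>2"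
          by (simp add: algebra_simps)
        also have "\<dots> \<le> real n * (norm (blinfun_apply c (p n)))\<^sup>2 + (norm (p n))\<^sup>2"
        proof -
          have "norm (blinfun_apply c (p n)) \<le> norm c * norm (p n)" by (rule norm_blinfun)
          also have "\<dots> \<le> 1 * norm (p n)" using c by (intro mult_right_mono) auto
          finally have "(norm (blinfun_apply c (p n)))\<^sup>2 \<le> (norm (p n))\<^sup>2" by (intro power_mono) auto
          then show ?thesis by simp
        qed
        also have "\<dots> \<le> (norm v)\<^sup>2" using key[of n] by simp
        finally show "(norm (blinfun_apply c (p n)))\<^sup>2 \<le> (norm v / sqrt (real (Suc n)))\<^sup>2"
          by (simp add: power_divide field_simps)
      qed simp
      define q where "q = cnj l' *\<^sub>C blinfun_apply (adj c) v"
      have adjg: "blinfun_apply (adj g) v = p n + q"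
      proof (rule cinner_ext)
        fix z
        show "cinner (blinfun_apply (adj g) v) z = cinner (p n + q) z"
          using gA wA[of n] cl
          by (simp add: cinner_adj_left clinear_apply cinner_add_left p_def q_def cinner_scaleC_left)
            (simp add: g_def blinfun.add_left blinfun_apply_scaleC cinner_add_right cinner_scaleC_right)
      qed
      have "norm (blinfun_apply (adj c) v) \<le> norm (adj c) * norm v" by (rule norm_blinfun)
      also have "\<dots> \<le> 1 * norm v" using c by (intro mult_right_mono) (auto simp: norm_adj clinear_apply)
      finally have "norm q \<le> s * norm v"
        using l's by (simp add: q_def norm_scaleC mult_mono')
      have "inner (p n) q \<le> s * norm v / sqrt (real (Suc n)) * norm v"
      proof -
        have "inner (p n) q \<le> cmod (cinner (p n) q)" by (metis Re_cinner complex_Re_le_cmod)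
        also have "cinner (p n) q = l' * cinner (blinfun_apply c (p n)) v"
          by (simp add: q_def cinner_scaleC_right cinner_adj_right cl)
        also have "cmod \<dots> \<le> s * (norm v / sqrt (real (Suc n)) * norm v)"
          unfolding norm_mult
        proof (intro mult_mono l's)
          show "cmod (cinner (blinfun_apply c (p n)) v) \<le> norm v / sqrt (real (Suc n)) * norm v"
            by (rule order_trans[OF cinner_norm_le]) (intro mult_right_mono cp_le norm_ge_zero)
        qed (use s in auto)
        finally show ?thesis by (simp add: mult.assoc)
      qed
      have "(norm (p n + q))\<^sup>2 = (norm (p n))\<^sup>2 + (norm q)\<^sup>2 + 2 * inner (p n) q"
        unfolding power2_norm_eq_inner by (simp add: inner_add_left inner_add_right inner_commute[of q "p n"])
      also have "\<dots> \<le> (norm v)\<^sup>2 + (s * norm v)\<^sup>2 + 2 * (s * norm v / sqrt (real (Suc n)) * norm v)"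
        by (intro add_mono power_mono mult_left_mono) (fact | simp)+
      also have "\<dots> = (1 + s\<^sup>2 + 2 * s / sqrt (real (Suc n))) * (norm v)\<^sup>2"
        by (simp add: power2_eq_square algebra_simps)
      also have "\<dots> = (sqrt (1 + s\<^sup>2 + 2 * s / sqrt (real (Suc n))) * norm v)\<^sup>2"
        using s by (simp add: power_mult_distrib)
      finally show "norm (blinfun_apply (adj g) v) \<le> sqrt (1 + s\<^sup>2 + 2 * s / sqrt (real (Suc n))) * norm v"
        unfolding adjg by (rule power2_le_imp_le) (use s in simp)
    qed (use s in simp)
    then have "cmod (\<rho>1 g) \<le> sqrt (1 + s\<^sup>2 + 2 * s / sqrt (real (Suc n)))"
      using dual_ballD(3)[OF \<rho>(1) gA] by (simp add: norm_adj clinear_apply gA)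
    moreover have "\<rho>1 g = \<rho>1 (w n) + of_real (s * cmod (\<rho>1 c))"
      using dual_ballD(1,2)[OF \<rho>(1)] wA c l(2) by (simp add: g_def scaleC_mem l'_def mult.assoc)
    moreover have "1 - d / (1 - t) \<le> Re (\<rho>1 (w n))"
    proof -
      have nw: "norm (w n) \<le> 1"
      proof -
        have "norm (w k) \<le> 1" for k
        proof (induction k)
          case 0 then show ?case using u by (simp add: w0)
        next
          case (Suc k)
          show ?case
          proof (rule norm_blinfun_bound)
            fix v
            let ?b = "v - blinfun_apply (adj c) (blinfun_apply c v)"
            have "(norm ?b)\<^sup>2 \<le> (norm v)\<^sup>2"
              using contraction_step[OF cl c(2), of v] zero_le_power2[of "norm (blinfun_apply c v)"] by linarith
            then have b: "norm ?b \<le> norm v" by (rule power2_le_imp_le) simp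
            have "blinfun_apply (w (Suc k)) v = blinfun_apply (w k) ?b"
              by (simp add: wS blinfun.bilinear_simps)
            also have "norm \<dots> \<le> norm (w k) * norm ?b" by (rule norm_blinfun)
            also have "\<dots> \<le> 1 * norm v" using Suc b by (intro mult_mono) auto
            finally show "norm (blinfun_apply (w (Suc k)) v) \<le> 1 * norm v" .
          qed simp
        qed
        then show ?thesis .
      qed
      have "Re (\<rho>2 (w n)) \<le> 1"
        using dual_ballD(3)[OF \<rho>(2) wA[of n]] nw complex_Re_le_cmod[of "\<rho>2 (w n)"] by linarith
      then have "t * Re (\<rho>2 (w n)) \<le> t * 1" using t by (intro mult_left_mono) auto
      moreover have "1 - d = (1 - t) * Re (\<rho>1 (w n)) + t * Re (\<rho>2 (w n))"
        using arg_cong[OF conv[OF wA[of n]], of Re]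
        by (simp add: wx Re_cinner power2_norm_eq_inner[symmetric] y)
      ultimately have "(1 - t) - d \<le> (1 - t) * Re (\<rho>1 (w n))" by linarith
      then have "((1 - t) - d) / (1 - t) \<le> Re (\<rho>1 (w n))"
        using t by (simp add: divide_le_eq mult.commute)
      then show ?thesis using t by (simp add: diff_divide_distrib)
    qed
    ultimately show ?thesis
      using complex_Re_le_cmod[of "\<rho>1 g"] by simp
  qed
  have "1 + s * cmod (\<rho>1 c) \<le> sqrt (1 + s\<^sup>2 * 1)" if s: "s > 0" for s
  proof (rule LIMSEQ_le)
    \<comment> \<open>The index is shifted by two because \<open>bound\<close> asks for
      \<open>d < 1\<close>.\<close>
    let ?d = "\<lambda>n. inverse (real (Suc (Suc n)))"
    have d: "?d \<longlonglongrightarrow> 0" using LIMSEQ_Suc[OF LIMSEQ_inverse_real_of_nat] by simp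
    have "(\<lambda>n. 1 - ?d n / (1 - t) + s * cmod (\<rho>1 c)) \<longlonglongrightarrow> 1 - 0 / (1 - t) + s * cmod (\<rho>1 c)"
      by (intro tendsto_intros d) (use t in simp)
    then show "(\<lambda>n. 1 - ?d n / (1 - t) + s * cmod (\<rho>1 c)) \<longlonglongrightarrow> 1 + s * cmod (\<rho>1 c)" by simp
    have "(\<lambda>n. sqrt (inverse (real (Suc n)))) \<longlonglongrightarrow> sqrt 0"
      by (intro tendsto_intros LIMSEQ_inverse_real_of_nat)
    then have q: "(\<lambda>n. 2 * s * sqrt (inverse (real (Suc n)))) \<longlonglongrightarrow> 2 * s * 0"
      by (intro tendsto_intros) simp
    have "(\<lambda>n. sqrt (1 + s\<^sup>2 + 2 * s * sqrt (inverse (real (Suc n))))) \<longlonglongrightarrow> sqrt (1 + s\<^sup>2 + 2 * s * 0)"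
      by (intro tendsto_intros q)
    then show "(\<lambda>n. sqrt (1 + s\<^sup>2 + 2 * s / sqrt (real (Suc n)))) \<longlonglongrightarrow> sqrt (1 + s\<^sup>2 * 1)"
      by (simp add: real_sqrt_inverse divide_inverse)
    show "\<exists>N. \<forall>n\<ge>N. 1 - ?d n / (1 - t) + s * cmod (\<rho>1 c) \<le> sqrt (1 + s\<^sup>2 + 2 * s / sqrt (real (Suc n)))"
      using bound[OF s] by (intro exI[of _ 0] allI impI) (auto simp: inverse_less_1_iff)
  qed
  then have "cmod (\<rho>1 c) \<le> 0" by (rule slope_nonpos) simp_all
  then show ?thesis by simp
qed

lemma convex_component_vanishes:
  assumes x: "norm x = 1" and y: "norm y = 1" and t: "0 < t" "t < (1::real)"
    and \<rho>: "\<rho>1 \<in> dual_unit_ball A" "\<rho>2 \<in> dual_unit_ball A"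
    and conv: "\<And>a. a \<in> A \<Longrightarrow> cinner (blinfun_apply a x) y = of_real (1 - t) * \<rho>1 a + of_real t * \<rho>2 a"
    and c: "c \<in> A" "blinfun_apply c x = 0"
  shows "\<rho>1 c = 0"
proof -
  define r where "r = inverse (1 + norm c)"
  have r: "r > 0" "r * norm c \<le> 1"
    using add_pos_nonneg[of 1 "norm c"] by (simp_all add: r_def inverse_eq_divide divide_le_eq_1_pos)
  have "\<rho>1 (complex_of_real r *\<^sub>C c) = 0"
    by (rule convex_component_vanishes_contraction[OF x y t \<rho> conv])
      (use c r in \<open>auto simp: scaleC_mem norm_scaleC blinfun_apply_scaleC\<close>)
  then show ?thesis using dual_ballD(2)[OF \<rho>(1) c(1)] r by simp
qed

text \<open>Where \<open>a x\<close> vanishes, both components vanish; by transitivity they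
  therefore depend on \<open>a x\<close> alone and are bounded by its norm. So they come from
  functionals of norm at most one on the Hilbert space, averaging to the inner product with the unit
  vector \<open>y\<close>, which is extreme among these.\<close>

lemma convex_component_eq:
  assumes x: "norm x = 1" and y: "norm y = 1" and t: "0 < t" "t < (1::real)"
    and \<rho>: "\<rho>1 \<in> dual_unit_ball A" "\<rho>2 \<in> dual_unit_ball A"
    and conv: "\<And>a. a \<in> A \<Longrightarrow> cinner (blinfun_apply a x) y = of_real (1 - t) * \<rho>1 a + of_real t * \<rho>2 a"
    and a: "a \<in> A"
  shows "\<rho>1 a = cinner (blinfun_apply a x) y"
proof -
  have t': "0 < 1 - t" "1 - t < 1" using t by simp_all
  have conv': "cinner (blinfun_apply a x) y = of_real (1 - (1 - t)) * \<rho>2 a + of_real (1 - t) * \<rho>1 a" if "a \<in> A" for a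
    using conv[OF that] by simp
  \<comment> \<open>Any \<open>b'\<close> with the same value at \<open>x\<close> may replace
    \<open>b\<close>, and its norm can be taken close to that of \<open>b x\<close>.\<close>
  have le: "cmod (\<rho> b) \<le> norm (blinfun_apply b x)"
    if \<rho>': "\<rho> \<in> dual_unit_ball A" and z: "\<And>c. c \<in> A \<Longrightarrow> blinfun_apply c x = 0 \<Longrightarrow> \<rho> c = 0" and b: "b \<in> A" for \<rho> b
  proof (rule field_le_epsilon)
    fix e :: real assume "e > 0"
    then obtain b' where b': "b' \<in> A" "blinfun_apply b' x = blinfun_apply b x" "norm b' \<le> norm (blinfun_apply b x) + e"
      using transitivity[of x e "blinfun_apply b x"] x by force
    have "\<rho> (b - b') = 0" using b b' by (intro z) (auto simp: diff_mem blinfun.diff_left)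
    moreover have "\<rho> b = \<rho> (b - b') + \<rho> b'"
      using dual_ballD(1)[OF \<rho>' diff_mem[OF b b'(1)] b'(1)] by simp
    ultimately show "cmod (\<rho> b) \<le> norm (blinfun_apply b x) + e"
      using dual_ballD(3)[OF \<rho>' b'(1)] b'(3) by simp
  qed
  have le1: "cmod (\<rho>1 b) \<le> norm (blinfun_apply b x)" if "b \<in> A" for b
    by (rule le[OF \<rho>(1) convex_component_vanishes[OF x y t \<rho> conv] that])
  have le2: "cmod (\<rho>2 b) \<le> norm (blinfun_apply b x)" if "b \<in> A" for b
    by (rule le[OF \<rho>(2) convex_component_vanishes[OF x y t' \<rho>(2,1) conv'] that])
  obtain u where u: "u \<in> A" "blinfun_apply u x = y"
    by (rule transitivity[of x 1 y]) (use x in auto)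
  have "Re (\<rho>1 u) \<le> 1" "Re (\<rho>2 u) \<le> 1"
    using le1[OF u(1)] le2[OF u(1)] complex_Re_le_cmod[of "\<rho>1 u"] complex_Re_le_cmod[of "\<rho>2 u"] by (simp_all add: u y)
  moreover have "1 = (1 - t) * Re (\<rho>1 u) + t * Re (\<rho>2 u)"
    using arg_cong[OF conv[OF u(1)], of Re] by (simp add: u y Re_cinner power2_norm_eq_inner[symmetric])
  moreover have "t * Re (\<rho>2 u) \<le> t * 1" using t calculation(2) by (intro mult_left_mono) auto
  ultimately have "(1 - t) * 1 \<le> (1 - t) * Re (\<rho>1 u)" by simp
  then have "Re (\<rho>1 u) = 1" using t \<open>Re (\<rho>1 u) \<le> 1\<close> by simp
  moreover have "(Re (\<rho>1 u))\<^sup>2 + (Im (\<rho>1 u))\<^sup>2 \<le> 1"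
    using le1[OF u(1)] power_le_one[OF norm_ge_zero, of "\<rho>1 u" 2] by (simp add: u y cmod_power2[symmetric])
  ultimately have u1: "\<rho>1 u = 1" by (simp add: complex_eq_iff)
  \<comment> \<open>Moving from \<open>u\<close> in the direction of \<open>b\<close> changes the
    norm of the value at \<open>x\<close> only to second order, because \<open>b x\<close> is
    orthogonal to \<open>y\<close>.\<close>
  have zero: "\<rho>1 b = 0" if b: "b \<in> A" "cinner (blinfun_apply b x) y = 0" for b
  proof -
    obtain l where l: "cmod l \<le> 1" "l * \<rho>1 b = complex_of_real (cmod (\<rho>1 b))"
      using sgn_multiple by blast
    have "1 + s * cmod (\<rho>1 b) \<le> sqrt (1 + s\<^sup>2 * (norm (blinfun_apply b x))\<^sup>2)" if "s > 0" for s
    proof -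
      define k where "k = of_real s * l"
      have k: "cmod k \<le> s" using l that by (simp add: k_def norm_mult mult_left_le)
      have "u + k *\<^sub>C b \<in> A" using u b by (simp add: add_mem scaleC_mem)
      from le1[OF this] have "cmod (\<rho>1 (u + k *\<^sub>C b)) \<le> norm (y + k *\<^sub>C blinfun_apply b x)"
        by (simp add: blinfun.add_left blinfun_apply_scaleC u)
      moreover have "\<rho>1 (u + k *\<^sub>C b) = of_real (1 + s * cmod (\<rho>1 b))"
        using dual_ballD(1,2)[OF \<rho>(1)] u b l by (simp add: scaleC_mem u1 k_def mult.assoc)
      moreover have "norm (y + k *\<^sub>C blinfun_apply b x) \<le> sqrt (1 + s\<^sup>2 * (norm (blinfun_apply b x))\<^sup>2)"
      proof (rule real_le_rsqrt)
        have "inner (k *\<^sub>C blinfun_apply b x) y = 0" "inner y y = 1"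
          using b(2) y by (simp_all add: Re_cinner[symmetric] cinner_scaleC_left cinner_self)
        then have "(norm (y + k *\<^sub>C blinfun_apply b x))\<^sup>2 = 1 + (norm (k *\<^sub>C blinfun_apply b x))\<^sup>2"
          unfolding power2_norm_eq_inner
          by (simp add: inner_add_left inner_add_right inner_commute[of y "k *\<^sub>C _"])
        also have "\<dots> \<le> 1 + s\<^sup>2 * (norm (blinfun_apply b x))\<^sup>2"
          using k by (simp add: norm_scaleC power_mult_distrib mult_right_mono power_mono)
        finally show "(norm (y + k *\<^sub>C blinfun_apply b x))\<^sup>2 \<le> 1 + s\<^sup>2 * (norm (blinfun_apply b x))\<^sup>2" .
      qed
      ultimately show ?thesis using complex_Re_le_cmod[of "\<rho>1 (u + k *\<^sub>C b)"] by simp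
    qed
    then have "cmod (\<rho>1 b) \<le> 0" by (rule slope_nonpos) simp_all
    then show ?thesis by simp
  qed
  let ?k = "cinner (blinfun_apply a x) y"
  have "\<rho>1 (a - ?k *\<^sub>C u) = 0"
    by (rule zero) (use a u y in \<open>auto simp: diff_mem scaleC_mem blinfun.diff_left blinfun_apply_scaleC cinner_diff_left
        cinner_scaleC_left cinner_self\<close>)
  moreover have "\<rho>1 a = \<rho>1 (a - ?k *\<^sub>C u) + \<rho>1 (?k *\<^sub>C u)"
    using dual_ballD(1)[OF \<rho>(1) diff_mem[OF a scaleC_mem[OF u(1)]] scaleC_mem[OF u(1)], of ?k ?k] by simp
  ultimately show ?thesis using dual_ballD(2)[OF \<rho>(1) u(1)] u1 by simp
qed

lemma kernel_on_scaleC: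
  assumes "c \<noteq> 0" "d \<noteq> 0"
  shows "kernel_on A (omega (c *\<^sub>C x) (d *\<^sub>C y)) = kernel_on A (omega x y)"
  using assms by (auto simp: kernel_on_def omega_def apply_simps cinner_simps)

text \<open>Scaling to unit vectors does not affect the kernel. For unit vectors a convex
  decomposition is trivial by the preceding lemma, applied to one component with \<open>t\<close>
  and to the other with \<open>1 - t\<close>.\<close>

lemma normal_part_subset_structure_set: "normal_part A \<subseteq> structure_set A"
proof
  fix I assume "I \<in> normal_part A"
  then obtain x0 y0 where I: "I = kernel_on A (omega x0 y0)" "x0 \<noteq> 0" "y0 \<noteq> 0"
    by (auto simp: normal_part_def)
  define x where "x = of_real (inverse (norm x0)) *\<^sub>C x0"
  define y where "y = of_real (inverse (norm y0)) *\<^sub>C y0"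
  have n: "norm x = 1" "norm y = 1" using I by (simp_all add: x_def y_def norm_scaleC norm_inverse)
  have Ixy: "I = kernel_on A (omega x y)"
    unfolding I(1) x_def y_def using I by (intro kernel_on_scaleC[symmetric]) auto
  define \<rho> where "\<rho> a = (if a \<in> A then omega x y a else 0)" for a
  have "\<rho> \<in> extreme_functions (dual_unit_ball A)"
    unfolding extreme_functions_def
  proof (intro CollectI conjI ballI allI impI)
    have "cmod (omega x y a) \<le> norm a" for a
    proof -
      have "cmod (omega x y a) \<le> norm (blinfun_apply a x) * norm y" unfolding omega_def by (rule cinner_norm_le)
      also have "\<dots> \<le> norm a" using norm_blinfun[of a x] n by simp
      finally show ?thesis .
    qed
    then show "\<rho> \<in> dual_unit_ball A"
      by (auto simp: dual_unit_ball_def \<rho>_def add_mem scaleC_mem omega_def blinfun.add_left blinfun_apply_scaleC cinner_simps)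
    fix \<rho>1 \<rho>2 and t :: real
    assume \<rho>: "\<rho>1 \<in> dual_unit_ball A" "\<rho>2 \<in> dual_unit_ball A"
      and t: "0 < t \<and> t < 1 \<and> \<rho> = (\<lambda>a. (1 - t) *\<^sub>R \<rho>1 a + t *\<^sub>R \<rho>2 a)"
    then have t1: "0 < t" "t < 1" and t2: "0 < 1 - t" "1 - t < 1" by simp_all
    have conv: "cinner (blinfun_apply a x) y = of_real (1 - t) * \<rho>1 a + of_real t * \<rho>2 a" if "a \<in> A" for a
      using fun_cong[OF conjunct2[OF conjunct2[OF t]], of a] that
      by (simp add: \<rho>_def omega_def scaleR_conv_of_real)
    then have conv': "cinner (blinfun_apply a x) y = of_real (1 - (1 - t)) * \<rho>2 a + of_real (1 - t) * \<rho>1 a" if "a \<in> A" for a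
      using that by simp
    have "\<rho>1 a = \<rho> a" for a
      using convex_component_eq[OF n t1 \<rho> conv, of a] dual_ballD(4)[OF \<rho>(1), of a]
      by (cases "a \<in> A") (simp_all add: \<rho>_def omega_def)
    then show "\<rho>1 = \<rho>" by blast
    have "\<rho>2 a = \<rho> a" for a
      using convex_component_eq[OF n t2 \<rho>(2,1) conv', of a] dual_ballD(4)[OF \<rho>(2), of a]
      by (cases "a \<in> A") (simp_all add: \<rho>_def omega_def)
    then show "\<rho>2 = \<rho>" by blast
  qed
  moreover have "kernel_on A \<rho> = I" by (auto simp: Ixy kernel_on_def \<rho>_def)
  ultimately show "I \<in> structure_set A" unfolding structure_set_def by blast
qed

end

section \<open>Inclusions between kernels\<close>

lemma functional_multiple:
  fixes f g :: "'a::complex_normed_vector \<Rightarrow> complex"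
  assumes S: "csubspace S"
    and f: "\<And>a b c. f (a - c *\<^sub>C b) = f a - c * f b" and g: "\<And>a b c. g (a - c *\<^sub>C b) = g a - c * g b"
    and ker: "\<And>a. a \<in> S \<Longrightarrow> f a = 0 \<Longrightarrow> g a = 0"
  obtains c where "\<And>a. a \<in> S \<Longrightarrow> g a = c * f a"
proof (cases "\<exists>u\<in>S. f u \<noteq> 0")
  case True
  then obtain u where u: "u \<in> S" "f u \<noteq> 0" by blast
  have "g a = g u / f u * f a" if "a \<in> S" for a
  proof -
    have "a - (f a / f u) *\<^sub>C u \<in> S"
      using S that u by (intro complex_vector.subspace_diff complex_vector.subspace_scale)
    then have "g (a - (f a / f u) *\<^sub>C u) = 0" by (rule ker) (simp add: f u)
    then show ?thesis using u by (simp add: g)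
  qed
  then show ?thesis using that by blast
next
  case False
  then show ?thesis using that[of 0] ker by simp
qed

text \<open>A vector \<open>u\<close> killed by \<open>f1\<close> but not by \<open>f2\<close>
  serves to remove the part of \<open>g\<close> proportional to \<open>f2\<close>; the remainder
  vanishes on the kernel of \<open>f1\<close>.\<close>

lemma functional_combination:
  fixes f1 f2 g :: "'a::complex_normed_vector \<Rightarrow> complex"
  assumes S: "csubspace S"
    and f1: "\<And>a b c. f1 (a - c *\<^sub>C b) = f1 a - c * f1 b" and f2: "\<And>a b c. f2 (a - c *\<^sub>C b) = f2 a - c * f2 b"
    and g: "\<And>a b c. g (a - c *\<^sub>C b) = g a - c * g b"
    and ker: "\<And>a. a \<in> S \<Longrightarrow> f1 a = 0 \<Longrightarrow> f2 a = 0 \<Longrightarrow> g a = 0"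
  obtains c d where "\<And>a. a \<in> S \<Longrightarrow> g a = c * f1 a + d * f2 a"
proof (cases "\<exists>u\<in>S. f1 u = 0 \<and> f2 u \<noteq> 0")
  case True
  then obtain u where u: "u \<in> S" "f1 u = 0" "f2 u \<noteq> 0" by blast
  define h where "h a = g a - g u / f2 u * f2 a" for a
  obtain c where c: "\<And>a. a \<in> S \<Longrightarrow> h a = c * f1 a"
  proof (rule functional_multiple[OF S f1, of h])
    show "h (a - c *\<^sub>C b) = h a - c * h b" for a b c
      by (simp add: h_def g f2 algebra_simps)
    fix a assume a: "a \<in> S" "f1 a = 0"
    have "a - (f2 a / f2 u) *\<^sub>C u \<in> S"
      using S a u by (intro complex_vector.subspace_diff complex_vector.subspace_scale)
    then have "g (a - (f2 a / f2 u) *\<^sub>C u) = 0" by (rule ker) (simp_all add: f1 f2 a u)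
    then show "h a = 0" using u by (simp add: g h_def)
  qed blast
  have "g a = c * f1 a + g u / f2 u * f2 a" if "a \<in> S" for a
    using c[OF that] by (simp add: h_def algebra_simps)
  then show ?thesis using that by blast
next
  case False
  then have "\<And>a. a \<in> S \<Longrightarrow> f1 a = 0 \<Longrightarrow> g a = 0" using ker by blast
  then obtain c where "\<And>a. a \<in> S \<Longrightarrow> g a = c * f1 a"
    using functional_multiple[OF S f1 g] by blast
  then show ?thesis using that[of c 0] by simp
qed

section \<open>Lines and closed linear spans\<close>

lemma in_cspan_singleton: "x \<in> cspan {y} \<longleftrightarrow> (\<exists>c. x = c *\<^sub>C y)"
  by (auto simp: complex_vector.span_singleton)

lemma cspan_singleton_eq_iff:
  assumes "x \<noteq> 0" "y \<noteq> 0"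
  shows "cspan {x} = cspan {y} \<longleftrightarrow> x \<in> cspan {y}"
proof
  assume "x \<in> cspan {y}"
  then obtain c where c: "x = c *\<^sub>C y" by (auto simp: in_cspan_singleton)
  with assms have "c \<noteq> 0" by auto
  then have "y = inverse c *\<^sub>C x" by (simp add: c scaleC_scaleC)
  then have "y \<in> cspan {x}" by (auto simp: in_cspan_singleton)
  with \<open>x \<in> cspan {y}\<close> show "cspan {x} = cspan {y}"
    by (intro equalityI complex_vector.span_minimal complex_vector.subspace_span) auto
qed (metis complex_vector.span_base insertI1)

text \<open>The residual of \<open>x'\<close> after projection onto \<open>x\<close> is orthogonal
  to \<open>x\<close>, hence to \<open>x'\<close>, hence to itself.\<close>

lemma cspan_singletonI_orthogonal:
  fixes x x' :: "'a::complex_hilbert"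
  assumes "x \<noteq> 0" "\<And>p. cinner x p = 0 \<Longrightarrow> cinner x' p = 0"
  shows "x' \<in> cspan {x}"
proof -
  define k where "k = cinner x' x / cinner x x"
  define p where "p = x' - k *\<^sub>C x"
  have "cinner p x = 0" using assms(1) by (simp add: p_def k_def cinner_simps)
  then have xp: "cinner x p = 0" by (simp add: cinner_eq_0_commute)
  then have "cinner p p = 0" using assms(2)[OF xp] by (simp add: p_def cinner_simps algebra_simps)
  then have "x' = k *\<^sub>C x" by (simp add: p_def)
  then show ?thesis by (auto simp: in_cspan_singleton)
qed

lemma clinear_rank_one: "clinear (\<lambda>v. cinner v p *\<^sub>C (q :: 'a::complex_hilbert))"
  by (simp add: semilinear_wrt_def cinner_simps scaleC_add_left scaleC_scaleC)

lemma omega_diff: "omega x y (a - c *\<^sub>C b) = omega x y a - c * omega x y b"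
  by (simp add: omega_def blinfun.diff_left blinfun_apply_scaleC cinner_simps)

text \<open>One Gram-Schmidt step per vector. The purpose is to see that finite spans are closed, so
  that closures of finite sets in a line of the grid are algebraic spans.\<close>

lemma finite_orthogonal_projection:
  fixes S :: "'a::complex_hilbert set"
  assumes "finite S"
  shows "\<exists>p\<in>cspan S. \<forall>s\<in>S. cinner (y - p) s = 0"
  using assms
proof (induction S arbitrary: y)
  case empty then show ?case by auto
next
  case (insert v F)
  obtain p where p: "p \<in> cspan F" "\<And>s. s \<in> F \<Longrightarrow> cinner (v - p) s = 0" using insert.IH by blast
  obtain q where q: "q \<in> cspan F" "\<And>s. s \<in> F \<Longrightarrow> cinner (y - q) s = 0" using insert.IH by blast
  have F: "cspan F \<subseteq> cspan (insert v F)" by (rule complex_vector.span_mono) auto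
  have orth: "cinner z s = 0" if "\<And>s. s \<in> F \<Longrightarrow> cinner z s = 0" "s \<in> cspan F" for z s
    using that(2) by (induction rule: complex_vector.span_induct_alt) (auto simp: cinner_simps that(1))
  define r where "r = v - p"
  define k where "k = cinner (y - q) r / cinner r r"
  have r: "r \<in> cspan (insert v F)"
    unfolding r_def using F p by (intro complex_vector.span_diff) (auto intro: complex_vector.span_base)
  have rF: "cinner r s = 0" if "s \<in> F" for s using p(2) that by (simp add: r_def)
  have yF: "cinner (y - (q + k *\<^sub>C r)) s = 0" if "s \<in> F" for s
    using q(2)[OF that] rF[OF that] by (simp add: cinner_simps)
  have "cinner (y - (q + k *\<^sub>C r)) r = 0"
    by (cases "r = 0") (simp_all add: k_def cinner_simps field_simps)
  moreover have "cinner (y - (q + k *\<^sub>C r)) p = 0" by (rule orth[OF yF p(1)])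
  ultimately have "cinner (y - (q + k *\<^sub>C r)) v = 0"
    by (simp add: r_def cinner_diff_right)
  moreover have "q + k *\<^sub>C r \<in> cspan (insert v F)"
    using F q r by (auto intro: complex_vector.span_add complex_vector.span_scale)
  ultimately show ?case using yF by blast
qed

lemma orthogonal_closure_cspan:
  fixes S :: "'a::complex_hilbert set"
  assumes "\<And>s. s \<in> S \<Longrightarrow> cinner z s = 0" "v \<in> closure (cspan S)"
  shows "cinner z v = 0"
proof -
  have "cspan S \<subseteq> {v. cinner z v = 0}"
    by (rule complex_vector.span_minimal)
      (auto simp: assms(1) complex_vector.subspace_def cinner_simps)
  moreover have "closed {v. cinner z v = 0}"
    by (intro closed_Collect_eq continuous_intros)
  ultimately show ?thesis using assms(2) closure_minimal by blast
qed

lemma closure_cspan_finite: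
  fixes S :: "'a::complex_hilbert set"
  assumes "finite S"
  shows "closure (cspan S) = cspan S"
proof
  show "closure (cspan S) \<subseteq> cspan S"
  proof
    fix y assume y: "y \<in> closure (cspan S)"
    obtain p where p: "p \<in> cspan S" "\<And>s. s \<in> S \<Longrightarrow> cinner (y - p) s = 0"
      using finite_orthogonal_projection[OF assms] by blast
    have "y - p \<in> closure (cspan S)"
      using y p(1) closure_subset
      by (intro complex_vector.subspace_diff closed_closure_csubspace complex_vector.subspace_span) auto
    then have "cinner (y - p) (y - p) = 0" using p(2) by (rule orthogonal_closure_cspan[rotated])
    then show "y \<in> cspan S" using p(1) by simp
  qed
qed (rule closure_subset)

text \<open>The double annihilator: it converts a condition on all vectors orthogonal to
  \<open>S\<close>, which is what an intersection of kernels amounts to, into membership in a closed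
  span.\<close>

lemma closure_cspan_orthogonal:
  fixes S :: "'a::complex_hilbert set"
  shows "y \<in> closure (cspan S) \<longleftrightarrow> (\<forall>v. (\<forall>s\<in>S. cinner v s = 0) \<longrightarrow> cinner v y = 0)"
proof
  assume *: "\<forall>v. (\<forall>s\<in>S. cinner v s = 0) \<longrightarrow> cinner v y = 0"
  let ?M = "closure (cspan S)"
  have cM: "csubspace ?M" by (intro closed_closure_csubspace complex_vector.subspace_span)
  have "subspace ?M"
    using cM by (auto simp: subspace_def complex_vector.subspace_def scaleC_of_real[symmetric])
  then obtain p where p: "p \<in> ?M" "\<And>m. m \<in> ?M \<Longrightarrow> inner (y - p) m = 0"
    using orthogonal_projection_exists[of ?M y] by auto
  \<comment> \<open>The projection gives real orthogonality; testing also with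
    \<open>\<i> *\<^sub>C m\<close> makes it complex.\<close>
  have "cinner (y - p) m = 0" if "m \<in> ?M" for m
    using p(2)[OF that] p(2)[OF complex_vector.subspace_scale[OF cM that, of \<i>]]
    by (simp add: cinner_eq_inner)
  moreover have "s \<in> ?M" if "s \<in> S" for s
    using that closure_subset complex_vector.span_base by blast
  ultimately have "cinner (y - p) y = 0" "cinner (y - p) p = 0" using * p(1) by blast+
  then have "cinner (y - p) (y - p) = 0" by (simp add: cinner_diff_right)
  then show "y \<in> ?M" using p(1) by simp
qed (use orthogonal_closure_cspan in blast)

section \<open>Kernels of vector functionals and closures along lines of the grid\<close>

context irreducible_algebra
begin

text \<open>The multiple is moved to the other side and, conjugated, into the second vector; the
  relation becomes a vanishing sum of two terms, to which \<open>annihilator_total\<close>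
  applies.\<close>

lemma omega_multiple_total:
  assumes "\<And>a. a \<in> A \<Longrightarrow> omega x' y' a = c * omega x y a" and T: "clinear T"
  shows "cinner (T x') y' = c * cinner (T x) y"
proof -
  define X :: "'h^2" where "X = (\<chi> i. if i = 1 then x' else x)"
  define Y :: "'h^2" where "Y = (\<chi> i. if i = 1 then y' else - (cnj c *\<^sub>C y))"
  have "(\<Sum>i\<in>UNIV. cinner (T (X $ i)) (Y $ i)) = 0"
    by (rule annihilator_total[OF _ T]) (use assms(1) in \<open>simp add: sum_2 X_def Y_def omega_def cinner_simps\<close>)
  then show ?thesis by (simp add: sum_2 X_def Y_def cinner_simps)
qed

lemma omega_combination_total:
  assumes "\<And>a. a \<in> A \<Longrightarrow> omega x y a = c * omega x1 y1 a + d * omega x2 y2 a" and T: "clinear T"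
  shows "cinner (T x) y = c * cinner (T x1) y1 + d * cinner (T x2) y2"
proof -
  define X :: "'h^3" where "X = (\<chi> i. if i = 1 then x else if i = 2 then x1 else x2)"
  define Y :: "'h^3" where "Y = (\<chi> i. if i = 1 then y else if i = 2 then - (cnj c *\<^sub>C y1) else - (cnj d *\<^sub>C y2))"
  have "(\<Sum>i\<in>UNIV. cinner (T (X $ i)) (Y $ i)) = 0"
    by (rule annihilator_total[OF _ T]) (use assms(1) in \<open>simp add: sum_3 X_def Y_def omega_def cinner_simps\<close>)
  then show ?thesis by (simp add: sum_3 X_def Y_def cinner_simps algebra_simps)
qed

text \<open>The last assumption is the relation evaluated at rank-one maps, where the two vectors
  separate; fixing \<open>q\<close> or \<open>p\<close> treats them one at a time.\<close>

lemma omega_multiple_cspan: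
  assumes nz: "x \<noteq> 0" "y \<noteq> 0" "x' \<noteq> 0" "y' \<noteq> 0"
    and tot: "\<And>p q. cinner x' p * cinner q y' = c * (cinner x p * cinner q y)"
  shows "x' \<in> cspan {x} \<and> y' \<in> cspan {y}"
proof
  show "x' \<in> cspan {x}"
  proof (rule cspan_singletonI_orthogonal[OF nz(1)])
    fix p assume "cinner x p = 0"
    then show "cinner x' p = 0" using tot[of p y'] nz by simp
  qed
  show "y' \<in> cspan {y}"
  proof (rule cspan_singletonI_orthogonal[OF nz(2)])
    fix q assume "cinner y q = 0"
    then have "cinner q y = 0" by (simp add: cinner_eq_0_commute)
    then have "cinner q y' = 0" using tot[of x' q] nz by simp
    then show "cinner y' q = 0" by (simp add: cinner_eq_0_commute)
  qed
qed

lemma kernel_subset_cspan: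
  assumes nz: "x \<noteq> 0" "y \<noteq> 0" "x' \<noteq> 0" "y' \<noteq> 0"
    and sub: "kernel_on A (omega x y) \<subseteq> kernel_on A (omega x' y')"
  shows "x' \<in> cspan {x} \<and> y' \<in> cspan {y}"
proof -
  obtain c where c: "\<And>a. a \<in> A \<Longrightarrow> omega x' y' a = c * omega x y a"
    by (rule functional_multiple[OF csubspace_algebra, of "omega x y" "omega x' y'"])
      (use sub in \<open>auto simp: omega_diff kernel_on_def\<close>)
  show ?thesis
    by (rule omega_multiple_cspan[OF nz, of c])
      (use omega_multiple_total[OF c clinear_rank_one] in \<open>simp add: cinner_simps\<close>)
qed

lemma kernel_eq_iff:
  assumes nz: "x \<noteq> 0" "y \<noteq> 0" "x' \<noteq> 0" "y' \<noteq> 0"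
  shows "kernel_on A (omega x y) = kernel_on A (omega x' y') \<longleftrightarrow> cspan {x} = cspan {x'} \<and> cspan {y} = cspan {y'}"
proof
  assume "kernel_on A (omega x y) = kernel_on A (omega x' y')"
  then have "x' \<in> cspan {x} \<and> y' \<in> cspan {y}" by (intro kernel_subset_cspan nz) simp
  then show "cspan {x} = cspan {x'} \<and> cspan {y} = cspan {y'}"
    using cspan_singleton_eq_iff nz by metis
next
  assume "cspan {x} = cspan {x'} \<and> cspan {y} = cspan {y'}"
  then have "x' \<in> cspan {x}" "y' \<in> cspan {y}" using cspan_singleton_eq_iff nz by metis+
  then obtain c d where "x' = c *\<^sub>C x" "y' = d *\<^sub>C y" by (auto simp: in_cspan_singleton)
  then show "kernel_on A (omega x y) = kernel_on A (omega x' y')"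
    using nz by (auto simp: kernel_on_scaleC)
qed

text \<open>As a form on rank-one maps, the functional of \<open>x\<close>, \<open>y\<close> has
  rank one, whereas a combination of the other two with both coefficients nonzero has rank two by
  independence. Hence one coefficient is zero.\<close>

lemma two_point_closure:
  assumes nz: "x \<noteq> 0" "y \<noteq> 0" "x1 \<noteq> 0" "y1 \<noteq> 0" "x2 \<noteq> 0" "y2 \<noteq> 0"
    and indep: "x2 \<notin> cspan {x1}" "y2 \<notin> cspan {y1}"
    and sub: "kernel_on A (omega x1 y1) \<inter> kernel_on A (omega x2 y2) \<subseteq> kernel_on A (omega x y)"
  shows "(x \<in> cspan {x1} \<and> y \<in> cspan {y1}) \<or> (x \<in> cspan {x2} \<and> y \<in> cspan {y2})"
proof -
  obtain c d where cd: "\<And>a. a \<in> A \<Longrightarrow> omega x y a = c * omega x1 y1 a + d * omega x2 y2 a"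
    by (rule functional_combination[OF csubspace_algebra, of "omega x1 y1" "omega x2 y2" "omega x y"])
      (use sub in \<open>auto simp: omega_diff kernel_on_def\<close>)
  have tot: "cinner x p * cinner q y = c * (cinner x1 p * cinner q y1) + d * (cinner x2 p * cinner q y2)" for p q
    using omega_combination_total[OF cd clinear_rank_one[of p q]] by (simp add: cinner_simps)
  consider "c = 0" | "d = 0" | "c \<noteq> 0" "d \<noteq> 0" by blast
  then show ?thesis
  proof cases
    assume "c = 0"
    then show ?thesis using omega_multiple_cspan[OF nz(5,6) nz(1,2), of d] tot by simp
  next
    assume "d = 0"
    then show ?thesis using omega_multiple_cspan[OF nz(3,4) nz(1,2), of c] tot by simp
  next
    assume cd0: "c \<noteq> 0" "d \<noteq> 0"
    \<comment> \<open>Independence of \<open>x1\<close> and \<open>x2\<close> makes both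
      coefficients vanish; thus \<open>y1\<close> and \<open>y2\<close> will lie on the line of
      \<open>y\<close>, contrary to their independence.\<close>
    have orth: "cinner q y1 = 0 \<and> cinner q y2 = 0" if "cinner q y = 0" for q
    proof -
      define k1 where "k1 = c * cinner q y1"
      define k2 where "k2 = d * cinner q y2"
      have "cinner (k1 *\<^sub>C x1 + k2 *\<^sub>C x2) p = cinner 0 p" for p
        using tot[of p q] that by (simp add: k1_def k2_def cinner_simps algebra_simps)
      then have z: "k1 *\<^sub>C x1 + k2 *\<^sub>C x2 = 0" by (rule cinner_ext)
      have "k2 = 0"
      proof (rule ccontr)
        assume k20: "k2 \<noteq> 0"
        have "x2 = inverse k2 *\<^sub>C (k2 *\<^sub>C x2)" using k20 by (simp add: scaleC_scaleC)
        also have "k2 *\<^sub>C x2 = - (k1 *\<^sub>C x1)" using z by (simp add: eq_neg_iff_add_eq_0 add.commute)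
        also have "inverse k2 *\<^sub>C (- (k1 *\<^sub>C x1)) = (- (inverse k2 * k1)) *\<^sub>C x1"
          by (simp add: scaleC_scaleC complex_vector.scale_minus_left complex_vector.scale_minus_right)
        finally show False using indep(1) unfolding in_cspan_singleton by blast
      qed
      moreover from this z have "k1 = 0" using nz by simp
      ultimately show ?thesis using cd0 by (simp add: k1_def k2_def)
    qed
    have "y1 \<in> cspan {y}" "y2 \<in> cspan {y}"
      by (rule cspan_singletonI_orthogonal[OF nz(2)], metis orth cinner_eq_0_commute)+
    then have "y2 \<in> cspan {y1}" using cspan_singleton_eq_iff nz by metis
    then show ?thesis using indep by blast
  qed
qed

text \<open>The vectors \<open>a x\<close> run through the whole space. A merely dense orbit would
  not do, because the vectors orthogonal to \<open>S\<close> themselves have to be attained.\<close>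

lemma row_closure:
  assumes "x \<noteq> 0"
  shows "A \<inter> (\<Inter>s\<in>S. kernel_on A (omega x s)) \<subseteq> kernel_on A (omega x y) \<longleftrightarrow> y \<in> closure (cspan S)"
proof -
  have "A \<inter> (\<Inter>s\<in>S. kernel_on A (omega x s)) \<subseteq> kernel_on A (omega x y)
      \<longleftrightarrow> (\<forall>a\<in>A. (\<forall>s\<in>S. cinner (blinfun_apply a x) s = 0) \<longrightarrow> cinner (blinfun_apply a x) y = 0)"
    by (auto simp: kernel_on_def omega_def)
  also have "\<dots> \<longleftrightarrow> (\<forall>v. (\<forall>s\<in>S. cinner v s = 0) \<longrightarrow> cinner v y = 0)"
    using transitivity[OF assms zero_less_one] by metis
  finally show ?thesis by (simp add: closure_cspan_orthogonal)
qed

lemma kernel_adj: "kernel_on A (omega y x) = {a \<in> A. adj a \<in> kernel_on A (omega x y)}"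
  by (auto simp: kernel_on_def omega_def adj_mem cinner_adj_left clinear_apply cinner_eq_0_commute[of x "blinfun_apply _ y"])

lemma adj_image_kernel: "adj ` kernel_on A (omega x y) = kernel_on A (omega y x)"
proof
  show "kernel_on A (omega y x) \<subseteq> adj ` kernel_on A (omega x y)"
  proof
    fix a assume "a \<in> kernel_on A (omega y x)"
    then have "a \<in> A" "adj a \<in> kernel_on A (omega x y)" by (auto simp: kernel_adj[of y x])
    then show "a \<in> adj ` kernel_on A (omega x y)" by (intro image_eqI[of _ _ "adj a"]) (auto simp: adj_adj clinear_apply)
  qed
  show "adj ` kernel_on A (omega x y) \<subseteq> kernel_on A (omega y x)"
  proof
    fix b assume "b \<in> adj ` kernel_on A (omega x y)"
    then obtain a where a: "a \<in> kernel_on A (omega x y)" "b = adj a" by blast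
    moreover from a(1) have "a \<in> A" by (simp add: kernel_on_def)
    ultimately show "b \<in> kernel_on A (omega y x)"
      by (simp add: kernel_adj[of y x] adj_mem adj_adj clinear_apply)
  qed
qed

text \<open>Transitivity governs \<open>a x\<close> for fixed \<open>x\<close> only. Taking adjoints
  moves the varying vector from the first place to the second.\<close>

lemma column_closure:
  assumes "y \<noteq> 0"
  shows "A \<inter> (\<Inter>s\<in>S. kernel_on A (omega s y)) \<subseteq> kernel_on A (omega x y) \<longleftrightarrow> x \<in> closure (cspan S)"
proof -
  have mem: "a \<in> kernel_on A (omega s y) \<longleftrightarrow> adj a \<in> kernel_on A (omega y s)"
    "adj a \<in> kernel_on A (omega s y) \<longleftrightarrow> a \<in> kernel_on A (omega y s)" if "a \<in> A" for a s
    using that kernel_adj[of s y] by (auto simp: adj_mem adj_adj clinear_apply)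
  have "A \<inter> (\<Inter>s\<in>S. kernel_on A (omega s y)) \<subseteq> kernel_on A (omega x y)
      \<longleftrightarrow> A \<inter> (\<Inter>s\<in>S. kernel_on A (omega y s)) \<subseteq> kernel_on A (omega y x)" (is "?L \<longleftrightarrow> ?R")
  proof
    assume L: ?L
    show ?R
    proof
      fix a assume a: "a \<in> A \<inter> (\<Inter>s\<in>S. kernel_on A (omega y s))"
      then have "adj a \<in> A \<inter> (\<Inter>s\<in>S. kernel_on A (omega s y))" by (simp add: mem adj_mem adj_adj clinear_apply)
      then show "a \<in> kernel_on A (omega y x)" using L mem(2)[of a x] a by blast
    qed
  next
    assume R: ?R
    show ?L
    proof
      fix a assume a: "a \<in> A \<inter> (\<Inter>s\<in>S. kernel_on A (omega s y))"
      then have "adj a \<in> A \<inter> (\<Inter>s\<in>S. kernel_on A (omega y s))" using mem(1) by (auto simp: adj_mem adj_adj clinear_apply)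
      then show "a \<in> kernel_on A (omega x y)" using R mem(1)[of a x] a by blast
    qed
  qed
  then show ?thesis using row_closure[OF assms] by simp
qed

end

section \<open>The fundamental theorem of projective geometry\<close>

text \<open>Phrased stepwise and with the span operator as a parameter, so that it applies to either
  space of a pair and to \<open>cspan\<close>.\<close>

definition independent3 :: "('a set \<Rightarrow> 'a set) \<Rightarrow> 'a::zero \<Rightarrow> 'a \<Rightarrow> 'a \<Rightarrow> bool" where
  "independent3 spn p q r \<longleftrightarrow> p \<noteq> 0 \<and> q \<notin> spn {p} \<and> r \<notin> spn {p, q}"

context vector_space
begin

lemma in_span_pair: "x \<in> span {a, b} \<longleftrightarrow> (\<exists>k l. x = scale k a + scale l b)"
proof
  assume "x \<in> span {a, b}"
  then obtain k where "x - scale k a \<in> span {b}" by (auto simp: span_insert)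
  then obtain l where "x - scale k a = scale l b" by (auto simp: span_singleton)
  then have "x = scale k a + scale l b" by (simp add: algebra_simps)
  then show "\<exists>k l. x = scale k a + scale l b" by blast
next
  assume "\<exists>k l. x = scale k a + scale l b"
  then show "x \<in> span {a, b}" using span_base[of a "{a, b}"] span_base[of b "{a, b}"] by (auto intro: span_add span_scale)
qed

lemma in_span_one: "x \<in> span {a} \<longleftrightarrow> (\<exists>k. x = scale k a)"
  by (auto simp: span_singleton)

lemma span_one_sym:
  assumes "x \<in> span {a}" "x \<noteq> 0" shows "a \<in> span {x}"
proof -
  obtain k where k: "x = scale k a" using assms(1) by (auto simp: in_span_one)
  with assms(2) have "k \<noteq> 0" by auto
  then have "a = scale (inverse k) x" by (simp add: k)
  then show ?thesis by (auto simp: in_span_one)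
qed

lemma span_one_trans: "x \<in> span {a} \<Longrightarrow> a \<in> span S \<Longrightarrow> x \<in> span S"
  by (auto simp: in_span_one intro: span_scale)

lemma independent2_coeff:
  assumes "p \<noteq> 0" "q \<notin> span {p}" "scale a p + scale b q = scale a' p + scale b' q"
  shows "a = a' \<and> b = b'"
proof -
  have eq: "scale (b - b') q = scale (a' - a) p"
    using assms(3) by (simp add: scale_left_diff_distrib algebra_simps)
  have "b - b' = 0"
  proof (rule ccontr)
    assume nz: "b - b' \<noteq> 0"
    then have "q = scale (inverse (b - b')) (scale (b - b') q)" by simp
    also have "\<dots> = scale (inverse (b - b') * (a' - a)) p" by (simp only: eq scale_scale)
    finally show False using assms(2) by (auto simp: in_span_one)
  qed
  moreover from this eq have "a' - a = 0" using assms(1) by (metis scale_eq_0_iff scale_zero_left)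
  ultimately show ?thesis by simp
qed

lemma independent3_coeff:
  assumes "independent3 span p q r"
    and eq: "scale a p + scale b q + scale c r = scale a' p + scale b' q + scale c' r"
  shows "a = a' \<and> b = b' \<and> c = c'"
proof -
  have ind: "p \<noteq> 0" "q \<notin> span {p}" "r \<notin> span {p, q}" using assms(1) by (auto simp: independent3_def)
  have eq': "scale (c - c') r = scale (a' - a) p + scale (b' - b) q"
    using eq by (simp add: scale_left_diff_distrib algebra_simps)
  have "c - c' = 0"
  proof (rule ccontr)
    assume nz: "c - c' \<noteq> 0"
    then have "r = scale (inverse (c - c')) (scale (c - c') r)" by simp
    also have "\<dots> \<in> span {p, q}" unfolding eq' by (intro span_scale span_add span_base) auto
    finally show False using ind(3) by simp
  qed
  then have "c = c'" by simp
  with eq have "scale a p + scale b q = scale a' p + scale b' q" by simp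
  then show ?thesis using independent2_coeff[OF ind(1,2)] \<open>c = c'\<close> by blast
qed

end

context vector_space_pair
begin

text \<open>Fix a nonzero vector \<open>e\<close>.  For \<open>x\<close> outside the line of \<open>e\<close>, let \<open>h x\<close> be the vector of the line
  \<open>g x\<close> with \<open>g e + h x\<close> on the line \<open>g (e + x)\<close>.  This map is additive as far as it is defined, and
  it is extended to the line of \<open>e\<close> by \<open>h (x + z) - h z\<close>, which does not depend on \<open>z\<close>.\<close>

theorem fundamental_theorem_projective_geometry:
  fixes g :: "'b \<Rightarrow> 'c"
  assumes g_nz: "\<And>x. x \<noteq> 0 \<Longrightarrow> g x \<noteq> 0"
    and coll: "\<And>x y z. x \<noteq> 0 \<Longrightarrow> y \<noteq> 0 \<Longrightarrow> z \<noteq> 0 \<Longrightarrow> x \<in> vs1.span {y, z} \<longleftrightarrow> g x \<in> vs2.span {g y, g z}"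
    and onto: "\<And>w. w \<noteq> 0 \<Longrightarrow> \<exists>x. x \<noteq> 0 \<and> w \<in> vs2.span {g x}"
    and dim3: "independent3 vs1.span e f f'"
  obtains U \<sigma> where "field_automorphism \<sigma>" "\<And>x y. U (x + y) = U x + U y"
    "\<And>c x. U (s1 c x) = s2 (\<sigma> c) (U x)" "bij U" "\<And>x. x \<noteq> 0 \<Longrightarrow> vs2.span {U x} = vs2.span {g x}"
proof -
  define E where "E = vs1.span {e}"
  have e: "e \<noteq> 0" and fE: "f \<notin> E" and f': "f' \<notin> vs1.span {e, f}"
    using dim3 by (auto simp: independent3_def E_def)
  have E_sub: "vs1.subspace E" unfolding E_def by (rule vs1.subspace_span)
  have eE: "e \<in> E" unfolding E_def by (rule vs1.span_base) simp
  have E0: "x \<noteq> 0" if "x \<notin> E" for x using that vs1.subspace_0[OF E_sub] by auto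
  have E_pair: "E \<subseteq> vs1.span {e, x}" for x unfolding E_def by (rule vs1.span_mono) auto
  have coll1: "x \<in> vs1.span {y} \<longleftrightarrow> g x \<in> vs2.span {g y}" if "x \<noteq> 0" "y \<noteq> 0" for x y
    using coll[OF that that(2)] by simp
  \<comment> \<open>No plane through \<open>e\<close> is everything: either \<open>f\<close> lies
    outside, or the plane is contained in that of \<open>e\<close> and \<open>f\<close>, and
    \<open>f'\<close> lies outside.\<close>
  have third: "\<exists>z. z \<notin> vs1.span {e, x}" for x
  proof (cases "f \<in> vs1.span {e, x}")
    case True
    have "x \<in> vs1.span {e, f}"
      using vs1.in_span_insert[of f x "{e}"] True fE by (simp add: E_def insert_commute)
    then have "vs1.span {e, x} \<subseteq> vs1.span {e, f}"
      by (intro vs1.span_minimal vs1.subspace_span) (auto intro: vs1.span_base)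
    then show ?thesis using f' by blast
  qed blast
  have add_out: "x + y \<notin> E" if "x \<in> E" "y \<notin> E" for x y
    using vs1.subspace_diff[OF E_sub, of "x + y" x] that by auto
  have g_ind: "independent3 vs2.span (g x) (g y) (g z)" if "independent3 vs1.span x y z" for x y z
  proof -
    have nz: "x \<noteq> 0" "y \<noteq> 0" "z \<noteq> 0"
      using that vs1.span_zero by (auto simp: independent3_def)
    then show ?thesis
      using that coll1[OF nz(2,1)] coll[OF nz(3,1,2)] g_nz by (simp add: independent3_def)
  qed
  define w where "w = g e"
  have w: "w \<noteq> 0" using g_nz e by (simp add: w_def)
  have gx_out: "g x \<notin> vs2.span {w}" if "x \<notin> E" for x
    using coll1[OF E0[OF that] e] that by (simp add: w_def E_def)
  have ex_nz: "e + x \<noteq> 0" if "x \<notin> E" for x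
    using E0[OF add_out[OF eE that]] .
  \<comment> \<open>Both coefficients of \<open>g (e + x)\<close> relative to \<open>w\<close> and
    \<open>g x\<close> are nonzero; dividing by the first one produces \<open>u\<close>.\<close>
  have h_ex: "\<exists>u. u \<in> vs2.span {g x} \<and> u \<noteq> 0 \<and> w + u \<in> vs2.span {g (e + x)}" if x: "x \<notin> E" for x
  proof -
    have "e + x \<in> vs1.span {e, x}" by (intro vs1.span_add vs1.span_base) auto
    then have "g (e + x) \<in> vs2.span {w, g x}" using coll[OF ex_nz[OF x] e E0[OF x]] by (simp add: w_def)
    then obtain a b where ab: "g (e + x) = s2 a w + s2 b (g x)" by (auto simp: vs2.in_span_pair)
    have "a \<noteq> 0"
    proof
      assume "a = 0"
      then have "g (e + x) \<in> vs2.span {g x}" using ab by (auto simp: vs2.in_span_one)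
      then have "e + x \<in> vs1.span {x}" using coll1[OF ex_nz[OF x] E0[OF x]] by simp
      then have "e \<in> vs1.span {x}"
        using vs1.span_diff[of "e + x" "{x}" x] vs1.span_base[of x "{x}"] by simp
      then have "x \<in> E" unfolding E_def using vs1.span_one_sym e by blast
      then show False using x by simp
    qed
    have "b \<noteq> 0"
    proof
      assume "b = 0"
      then have "g (e + x) \<in> vs2.span {g e}" using ab by (auto simp: vs2.in_span_one w_def)
      then have "e + x \<in> E" using coll1[OF ex_nz[OF x] e] by (simp add: E_def)
      then show False using add_out[OF eE x] by simp
    qed
    have "w + s2 (b / a) (g x) = s2 (inverse a) (g (e + x))"
      using \<open>a \<noteq> 0\<close> by (simp add: ab vs2.scale_right_distrib divide_inverse mult.commute)
    moreover have "s2 (b / a) (g x) \<noteq> 0" using \<open>a \<noteq> 0\<close> \<open>b \<noteq> 0\<close> g_nz[OF E0[OF x]] by simp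
    ultimately show ?thesis by (metis vs2.in_span_one)
  qed
  define h where "h x = (SOME u. u \<in> vs2.span {g x} \<and> u \<noteq> 0 \<and> w + u \<in> vs2.span {g (e + x)})" for x
  have h: "h x \<in> vs2.span {g x}" "h x \<noteq> 0" "w + h x \<in> vs2.span {g (e + x)}" if "x \<notin> E" for x
    using someI_ex[OF h_ex[OF that]] by (auto simp: h_def)
  have h_uniq: "u = h x" if x: "x \<notin> E" and u: "u \<in> vs2.span {g x}" "w + u \<in> vs2.span {g (e + x)}" for x u
  proof -
    obtain a b where ab: "u = s2 a (g x)" "h x = s2 b (g x)"
      using u h[OF x] by (auto simp: vs2.in_span_one)
    obtain k l where kl: "w + u = s2 k (g (e + x))" "w + h x = s2 l (g (e + x))"
      using u h[OF x] by (auto simp: vs2.in_span_one)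
    have "s2 l (w + u) = s2 k (w + h x)" by (simp add: kl mult.commute)
    then have "s2 l w + s2 (l * a) (g x) = s2 k w + s2 (k * b) (g x)"
      by (simp add: ab vs2.scale_right_distrib)
    then have lk: "l = k" "l * a = k * b" using vs2.independent2_coeff[OF w gx_out[OF x]] by blast+
    have "k \<noteq> 0"
    proof
      assume "k = 0"
      then have "s2 1 w + s2 a (g x) = s2 0 w + s2 0 (g x)" using kl by (simp add: ab)
      then show False using vs2.independent2_coeff[OF w gx_out[OF x]] by fastforce
    qed
    then show ?thesis using lk ab by simp
  qed
  have gh: "g x \<in> vs2.span {h x}" if "x \<notin> E" for x
    using vs2.span_one_sym h[OF that] by blast
  have wh_nz: "w + h x \<noteq> 0" if "x \<notin> E" for x
  proof
    assume "w + h x = 0"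
    then have "h x = s2 (- 1) w" by (simp add: eq_neg_iff_add_eq_0 add.commute)
    then have "h x \<in> vs2.span {w}" unfolding vs2.in_span_one by (rule exI)
    then show False using gx_out[OF that] gh[OF that] vs2.span_one_trans by blast
  qed
  have gwh: "g (e + x) \<in> vs2.span {w + h x}" if "x \<notin> E" for x
    using vs2.span_one_sym h(3)[OF that] wh_nz[OF that] by blast
  have pair_mono: "u \<in> vs2.span {p, q}" if "u \<in> vs2.span {p', q'}" "p' \<in> vs2.span {p}" "q' \<in> vs2.span {q}" for u p q p' q'
  proof -
    have "p' \<in> vs2.span {p, q}" "q' \<in> vs2.span {p, q}"
      using that(2,3) vs2.span_mono[of "{p}" "{p, q}"] vs2.span_mono[of "{q}" "{p, q}"] by auto
    then have "vs2.span {p', q'} \<subseteq> vs2.span {p, q}" by (intro vs2.span_minimal vs2.subspace_span) auto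
    then show ?thesis using that(1) by blast
  qed
  have h_ind: "independent3 vs2.span w (h x) (h y)" if ind: "independent3 vs1.span e x y" for x y
  proof -
    have xE: "x \<notin> E" and yE: "y \<notin> E" and y: "y \<notin> vs1.span {e, x}"
      using ind E_pair by (auto simp: independent3_def E_def)
    have "independent3 vs2.span w (g x) (g y)" using g_ind[OF ind] by (simp add: w_def)
    moreover have "h x \<in> vs2.span {w} \<Longrightarrow> g x \<in> vs2.span {w}"
      using gh[OF xE] vs2.span_one_trans by blast
    moreover have "h y \<in> vs2.span {w, h x} \<Longrightarrow> g y \<in> vs2.span {w, g x}"
      using pair_mono[of "g y" w "h x" w "g x"] gh[OF yE] h(1)[OF xE] vs2.span_one_trans
      by (meson insertI1 vs2.span_base)
    ultimately show ?thesis by (auto simp: independent3_def)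
  qed
  have h_add3: "h (x + y) = h x + h y" if ind: "independent3 vs1.span e x y" for x y
  proof -
    have xE: "x \<notin> E" and yE: "y \<notin> E" and y: "y \<notin> vs1.span {e, x}"
      using ind E_pair by (auto simp: independent3_def E_def)
    have xyE: "x + y \<notin> E"
    proof
      assume "x + y \<in> E"
      then have "(x + y) - x \<in> vs1.span {e, x}" using E_pair by (intro vs1.span_diff) (auto intro: vs1.span_base)
      then show False using y by simp
    qed
    \<comment> \<open>The point of \<open>e + x + y\<close> is where the line through
      \<open>e + x\<close> and \<open>y\<close> meets the line through \<open>e + y\<close> and
      \<open>x\<close>. Comparing coefficients in the image identifies its direction as that of
      \<open>w + h x + h y\<close>.\<close>
    define p where "p = e + (x + y)"
    have p: "p \<noteq> 0" using ex_nz[OF xyE] by (simp add: p_def)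
    have "p \<in> vs1.span {e + x, y}" "p \<in> vs1.span {e + y, x}"
      using vs1.span_add[of "e + x" "{e + x, y}" y] vs1.span_add[of "e + y" "{e + y, x}" x]
      by (simp_all add: vs1.span_base p_def add_ac)
    then have "g p \<in> vs2.span {g (e + x), g y}" "g p \<in> vs2.span {g (e + y), g x}"
      using coll[OF p ex_nz[OF xE] E0[OF yE]] coll[OF p ex_nz[OF yE] E0[OF xE]] by simp_all
    then have "g p \<in> vs2.span {w + h x, h y}" "g p \<in> vs2.span {w + h y, h x}"
      using gwh[OF xE] gwh[OF yE] gh[OF xE] gh[OF yE] by (blast intro: pair_mono)+
    then obtain a b a' b' where ab: "g p = s2 a (w + h x) + s2 b (h y)" "g p = s2 a' (w + h y) + s2 b' (h x)"
      unfolding vs2.in_span_pair by blast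
    then have "s2 a w + s2 a (h x) + s2 b (h y) = s2 a' w + s2 b' (h x) + s2 a' (h y)"
      by (simp add: vs2.scale_right_distrib algebra_simps)
    then have "a = a' \<and> a = b' \<and> b = a'" by (rule vs2.independent3_coeff[OF h_ind[OF ind]])
    then have gp: "g p = s2 a (w + (h x + h y))" using ab(1) by (simp add: vs2.scale_right_distrib algebra_simps)
    have a0: "a \<noteq> 0" using gp g_nz[OF p] by auto
    have "p \<in> vs1.span {e, x + y}" unfolding p_def by (intro vs1.span_add vs1.span_base) auto
    then have "g p \<in> vs2.span {w, g (x + y)}" using coll[OF p e E0[OF xyE]] by (simp add: w_def)
    then obtain c d where cd: "g p = s2 c w + s2 d (g (x + y))" unfolding vs2.in_span_pair by blast
    have "x + y \<in> vs1.span {x, y}" by (intro vs1.span_add vs1.span_base) auto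
    then have "g (x + y) \<in> vs2.span {h x, h y}"
      using coll[OF E0[OF xyE] E0[OF xE] E0[OF yE]] gh[OF xE] gh[OF yE] by (blast intro: pair_mono)
    then obtain k l where kl: "g (x + y) = s2 k (h x) + s2 l (h y)" unfolding vs2.in_span_pair by blast
    have "s2 a w + s2 a (h x) + s2 a (h y) = s2 c w + s2 (d * k) (h x) + s2 (d * l) (h y)"
      using gp cd by (simp add: kl vs2.scale_right_distrib algebra_simps)
    note coeff = vs2.independent3_coeff[OF h_ind[OF ind] this]
    have "d * k = a" "d * l = a"
      by (rule coeff[THEN conjunct2, THEN conjunct1, symmetric], rule coeff[THEN conjunct2, THEN conjunct2, symmetric])
    then have "s2 a (h x + h y) = s2 d (g (x + y))" by (simp add: kl vs2.scale_right_distrib)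
    then have "s2 (inverse a) (s2 a (h x + h y)) = s2 (inverse a) (s2 d (g (x + y)))" by simp
    then have "h x + h y \<in> vs2.span {g (x + y)}" using a0 by (auto simp: vs2.in_span_one)
    moreover have "w + (h x + h y) = s2 (inverse a) (g p)" using a0 by (simp add: gp)
    then have "w + (h x + h y) \<in> vs2.span {g (e + (x + y))}" by (auto simp: vs2.in_span_one p_def)
    ultimately show ?thesis using h_uniq[OF xyE] by simp
  qed
  have ind3I: "independent3 vs1.span e x z" if "x \<notin> E" "z \<notin> vs1.span {e, x}" for x z
    using that e by (simp add: independent3_def E_def)
  have h_add: "h (x + y) = h x + h y" if xE: "x \<notin> E" and yE: "y \<notin> E" and xyE: "x + y \<notin> E" for x y
  proof (cases "y \<in> vs1.span {e, x}")
    case False then show ?thesis by (intro h_add3 ind3I xE)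
  next
    case True
    \<comment> \<open>The planar case is lifted into space: with \<open>z\<close> outside the plane,
      \<open>x + (y + z)\<close> and \<open>(x + y) + z\<close> can both be expanded in independent
      position, and \<open>h z\<close> cancels.\<close>
    obtain z where z: "z \<notin> vs1.span {e, x}" using third by blast
    have sub: "vs1.span {e, u} \<subseteq> vs1.span {e, x}" if "u \<in> vs1.span {e, x}" for u
      using that by (intro vs1.span_minimal vs1.subspace_span) (auto intro: vs1.span_base)
    have xy: "x + y \<in> vs1.span {e, x}" using True by (intro vs1.span_add) (auto intro: vs1.span_base)
    have yz: "y + z \<notin> vs1.span {e, x}"
      using vs1.span_diff[of "y + z" "{e, x}" y] True z by auto
    have "h (x + (y + z)) = h x + (h y + h z)"
      using h_add3[OF ind3I[OF xE yz]] h_add3[OF ind3I[OF yE, of z]] sub[OF True] z by auto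
    moreover have "h ((x + y) + z) = h (x + y) + h z"
      using h_add3[OF ind3I[OF xyE, of z]] sub[OF xy] z by auto
    ultimately show ?thesis by (simp add: add.assoc)
  qed
  have h_shift0: "h (x + z) - h z = h (x + z') - h z'" if "x \<in> E" "z \<notin> E" "z' \<notin> E" "z + z' \<notin> E" for x z z'
  proof -
    have out: "x + (z + z') \<notin> E" by (rule add_out[OF that(1,4)])
    have "h (x + z) + h z' = h ((x + z) + z')"
      by (rule h_add[symmetric, OF add_out[OF that(1,2)] that(3)]) (use out in \<open>simp add: add.assoc\<close>)
    also have "(x + z) + z' = (x + z') + z" by (simp add: add_ac)
    also have "h ((x + z') + z) = h (x + z') + h z"
      by (rule h_add[OF add_out[OF that(1,3)] that(2)]) (use out in \<open>simp add: add_ac\<close>)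
    finally show ?thesis by (simp add: algebra_simps)
  qed
  have h_shift: "h (x + z) - h z = h (x + z') - h z'" if x: "x \<in> E" and z: "z \<notin> E" "z' \<notin> E" for x z z'
  proof (cases "z + z' \<in> E")
    case False then show ?thesis by (intro h_shift0 x z)
  next
    case True
    \<comment> \<open>When \<open>z + z'\<close> falls into \<open>E\<close>, the comparison passes
      through a third vector \<open>y\<close> for which neither \<open>z + y\<close> nor
      \<open>z' + y\<close> does.\<close>
    obtain y where y: "y \<notin> vs1.span {e, z}" using third by blast
    then have yE: "y \<notin> E" using E_pair by blast
    have zs: "z \<in> vs1.span {e, z}" by (rule vs1.span_base) simp
    have "z' \<in> vs1.span {e, z}"
      using vs1.span_diff[of "z + z'" "{e, z}" z] True E_pair[of z] zs by auto
    then have "z + y \<notin> E" "z' + y \<notin> E"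
      using vs1.span_diff[of "z + y" "{e, z}" z] vs1.span_diff[of "z' + y" "{e, z}" z'] zs y E_pair[of z] by auto
    then show ?thesis using h_shift0[OF x z(1) yE] h_shift0[OF x z(2) yE] by simp
  qed
  define U where "U x = (if x \<in> E then h (x + f) - h f else h x)" for x
  have U_out: "U x = h x" if "x \<notin> E" for x using that by (simp add: U_def)
  have U_in: "U x = h (x + z) - h z" if "x \<in> E" "z \<notin> E" for x z
    using that h_shift[OF that(1) fE that(2)] by (simp add: U_def)
  have U_add1: "U (x + y) = U x + U y" if "x \<in> E" "y \<notin> E" for x y
    using U_in[OF that] U_out[OF that(2)] U_out[OF add_out[OF that]] by simp
  have U_add: "U (x + y) = U x + U y" for x y
  proof -
    consider "x \<in> E" "y \<notin> E" | "x \<notin> E" "y \<in> E" | "x \<in> E" "y \<in> E" | "x \<notin> E" "y \<notin> E" "x + y \<notin> E"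
      | "x \<notin> E" "y \<notin> E" "x + y \<in> E" by blast
    then show ?thesis
    proof cases
      case 1 then show ?thesis by (rule U_add1)
    next
      case 2 then show ?thesis using U_add1[of y x] by (simp add: add.commute)
    next
      case 3
      then have "x + y \<in> E" by (rule vs1.subspace_add[OF E_sub])
      then have "U (x + y) = h (x + (y + f)) - h f" using U_in[OF _ fE] by (simp add: add.assoc)
      also have "\<dots> = (h (x + (y + f)) - h (y + f)) + (h (y + f) - h f)" by simp
      also have "\<dots> = U x + U y" using U_in[OF 3(1) add_out[OF 3(2) fE]] U_in[OF 3(2) fE] by simp
      finally show ?thesis .
    next
      case 4 then show ?thesis using h_add by (simp add: U_out)
    next
      case 5
      obtain z where z: "z \<notin> vs1.span {e, x}" using third by blast
      then have zE: "z \<notin> E" using E_pair by blast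
      have xs: "x \<in> vs1.span {e, x}" by (rule vs1.span_base) simp
      have "y \<in> vs1.span {e, x}"
        using vs1.span_diff[of "x + y" "{e, x}" x] 5(3) E_pair[of x] xs by auto
      then have yz: "y + z \<notin> E"
        using vs1.span_diff[of "y + z" "{e, x}" y] z E_pair[of x] by auto
      have "U (x + y) = h (x + (y + z)) - h z" using U_in[OF 5(3) zE] by (simp add: add.assoc)
      also have "h (x + (y + z)) = h x + h (y + z)"
        using add_out[OF 5(3) zE] by (intro h_add 5 yz) (simp add: add.assoc)
      also have "h (y + z) = h y + h z" by (intro h_add 5 zE yz)
      finally show ?thesis using 5 by (simp add: U_out)
    qed
  qed
  have U0: "U 0 = 0" using U_add[of 0 0] by simp
  have U_diff: "U (x - y) = U x - U y" for x y using U_add[of "x - y" y] by (simp add: algebra_simps)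
  have U_g: "U x \<in> vs2.span {g x} \<and> U x \<noteq> 0" if x0: "x \<noteq> 0" for x
  proof (cases "x \<in> E")
    case False then show ?thesis using h by (simp add: U_out)
  next
    case True
    then have ex: "e \<in> vs1.span {x}" unfolding E_def by (rule vs1.span_one_sym[OF _ x0])
    have Ex: "E = vs1.span {x}"
      using True ex unfolding E_def
      by (intro equalityI vs1.span_minimal vs1.subspace_span) auto
    \<comment> \<open>For \<open>x\<close> in \<open>E\<close> the direction of \<open>U x\<close>
      is found by intersection: it lies in the plane of \<open>g x\<close> and \<open>g z\<close>
      for each \<open>z\<close> outside \<open>E\<close>, and the planes for \<open>f\<close> and
      \<open>f'\<close> have only the line of \<open>g x\<close> in common.\<close>
    have memx: "U x \<in> vs2.span {g x, g z}" if z: "z \<notin> E" for z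
    proof -
      have xz: "x + z \<notin> E" by (rule add_out[OF True z])
      have "x + z \<in> vs1.span {x, z}" by (intro vs1.span_add vs1.span_base) auto
      then have "g (x + z) \<in> vs2.span {g x, g z}" using coll[OF E0[OF xz] x0 E0[OF z]] by simp
      then have "h (x + z) \<in> vs2.span {g x, g z}" using h(1)[OF xz] vs2.span_one_trans by blast
      moreover have "h z \<in> vs2.span {g x, g z}"
        using h(1)[OF z] vs2.span_one_trans vs2.span_base by (metis insertI1 insert_commute)
      ultimately show ?thesis using U_in[OF True z] vs2.span_diff by simp
    qed
    have f'E: "f' \<notin> E" using f' E_pair by blast
    have "f' \<notin> vs1.span {x, f}"
    proof
      have "vs1.span {x, f} \<subseteq> vs1.span {e, f}"
        using True E_pair by (intro vs1.span_minimal vs1.subspace_span) (auto intro: vs1.span_base)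
      moreover assume "f' \<in> vs1.span {x, f}"
      ultimately show False using f' by blast
    qed
    then have "independent3 vs1.span x f f'" using x0 fE by (simp add: independent3_def Ex)
    then have ind: "independent3 vs2.span (g x) (g f) (g f')" by (rule g_ind)
    obtain a b a' b' where ab: "U x = s2 a (g x) + s2 b (g f)" "U x = s2 a' (g x) + s2 b' (g f')"
      using memx[OF fE] memx[OF f'E] unfolding vs2.in_span_pair by blast
    then have "s2 a (g x) + s2 b (g f) + s2 0 (g f') = s2 a' (g x) + s2 0 (g f) + s2 b' (g f')" by simp
    then have "b = 0" using vs2.independent3_coeff[OF ind] by blast
    then have "U x \<in> vs2.span {g x}" using ab(1) by (auto simp: vs2.in_span_one)
    moreover have "U x \<noteq> 0"
    proof
      assume "U x = 0"
      then have eq: "h (x + f) = h f" using U_in[OF True fE] by simp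
      have xf: "x + f \<notin> E" by (rule add_out[OF True fE])
      have "g (x + f) \<in> vs2.span {g f}"
        using gh[OF xf] h(1)[OF fE] vs2.span_one_trans by (simp add: eq)
      then have "x + f \<in> vs1.span {f}" using coll1[OF E0[OF xf] E0[OF fE]] by simp
      then have "x \<in> vs1.span {f}"
        using vs1.span_diff[of "x + f" "{f}" f] vs1.span_base[of f "{f}"] by simp
      then have "f \<in> E" unfolding Ex by (rule vs1.span_one_sym[OF _ x0])
      then show False using fE by simp
    qed
    ultimately show ?thesis by blast
  qed
  have gU: "g x \<in> vs2.span {U x}" if "x \<noteq> 0" for x
    using U_g[OF that] vs2.span_one_sym by blast
  have span_eq: "vs2.span {U x} = vs2.span {g x}" if "x \<noteq> 0" for x
    using U_g[OF that] gU[OF that] by (intro equalityI vs2.span_minimal vs2.subspace_span) auto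
  have U_eq0: "x = 0" if "U x = 0" for x using U_g that by blast
  have U_ind: "U y \<notin> vs2.span {U x}" if "x \<noteq> 0" "y \<noteq> 0" "y \<notin> vs1.span {x}" for x y
  proof
    assume "U y \<in> vs2.span {U x}"
    then have "g y \<in> vs2.span {g x}" using span_eq[OF that(1)] gU[OF that(2)] vs2.span_one_trans by blast
    then show False using coll1[OF that(2,1)] that(3) by simp
  qed
  have U_mult: "\<exists>k. U (s1 c x) = s2 k (U x)" if x: "x \<noteq> 0" for c x
  proof (cases "c = 0")
    case True then show ?thesis using U0 by (metis vs1.scale_zero_left vs2.scale_zero_left)
  next
    case False
    then have cx: "s1 c x \<noteq> 0" using x by simp
    have "s1 c x \<in> vs1.span {x}" by (auto simp: vs1.in_span_one)
    then have "g (s1 c x) \<in> vs2.span {g x}" using coll1[OF cx x] by simp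
    then have "U (s1 c x) \<in> vs2.span {U x}"
      using U_g[OF cx] span_eq[OF x] vs2.span_one_trans by blast
    then show ?thesis by (simp add: vs2.in_span_one)
  qed
  \<comment> \<open>Scaling by \<open>c\<close> multiplies \<open>U x\<close>, \<open>U y\<close>
    and \<open>U (x + y)\<close> by scalars, which agree because \<open>U x\<close> and
    \<open>U y\<close> are independent. So the scalar depends on \<open>c\<close> alone.\<close>
  have U_same: "U (s1 c y) = s2 k (U y)"
    if xy: "x \<noteq> 0" "y \<noteq> 0" "y \<notin> vs1.span {x}" and k: "U (s1 c x) = s2 k (U x)" for c k x y
  proof -
    have "x + y \<noteq> 0"
    proof
      assume "x + y = 0"
      then have "y = s1 (- 1) x" by (simp add: eq_neg_iff_add_eq_0 add.commute)
      then have "y \<in> vs1.span {x}" unfolding vs1.in_span_one by (rule exI)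
      then show False using xy(3) by simp
    qed
    then obtain m where m: "U (s1 c (x + y)) = s2 m (U (x + y))" using U_mult by blast
    obtain l where l: "U (s1 c y) = s2 l (U y)" using U_mult[OF xy(2)] by blast
    have "s2 k (U x) + s2 l (U y) = s2 m (U x) + s2 m (U y)"
      using m by (simp add: vs1.scale_right_distrib vs2.scale_right_distrib U_add k l)
    then have "k = m \<and> l = m"
      using vs2.independent2_coeff[OF _ U_ind[OF xy]] U_eq0 xy(1) by blast
    then show ?thesis using l by simp
  qed
  define \<sigma> where "\<sigma> c = (SOME k. U (s1 c e) = s2 k (U e))" for c
  have Ue: "U (s1 c e) = s2 (\<sigma> c) (U e)" for c
    unfolding \<sigma>_def by (rule someI_ex[OF U_mult[OF e]])
  have U_scale_out: "U (s1 c x) = s2 (\<sigma> c) (U x)" if "x \<notin> E" for c x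
    by (rule U_same[OF e E0[OF that] _ Ue]) (use that in \<open>simp add: E_def\<close>)
  have U_scale: "U (s1 c x) = s2 (\<sigma> c) (U x)" for c x
  proof (cases "x \<in> E \<and> x \<noteq> 0")
    case True
    have "x \<notin> vs1.span {f}"
    proof
      assume "x \<in> vs1.span {f}"
      then have "f \<in> vs1.span {x}" using True vs1.span_one_sym by blast
      moreover have "vs1.span {x} \<subseteq> E" unfolding E_def
        using True by (intro vs1.span_minimal vs1.subspace_span) (auto simp: E_def)
      ultimately show False using fE by blast
    qed
    then show ?thesis using U_same[OF E0[OF fE] _ _ U_scale_out[OF fE]] True by blast
  next
    case False
    then show ?thesis using U_scale_out U0 by (cases "x = 0") auto
  qed
  have Ue0: "U e \<noteq> 0" using U_eq0 e by blast
  have s_add: "\<sigma> (a + b) = \<sigma> a + \<sigma> b" for a b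
  proof -
    have "s2 (\<sigma> (a + b)) (U e) = s2 (\<sigma> a + \<sigma> b) (U e)"
      by (simp add: Ue[symmetric] vs1.scale_left_distrib vs2.scale_left_distrib U_add)
    then show ?thesis using Ue0 by simp
  qed
  have s_mult: "\<sigma> (a * b) = \<sigma> a * \<sigma> b" for a b
  proof -
    have "s2 (\<sigma> (a * b)) (U e) = s2 (\<sigma> a * \<sigma> b) (U e)"
      using U_scale[of a "s1 b e"] by (simp add: Ue)
    then show ?thesis using Ue0 by simp
  qed
  have s_one: "\<sigma> 1 = 1"
  proof -
    have "s2 (\<sigma> 1) (U e) = s2 1 (U e)" by (simp add: Ue[symmetric])
    then show ?thesis using Ue0 by (simp only: vs2.scale_right_imp_eq)
  qed
  have s_inj: "a = b" if "\<sigma> a = \<sigma> b" for a b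
  proof -
    have "\<sigma> (a - b) = 0" using s_add[of "a - b" b] that by simp
    then have "U (s1 (a - b) e) = 0" by (simp add: Ue)
    then show ?thesis using U_eq0 e by fastforce
  qed
  have "\<sigma> 0 + \<sigma> 0 = \<sigma> 0 + 0" using s_add[of 0 0, symmetric] by (simp only: add_0_left add_0_right)
  then have s_zero: "\<sigma> 0 = 0" by (rule add_left_imp_eq)
  have f_nz: "f \<noteq> 0" by (rule E0[OF fE])
  have fe: "f \<notin> vs1.span {e}" using fE by (simp add: E_def)
  \<comment> \<open>Given \<open>d\<close>, a vector representing the line of
    \<open>U e + d U f\<close> lies in the plane of \<open>e\<close> and \<open>f\<close>, and the
    quotient of its coordinates is mapped to \<open>d\<close>.\<close>
  have s_surj: "\<exists>c. \<sigma> c = d" for d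
  proof -
    have nz: "U e + s2 d (U f) \<noteq> 0"
    proof
      assume "U e + s2 d (U f) = 0"
      then have "s2 1 (U e) + s2 d (U f) = s2 0 (U e) + s2 0 (U f)" by simp
      then show False using vs2.independent2_coeff[OF Ue0 U_ind[OF e f_nz fe]] by fastforce
    qed
    then obtain z where z: "z \<noteq> 0" "U e + s2 d (U f) \<in> vs2.span {g z}" using onto by blast
    then obtain m where m: "U e + s2 d (U f) = s2 m (U z)"
      using span_eq[OF z(1)] by (metis vs2.in_span_one)
    have "g z \<in> vs2.span {U e + s2 d (U f)}" by (rule vs2.span_one_sym[OF z(2) nz])
    moreover have "U e + s2 d (U f) \<in> vs2.span {U e, U f}" by (intro vs2.span_add vs2.span_scale vs2.span_base) auto
    ultimately have "g z \<in> vs2.span {U e, U f}" by (rule vs2.span_one_trans)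
    then have "g z \<in> vs2.span {g e, g f}" using U_g[OF e] U_g[OF f_nz] by (blast intro: pair_mono)
    then have "z \<in> vs1.span {e, f}" using coll[OF z(1) e f_nz] by simp
    then obtain a b where ab: "z = s1 a e + s1 b f" by (auto simp: vs1.in_span_pair)
    have "s2 1 (U e) + s2 d (U f) = s2 (m * \<sigma> a) (U e) + s2 (m * \<sigma> b) (U f)"
      using m by (simp add: ab U_add U_scale vs2.scale_right_distrib)
    then have "1 = m * \<sigma> a \<and> d = m * \<sigma> b" by (rule vs2.independent2_coeff[OF Ue0 U_ind[OF e f_nz fe]])
    moreover from this have "a \<noteq> 0" using s_zero by auto
    then have "\<sigma> (b / a) * \<sigma> a = \<sigma> b" by (simp add: s_mult[symmetric])
    ultimately have "\<sigma> (b / a) = d" by (metis mult.assoc mult.commute mult.right_neutral)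
    then show ?thesis by blast
  qed
  have "field_automorphism \<sigma>"
    unfolding field_automorphism_def bij_def inj_def surj_def
    using s_inj s_surj s_one s_add s_mult by metis
  moreover have "bij U"
    unfolding bij_def
  proof
    show "inj U"
    proof (rule injI)
      fix x y assume "U x = U y"
      then have "U (x - y) = 0" by (simp add: U_diff)
      then show "x = y" using U_eq0[of "x - y"] by simp
    qed
    show "surj U"
    proof -
      have "\<exists>x. U x = v" for v
      proof (cases "v = 0")
        case True then show ?thesis using U0 by blast
      next
        case False
        then obtain x where x: "x \<noteq> 0" "v \<in> vs2.span {g x}" using onto by blast
        then obtain k where "v = s2 k (U x)" using span_eq[OF x(1)] by (metis vs2.in_span_one)
        moreover obtain c where "\<sigma> c = k" using s_surj by blast
        ultimately have "U (s1 c x) = v" by (simp add: U_scale)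
        then show ?thesis by blast
      qed
      then show ?thesis unfolding surj_def by metis
    qed
  qed
  ultimately show ?thesis using that U_add U_scale span_eq by blast
qed

end

section \<open>Bijections of grids\<close>

text \<open>Two rows cannot share their image row, since they contain nonadjacent points, whose
  images would then be adjacent. Points of one column are adjacent and lie in different rows, so
  their images share the second coordinate.\<close>

lemma grid_bijection_rows:
  assumes bij: "bij_betw F (P \<times> P) (Q \<times> Q)"
    and adj: "\<And>p q. p \<in> P \<times> P \<Longrightarrow> q \<in> P \<times> P \<Longrightarrow>
      fst p = fst q \<or> snd p = snd q \<longleftrightarrow> fst (F p) = fst (F q) \<or> snd (F p) = snd (F q)"
    and ab: "a \<in> P" "b \<in> P" "a \<noteq> b"
    and rows: "\<And>x y y'. x \<in> P \<Longrightarrow> y \<in> P \<Longrightarrow> y' \<in> P \<Longrightarrow> fst (F (x, y)) = fst (F (x, y'))"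
  shows "\<exists>f g. bij_betw f P Q \<and> bij_betw g P Q \<and> (\<forall>x\<in>P. \<forall>y\<in>P. F (x, y) = (f x, g y))"
proof -
  have inj: "p = q" if "p \<in> P \<times> P" "q \<in> P \<times> P" "F p = F q" for p q
    using bij that by (meson bij_betw_imp_inj_on inj_onD)
  have onto: "\<exists>p\<in>P \<times> P. F p = q" if "q \<in> Q \<times> Q" for q
    using bij that by (metis bij_betw_imp_surj_on imageE)
  have mem: "F p \<in> Q \<times> Q" if "p \<in> P \<times> P" for p using bij that by (auto dest: bij_betwE)
  have same_row: "x = x'" if "x \<in> P" "x' \<in> P" "y \<in> P" "y' \<in> P" and eq: "fst (F (x, y)) = fst (F (x', y'))" for x x' y y'
  proof (rule ccontr)
    assume "x \<noteq> x'"
    have "fst (F (x, a)) = fst (F (x', b))"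
      using rows[of x a y] rows[of x' b y'] that ab eq by simp
    then show False using adj[of "(x, a)" "(x', b)"] that ab \<open>x \<noteq> x'\<close> by simp
  qed
  have cols: "snd (F (x, y)) = snd (F (x', y))" if "x \<in> P" "x' \<in> P" "y \<in> P" for x x' y
  proof (cases "x = x'")
    case False
    have "fst (F (x, y)) = fst (F (x', y)) \<or> snd (F (x, y)) = snd (F (x', y))"
      using adj[of "(x, y)" "(x', y)"] that by simp
    then show ?thesis using same_row[of x x' y y] that False by blast
  qed simp
  define f where "f x = fst (F (x, a))" for x
  define g where "g y = snd (F (a, y))" for y
  have F: "F (x, y) = (f x, g y)" if "x \<in> P" "y \<in> P" for x y
    using rows[of x y a] cols[of x a y] that ab by (simp add: f_def g_def prod_eq_iff)
  have "bij_betw f P Q"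
    unfolding bij_betw_def
  proof
    show "inj_on f P" using inj[of "(_, a)" "(_, a)"] F ab by (auto intro!: inj_onI)
    show "f ` P = Q"
    proof
      show "f ` P \<subseteq> Q" using mem[of "(_, a)"] F ab by auto
      have "g a \<in> Q" using mem[of "(a, a)"] F ab by auto
      then show "Q \<subseteq> f ` P" using onto[of "(_, g a)"] F by (fastforce simp: image_iff)
    qed
  qed
  moreover have "bij_betw g P Q"
    unfolding bij_betw_def
  proof
    show "inj_on g P" using inj[of "(a, _)" "(a, _)"] F ab by (auto intro!: inj_onI)
    show "g ` P = Q"
    proof
      show "g ` P \<subseteq> Q" using mem[of "(a, _)"] F ab by auto
      have "f a \<in> Q" using mem[of "(a, a)"] F ab by auto
      then show "Q \<subseteq> g ` P" using onto[of "(f a, _)"] F by (fastforce simp: image_iff)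
    qed
  qed
  ultimately show ?thesis using F by blast
qed

text \<open>The points of a row are pairwise adjacent, so that their images lie in one row or in one
  column. If both types occurred, an image row and an image column would meet; the preimage of the
  meeting point is adjacent to all points of two rows and hence lies in both, so that the rows
  coincide.\<close>

lemma grid_bijection:
  assumes bij: "bij_betw F (P \<times> P) (Q \<times> Q)"
    and adj: "\<And>p q. p \<in> P \<times> P \<Longrightarrow> q \<in> P \<times> P \<Longrightarrow>
      fst p = fst q \<or> snd p = snd q \<longleftrightarrow> fst (F p) = fst (F q) \<or> snd (F p) = snd (F q)"
    and ab: "a \<in> P" "b \<in> P" "a \<noteq> b"
  shows "\<exists>f g. bij_betw f P Q \<and> bij_betw g P Q \<and>
    ((\<forall>x\<in>P. \<forall>y\<in>P. F (x, y) = (f x, g y)) \<or> (\<forall>x\<in>P. \<forall>y\<in>P. F (x, y) = (g y, f x)))"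
proof -
  have inj: "p = q" if "p \<in> P \<times> P" "q \<in> P \<times> P" "F p = F q" for p q
    using bij that by (meson bij_betw_imp_inj_on inj_onD)
  have onto: "\<exists>p\<in>P \<times> P. F p = q" if "q \<in> Q \<times> Q" for q
    using bij that by (metis bij_betw_imp_surj_on imageE)
  have mem: "F p \<in> Q \<times> Q" if "p \<in> P \<times> P" for p using bij that by (auto dest: bij_betwE)
  define R where "R x \<longleftrightarrow> (\<forall>y\<in>P. \<forall>y'\<in>P. fst (F (x, y)) = fst (F (x, y')))" for x
  define C where "C x \<longleftrightarrow> (\<forall>y\<in>P. \<forall>y'\<in>P. snd (F (x, y)) = snd (F (x, y')))" for x
  have row: "fst (F (x, y)) = fst (F (x, y')) \<or> snd (F (x, y)) = snd (F (x, y'))"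
    if "x \<in> P" "y \<in> P" "y' \<in> P" for x y y'
    using adj[of "(x, y)" "(x, y')"] that by simp
  have RC: "R x \<or> C x" if x: "x \<in> P" for x
  proof (rule ccontr)
    assume "\<not> (R x \<or> C x)"
    then obtain y1 y2 where y: "y1 \<in> P" "y2 \<in> P" "fst (F (x, y1)) \<noteq> fst (F (x, y2))" by (auto simp: R_def)
    have "snd (F (x, y)) = snd (F (x, y1))" if "y \<in> P" for y
      using row[OF x that y(1)] row[OF x that y(2)] row[OF x y(1,2)] y(3) by metis
    then show False using \<open>\<not> (R x \<or> C x)\<close> by (simp add: C_def)
  qed
  \<comment> \<open>Adjacency to \<open>(x, a)\<close> and \<open>(x, b)\<close> already forces the
    row, as the column cannot be both \<open>a\<close> and \<open>b\<close>.\<close>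
  have hit: "x'' = x" if x: "x \<in> P" and x'': "x'' \<in> P" "y'' \<in> P"
    and "\<And>y. y \<in> P \<Longrightarrow> fst (F (x, y)) = fst (F (x'', y'')) \<or> snd (F (x, y)) = snd (F (x'', y''))" for x x'' y''
    using adj[of "(x, a)" "(x'', y'')"] adj[of "(x, b)" "(x'', y'')"] that ab by auto
  have "x = x'" if R: "R x" and C: "C x'" and x: "x \<in> P" "x' \<in> P" for x x'
  proof -
    let ?q = "(fst (F (x, a)), snd (F (x', a)))"
    have "?q \<in> Q \<times> Q" using mem[of "(x, a)"] mem[of "(x', a)"] x ab by auto
    then obtain x'' y'' where p: "x'' \<in> P" "y'' \<in> P" "F (x'', y'') = ?q" using onto by blast
    have "fst (F (x, y)) = fst (F (x'', y''))" if "y \<in> P" for y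
      using R that ab(1) unfolding R_def p(3) fst_conv by blast
    then have "x'' = x" using hit[OF x(1) p(1,2)] by blast
    moreover have "snd (F (x', y)) = snd (F (x'', y''))" if "y \<in> P" for y
      using C that ab(1) unfolding C_def p(3) snd_conv by blast
    then have "x'' = x'" using hit[OF x(2) p(1,2)] by blast
    ultimately show ?thesis by simp
  qed
  then have "(\<forall>x\<in>P. R x) \<or> (\<forall>x\<in>P. C x)" using RC ab by metis
  then show ?thesis
  proof
    assume R: "\<forall>x\<in>P. R x"
    have "\<exists>f g. bij_betw f P Q \<and> bij_betw g P Q \<and> (\<forall>x\<in>P. \<forall>y\<in>P. F (x, y) = (f x, g y))"
      by (rule grid_bijection_rows[OF bij adj ab R[unfolded R_def, rule_format]])
    then show ?thesis by blast
  next
    assume C: "\<forall>x\<in>P. C x"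
    have "bij_betw prod.swap (Q \<times> Q) (Q \<times> Q)" by (intro bij_betwI[where g = prod.swap]) auto
    then have bij': "bij_betw (prod.swap \<circ> F) (P \<times> P) (Q \<times> Q)" by (rule bij_betw_trans[OF bij])
    have "\<exists>f g. bij_betw f P Q \<and> bij_betw g P Q \<and> (\<forall>x\<in>P. \<forall>y\<in>P. (prod.swap \<circ> F) (x, y) = (f x, g y))"
    proof (intro grid_bijection_rows[OF bij' _ ab])
      show "fst p = fst q \<or> snd p = snd q \<longleftrightarrow>
          fst ((prod.swap \<circ> F) p) = fst ((prod.swap \<circ> F) q) \<or> snd ((prod.swap \<circ> F) p) = snd ((prod.swap \<circ> F) q)"
        if "p \<in> P \<times> P" "q \<in> P \<times> P" for p q
        using adj[OF that] by auto
      show "fst ((prod.swap \<circ> F) (x, y)) = fst ((prod.swap \<circ> F) (x, y'))" if "x \<in> P" "y \<in> P" "y' \<in> P" for x y y'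
        using C[unfolded C_def, rule_format, OF that] by simp
    qed
    then obtain f g where fg: "bij_betw f P Q" "bij_betw g P Q" "\<forall>x\<in>P. \<forall>y\<in>P. prod.swap (F (x, y)) = (f x, g y)"
      by auto
    then have "\<forall>x\<in>P. \<forall>y\<in>P. F (x, y) = (g y, f x)" by (metis swap_simp swap_swap)
    then show ?thesis using fg by blast
  qed
qed

section \<open>Bijections of normal parts\<close>

lemma module_span_scaleC: "module.span scaleC = cspan"
  by (simp add: cspan_def)

definition projective_points :: "'a::complex_normed_vector set set" where
  "projective_points = (\<lambda>x. cspan {x}) ` (- {0})"

definition representative :: "'a::complex_normed_vector set \<Rightarrow> 'a" where
  "representative X = (SOME x. x \<noteq> 0 \<and> cspan {x} = X)"

lemma representative:
  assumes "X \<in> projective_points"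
  shows "representative X \<noteq> 0" "cspan {representative X} = X"
proof -
  have "\<exists>x. x \<noteq> 0 \<and> cspan {x} = X" using assms by (auto simp: projective_points_def)
  from someI_ex[OF this] show "representative X \<noteq> 0" "cspan {representative X} = X"
    by (simp_all add: representative_def)
qed

lemma cspan_projective_point: "x \<noteq> 0 \<Longrightarrow> cspan {x} \<in> projective_points"
  by (auto simp: projective_points_def)

text \<open>Grid coordinates of the normal part. The chosen representatives do not matter, because
  scaling the vectors leaves the kernel unchanged.\<close>

definition kernel_of_points :: "('h::complex_hilbert \<Rightarrow>\<^sub>L 'h) set \<Rightarrow> 'h set \<times> 'h set \<Rightarrow> ('h \<Rightarrow>\<^sub>L 'h) set" where
  "kernel_of_points A p = kernel_on A (omega (representative (fst p)) (representative (snd p)))"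

lemma kernel_normal_part: "x \<noteq> 0 \<Longrightarrow> y \<noteq> 0 \<Longrightarrow> kernel_on A (omega x y) \<in> normal_part A"
  by (auto simp: normal_part_def)

lemma normal_part_subset: "I \<in> normal_part A \<Longrightarrow> I \<subseteq> A"
  by (auto simp: normal_part_def kernel_on_def)

context irreducible_algebra
begin

lemma kernel_of_points_cspan:
  assumes "x \<noteq> 0" "y \<noteq> 0"
  shows "kernel_of_points A (cspan {x}, cspan {y}) = kernel_on A (omega x y)"
  using assms representative[OF cspan_projective_point[OF assms(1)]] representative[OF cspan_projective_point[OF assms(2)]]
  by (simp add: kernel_of_points_def kernel_eq_iff)

lemma kernel_of_points_bij:
  "bij_betw (kernel_of_points A) (projective_points \<times> projective_points) (normal_part A)"
  unfolding bij_betw_def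
proof
  show "inj_on (kernel_of_points A) (projective_points \<times> projective_points)"
  proof (rule inj_onI)
    fix p q :: "'h set \<times> 'h set"
    assume p: "p \<in> projective_points \<times> projective_points" and q: "q \<in> projective_points \<times> projective_points"
      and eq: "kernel_of_points A p = kernel_of_points A q"
    obtain x y where "x \<noteq> 0" "y \<noteq> 0" "p = (cspan {x}, cspan {y})" using p by (auto simp: projective_points_def)
    moreover obtain x' y' where "x' \<noteq> 0" "y' \<noteq> 0" "q = (cspan {x'}, cspan {y'})" using q by (auto simp: projective_points_def)
    ultimately show "p = q" using eq by (simp add: kernel_of_points_cspan kernel_eq_iff)
  qed
  show "kernel_of_points A ` (projective_points \<times> projective_points) = normal_part A"
  proof
    show "kernel_of_points A ` (projective_points \<times> projective_points) \<subseteq> normal_part A"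
      by (auto simp: kernel_of_points_def intro!: kernel_normal_part representative)
    show "normal_part A \<subseteq> kernel_of_points A ` (projective_points \<times> projective_points)"
    proof
      fix I assume "I \<in> normal_part A"
      then obtain x y where "x \<noteq> 0" "y \<noteq> 0" "I = kernel_on A (omega x y)" by (auto simp: normal_part_def)
      then show "I \<in> kernel_of_points A ` (projective_points \<times> projective_points)"
        by (intro image_eqI[of _ _ "(cspan {x}, cspan {y})"]) (auto simp: kernel_of_points_cspan cspan_projective_point)
    qed
  qed
qed

text \<open>The right-hand side speaks of closures of at most two points only and is therefore
  respected by a finite homeomorphism. The third point on a common line comes from the sum of the
  two differing coordinates. A single point is its own closure, whence the separate disjunct for
  equality.\<close>

lemma kernel_of_points_adjacent:
  assumes p: "p \<in> projective_points \<times> projective_points" and q: "q \<in> projective_points \<times> projective_points"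
  shows "fst p = fst q \<or> snd p = snd q \<longleftrightarrow> kernel_of_points A p = kernel_of_points A q \<or>
    (\<exists>I\<in>normal_part A. I \<noteq> kernel_of_points A p \<and> I \<noteq> kernel_of_points A q \<and>
      A \<inter> \<Inter>{kernel_of_points A p, kernel_of_points A q} \<subseteq> I)" (is "?L \<longleftrightarrow> ?R")
proof -
  obtain x1 y1 where p': "x1 \<noteq> 0" "y1 \<noteq> 0" "p = (cspan {x1}, cspan {y1})" using p by (auto simp: projective_points_def)
  obtain x2 y2 where q': "x2 \<noteq> 0" "y2 \<noteq> 0" "q = (cspan {x2}, cspan {y2})" using q by (auto simp: projective_points_def)
  note kp = kernel_of_points_cspan[OF p'(1,2)] and kq = kernel_of_points_cspan[OF q'(1,2)]
  have sum_nz: "u + v \<noteq> 0 \<and> u + v \<notin> cspan {u} \<and> u + v \<notin> cspan {v}"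
    if "u \<noteq> 0" "v \<noteq> 0" "cspan {u} \<noteq> cspan {v}" for u v :: 'h
  proof -
    have v: "v \<notin> cspan {u}" "u \<notin> cspan {v}" using that cspan_singleton_eq_iff by metis+
    have "u + v \<notin> cspan {u}"
      using complex_vector.span_diff[of "u + v" "{u}" u] complex_vector.span_base[of u "{u}"] v(1) by auto
    moreover have "u + v \<notin> cspan {v}"
      using complex_vector.span_diff[of "u + v" "{v}" v] complex_vector.span_base[of v "{v}"] v(2) by auto
    ultimately show ?thesis using complex_vector.span_zero[of "{u}"] by metis
  qed
  show ?thesis
  proof
    assume L: ?L
    show ?R
    proof (cases "p = q")
      case False
      with L p' q' consider "cspan {x1} = cspan {x2}" "cspan {y1} \<noteq> cspan {y2}"
        | "cspan {y1} = cspan {y2}" "cspan {x1} \<noteq> cspan {x2}" by auto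
      then show ?thesis
      proof cases
        case 1
        note nz = sum_nz[OF p'(2) q'(2) 1(2)]
        have k2: "kernel_on A (omega x2 y2) = kernel_on A (omega x1 y2)"
          using 1 p' q' by (simp add: kernel_eq_iff)
        have "kernel_on A (omega x1 y1) \<inter> kernel_on A (omega x1 y2) \<subseteq> kernel_on A (omega x1 (y1 + y2))"
          by (auto simp: kernel_on_def omega_def cinner_simps)
        moreover have "cspan {y1 + y2} \<noteq> cspan {y1}" "cspan {y1 + y2} \<noteq> cspan {y2}"
          using nz p' q' by (simp_all add: cspan_singleton_eq_iff)
        ultimately have "kernel_on A (omega x1 (y1 + y2)) \<in> normal_part A \<and>
          kernel_on A (omega x1 (y1 + y2)) \<noteq> kernel_of_points A p \<and>
          kernel_on A (omega x1 (y1 + y2)) \<noteq> kernel_of_points A q \<and>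
          A \<inter> \<Inter>{kernel_of_points A p, kernel_of_points A q} \<subseteq> kernel_on A (omega x1 (y1 + y2))"
          using nz p' q' by (auto simp: kp kq k2 kernel_eq_iff kernel_normal_part)
        then show ?thesis by blast
      next
        case 2
        note nz = sum_nz[OF p'(1) q'(1) 2(2)]
        have k2: "kernel_on A (omega x2 y2) = kernel_on A (omega x2 y1)"
          using 2 p' q' by (simp add: kernel_eq_iff)
        have "kernel_on A (omega x1 y1) \<inter> kernel_on A (omega x2 y1) \<subseteq> kernel_on A (omega (x1 + x2) y1)"
          by (auto simp: kernel_on_def omega_def cinner_simps apply_simps)
        moreover have "cspan {x1 + x2} \<noteq> cspan {x1}" "cspan {x1 + x2} \<noteq> cspan {x2}"
          using nz p' q' by (simp_all add: cspan_singleton_eq_iff)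
        ultimately have "kernel_on A (omega (x1 + x2) y1) \<in> normal_part A \<and>
          kernel_on A (omega (x1 + x2) y1) \<noteq> kernel_of_points A p \<and>
          kernel_on A (omega (x1 + x2) y1) \<noteq> kernel_of_points A q \<and>
          A \<inter> \<Inter>{kernel_of_points A p, kernel_of_points A q} \<subseteq> kernel_on A (omega (x1 + x2) y1)"
          using nz p' q' by (auto simp: kp kq k2 kernel_eq_iff kernel_normal_part)
        then show ?thesis by blast
      qed
    qed simp
  next
    assume R: ?R
    show ?L
    proof (rule ccontr)
      assume nL: "\<not> ?L"
      then have neq: "cspan {x1} \<noteq> cspan {x2}" "cspan {y1} \<noteq> cspan {y2}" using p' q' by auto
      then have indep: "x2 \<notin> cspan {x1}" "y2 \<notin> cspan {y1}" using p' q' cspan_singleton_eq_iff by metis+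
      have "kernel_of_points A p \<noteq> kernel_of_points A q"
        using neq p' q' by (simp add: kp kq kernel_eq_iff)
      then obtain x y where xy: "x \<noteq> 0" "y \<noteq> 0" "kernel_on A (omega x y) \<noteq> kernel_on A (omega x1 y1)"
          "kernel_on A (omega x y) \<noteq> kernel_on A (omega x2 y2)"
          "A \<inter> (kernel_on A (omega x1 y1) \<inter> kernel_on A (omega x2 y2)) \<subseteq> kernel_on A (omega x y)"
        using R p' q' unfolding normal_part_def by (auto simp: kp kq)
      have "(x \<in> cspan {x1} \<and> y \<in> cspan {y1}) \<or> (x \<in> cspan {x2} \<and> y \<in> cspan {y2})"
        by (rule two_point_closure[OF xy(1,2) p'(1,2) q'(1,2) indep])
          (use xy(5) in \<open>auto simp: kernel_on_def\<close>)
      then show False using xy p' q' by (auto simp: kernel_eq_iff cspan_singleton_eq_iff)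
    qed
  qed
qed

lemma mem_adj_image: "I \<subseteq> A \<Longrightarrow> a \<in> A \<Longrightarrow> a \<in> adj ` I \<longleftrightarrow> adj a \<in> I"
  by (metis adj_adj clinear_apply image_iff subsetD)

lemma adj_image_adj_image: "I \<subseteq> A \<Longrightarrow> adj ` adj ` I = I"
  by (force simp: image_image adj_adj clinear_apply subset_iff)

lemma adj_image_normal_part:
  assumes "I \<in> normal_part A" shows "adj ` I \<in> normal_part A"
proof -
  obtain x y where "x \<noteq> 0" "y \<noteq> 0" "I = kernel_on A (omega x y)" using assms by (auto simp: normal_part_def)
  then show ?thesis by (simp add: adj_image_kernel kernel_normal_part)
qed

text \<open>Taking adjoints is a homeomorphism of the normal part onto itself that exchanges the
  rows and columns of the grid.\<close>

lemma adj_image_closure: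
  assumes S: "S \<subseteq> normal_part A" and I: "I \<in> normal_part A"
  shows "A \<inter> \<Inter>((`) adj ` S) \<subseteq> adj ` I \<longleftrightarrow> A \<inter> \<Inter>S \<subseteq> I"
proof -
  have "A \<inter> \<Inter>((`) adj ` S) \<subseteq> adj ` I \<longleftrightarrow> (\<forall>a\<in>A. (\<forall>J\<in>S. a \<in> adj ` J) \<longrightarrow> a \<in> adj ` I)" by auto
  also have "\<dots> \<longleftrightarrow> (\<forall>a\<in>A. (\<forall>J\<in>S. adj a \<in> J) \<longrightarrow> adj a \<in> I)"
    using S I mem_adj_image[OF normal_part_subset] by (metis subsetD)
  also have "\<dots> \<longleftrightarrow> (\<forall>a\<in>A. (\<forall>J\<in>S. a \<in> J) \<longrightarrow> a \<in> I)"
    by (metis adj_adj adj_mem clinear_apply)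
  finally show ?thesis by auto
qed

end

text \<open>Finite continuity of \<Phi> and of its inverse are merged into one equivalence about
  intersections of kernels. This form is stable under inversion and under composition with the
  adjoint.\<close>

locale kernel_bijection = dom: irreducible_algebra A + cod: irreducible_algebra B
  for A :: "('h::complex_hilbert \<Rightarrow>\<^sub>L 'h) set" and B :: "('k::complex_hilbert \<Rightarrow>\<^sub>L 'k) set" +
  fixes \<Phi> :: "('h \<Rightarrow>\<^sub>L 'h) set \<Rightarrow> ('k \<Rightarrow>\<^sub>L 'k) set"
  assumes bij: "bij_betw \<Phi> (normal_part A) (normal_part B)"
    and finite_closure: "finite S \<Longrightarrow> S \<subseteq> normal_part A \<Longrightarrow> I \<in> normal_part A \<Longrightarrow>
      A \<inter> \<Inter>S \<subseteq> I \<longleftrightarrow> B \<inter> \<Inter>(\<Phi> ` S) \<subseteq> \<Phi> I"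
begin

lemma \<Phi>_mem: "I \<in> normal_part A \<Longrightarrow> \<Phi> I \<in> normal_part B"
  using bij by (auto dest: bij_betwE)

lemma \<Phi>_inj: "I \<in> normal_part A \<Longrightarrow> J \<in> normal_part A \<Longrightarrow> \<Phi> I = \<Phi> J \<longleftrightarrow> I = J"
  using bij by (auto simp: bij_betw_def inj_on_def)

lemma \<Phi>_onto: "J \<in> normal_part B \<Longrightarrow> \<exists>I\<in>normal_part A. \<Phi> I = J"
  by (metis bij bij_betw_imp_surj_on imageE)

lemma inverse: "kernel_bijection B A (inv_into (normal_part A) \<Phi>)"
proof unfold_locales
  let ?\<Psi> = "inv_into (normal_part A) \<Phi>"
  show bij': "bij_betw ?\<Psi> (normal_part B) (normal_part A)" by (rule bij_betw_inv_into[OF bij])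
  fix S I assume S: "finite S" "S \<subseteq> normal_part B" and I: "I \<in> normal_part B"
  have inv: "\<Phi> (?\<Psi> J) = J" "?\<Psi> J \<in> normal_part A" if "J \<in> normal_part B" for J
    using bij_betw_inv_into_right[OF bij that] bij_betwE[OF bij'] that by blast+
  have "(\<lambda>J. \<Phi> (?\<Psi> J)) ` S = (\<lambda>J. J) ` S"
    by (rule image_cong[OF refl inv(1)]) (use S in blast)
  then have "\<Phi> ` ?\<Psi> ` S = S" by (simp only: image_image image_ident)
  moreover have "?\<Psi> ` S \<subseteq> normal_part A" using S(2) inv(2) by blast
  ultimately show "B \<inter> \<Inter>S \<subseteq> I \<longleftrightarrow> A \<inter> \<Inter>(?\<Psi> ` S) \<subseteq> ?\<Psi> I"
    using finite_closure[OF finite_imageI[OF S(1)] _ inv(2)[OF I], of ?\<Psi>] by (simp only: inv(1)[OF I])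
qed

lemma adjoint: "kernel_bijection A B (\<lambda>I. adj ` \<Phi> I)"
proof unfold_locales
  show "bij_betw (\<lambda>I. adj ` \<Phi> I) (normal_part A) (normal_part B)"
  proof -
    have "bij_betw ((`) adj) (normal_part B) (normal_part B)"
      by (rule bij_betwI[where g = "(`) adj"])
        (auto simp: cod.adj_image_normal_part cod.adj_image_adj_image[OF normal_part_subset])
    from bij_betw_trans[OF bij this] show ?thesis by (simp add: comp_def)
  qed
  fix S I assume S: "finite S" "S \<subseteq> normal_part A" and I: "I \<in> normal_part A"
  have "\<Phi> ` S \<subseteq> normal_part B" using S \<Phi>_mem by auto
  from cod.adj_image_closure[OF this \<Phi>_mem[OF I]]
  show "A \<inter> \<Inter>S \<subseteq> I \<longleftrightarrow> B \<inter> \<Inter>((\<lambda>I. adj ` \<Phi> I) ` S) \<subseteq> adj ` \<Phi> I"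
    using finite_closure[OF S I] by (simp add: image_image)
qed

text \<open>Two different rays are what distinguishes rows from columns of the grid; one-dimensional
  spaces are treated separately.\<close>

lemma product_form:
  assumes ab: "a \<in> projective_points" "b \<in> projective_points" "a \<noteq> (b :: 'h set)"
  obtains f g where "bij_betw f projective_points projective_points" "bij_betw g projective_points projective_points"
    "(\<forall>x\<in>projective_points. \<forall>y\<in>projective_points. \<Phi> (kernel_of_points A (x, y)) = kernel_of_points B (f x, g y)) \<or>
     (\<forall>x\<in>projective_points. \<forall>y\<in>projective_points. \<Phi> (kernel_of_points A (x, y)) = kernel_of_points B (g y, f x))"
proof -
  let ?PA = "projective_points :: 'h set set" and ?PB = "projective_points :: 'k set set"
  let ?inv = "inv_into (?PB \<times> ?PB) (kernel_of_points B)"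
  define F where "F = ?inv \<circ> (\<Phi> \<circ> kernel_of_points A)"
  have bF: "bij_betw F (?PA \<times> ?PA) (?PB \<times> ?PB)"
    unfolding F_def
    by (rule bij_betw_trans[OF bij_betw_trans[OF dom.kernel_of_points_bij bij] bij_betw_inv_into[OF cod.kernel_of_points_bij]])
  have kA: "kernel_of_points A p \<in> normal_part A" if "p \<in> ?PA \<times> ?PA" for p
    using dom.kernel_of_points_bij that by (auto dest: bij_betwE)
  have kF: "kernel_of_points B (F p) = \<Phi> (kernel_of_points A p)" if "p \<in> ?PA \<times> ?PA" for p
    unfolding F_def comp_def by (rule bij_betw_inv_into_right[OF cod.kernel_of_points_bij \<Phi>_mem[OF kA[OF that]]])
  have adj: "fst p = fst q \<or> snd p = snd q \<longleftrightarrow> fst (F p) = fst (F q) \<or> snd (F p) = snd (F q)"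
    if p: "p \<in> ?PA \<times> ?PA" and q: "q \<in> ?PA \<times> ?PA" for p q
  proof -
    let ?p = "kernel_of_points A p" and ?q = "kernel_of_points A q"
    have Fpq: "F p \<in> ?PB \<times> ?PB" "F q \<in> ?PB \<times> ?PB" using bF p q by (auto dest: bij_betwE)
    have cl: "A \<inter> \<Inter>{?p, ?q} \<subseteq> I \<longleftrightarrow> B \<inter> \<Inter>{\<Phi> ?p, \<Phi> ?q} \<subseteq> \<Phi> I" if "I \<in> normal_part A" for I
      using finite_closure[of "{?p, ?q}" I] kA p q that by simp
    have "(\<exists>I\<in>normal_part A. I \<noteq> ?p \<and> I \<noteq> ?q \<and> A \<inter> \<Inter>{?p, ?q} \<subseteq> I)
      \<longleftrightarrow> (\<exists>I\<in>normal_part A. \<Phi> I \<noteq> \<Phi> ?p \<and> \<Phi> I \<noteq> \<Phi> ?q \<and> B \<inter> \<Inter>{\<Phi> ?p, \<Phi> ?q} \<subseteq> \<Phi> I)"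
      using cl \<Phi>_inj kA[OF p] kA[OF q] by (intro bex_cong) auto
    also have "\<dots> \<longleftrightarrow> (\<exists>J\<in>normal_part B. J \<noteq> \<Phi> ?p \<and> J \<noteq> \<Phi> ?q \<and> B \<inter> \<Inter>{\<Phi> ?p, \<Phi> ?q} \<subseteq> J)"
      using \<Phi>_onto \<Phi>_mem by metis
    finally show ?thesis
      unfolding dom.kernel_of_points_adjacent[OF p q] cod.kernel_of_points_adjacent[OF Fpq] kF[OF p] kF[OF q]
      using \<Phi>_inj[OF kA[OF p] kA[OF q]] by simp
  qed
  obtain f g where fg: "bij_betw f ?PA ?PB" "bij_betw g ?PA ?PB"
    "(\<forall>x\<in>?PA. \<forall>y\<in>?PA. F (x, y) = (f x, g y)) \<or> (\<forall>x\<in>?PA. \<forall>y\<in>?PA. F (x, y) = (g y, f x))"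
    using grid_bijection[OF bF adj ab] by blast
  have "\<Phi> (kernel_of_points A (x, y)) = kernel_of_points B (F (x, y))" if "x \<in> ?PA" "y \<in> ?PA" for x y
    using kF[of "(x, y)"] that by simp
  with fg(3) have "(\<forall>x\<in>?PA. \<forall>y\<in>?PA. \<Phi> (kernel_of_points A (x, y)) = kernel_of_points B (f x, g y)) \<or>
     (\<forall>x\<in>?PA. \<forall>y\<in>?PA. \<Phi> (kernel_of_points A (x, y)) = kernel_of_points B (g y, f x))" by auto
  then show ?thesis using that fg by blast
qed

text \<open>This interchanges the two forms of the conclusion, so that later statements can be
  proved for the first one and transferred.\<close>

lemma implements_adjoint:
  "implements A B (\<lambda>I. adj ` \<Phi> I) u v \<longleftrightarrow> implements_flipped A B \<Phi> u v"
proof -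
  have "adj ` \<Phi> (kernel_on A (omega x y)) = kernel_on B (omega (u x) (v y)) \<longleftrightarrow>
      \<Phi> (kernel_on A (omega x y)) = kernel_on B (omega (v y) (u x))" if "x \<noteq> 0" "y \<noteq> 0" for x y
    by (metis \<Phi>_mem cod.adj_image_adj_image cod.adj_image_kernel kernel_normal_part normal_part_subset that)
  then show ?thesis by (simp add: implements_def implements_flipped_def)
qed

lemma implementing_representatives:
  assumes "(x :: 'h) \<noteq> 0" "y \<noteq> 0" "y \<notin> cspan {x}"
  obtains u v where "\<And>x. x \<noteq> 0 \<Longrightarrow> u x \<noteq> 0" "\<And>x. x \<noteq> 0 \<Longrightarrow> v x \<noteq> 0"
    "implements A B \<Phi> u v \<or> implements_flipped A B \<Phi> u v"
proof -
  have "cspan {x} \<noteq> cspan {y}" using assms cspan_singleton_eq_iff by metis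
  then obtain f g where fg: "bij_betw f projective_points projective_points" "bij_betw g projective_points projective_points"
    "(\<forall>x\<in>projective_points. \<forall>y\<in>projective_points. \<Phi> (kernel_of_points A (x, y)) = kernel_of_points B (f x, g y)) \<or>
     (\<forall>x\<in>projective_points. \<forall>y\<in>projective_points. \<Phi> (kernel_of_points A (x, y)) = kernel_of_points B (g y, f x))"
    using product_form[OF cspan_projective_point[OF assms(1)] cspan_projective_point[OF assms(2)]] by blast
  define u where "u x = representative (f (cspan {x}))" for x
  define v where "v x = representative (g (cspan {x}))" for x
  have "f (cspan {x}) \<in> projective_points" "g (cspan {x}) \<in> projective_points" if "x \<noteq> 0" for x
    using fg(1,2) that by (auto simp: cspan_projective_point dest!: bij_betwE)
  then have nz: "u x \<noteq> 0" "v x \<noteq> 0" if "x \<noteq> 0" for x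
    using that by (simp_all add: u_def v_def representative)
  have "implements A B \<Phi> u v \<or> implements_flipped A B \<Phi> u v"
    using fg(3)
  proof
    assume *: "\<forall>x\<in>projective_points. \<forall>y\<in>projective_points. \<Phi> (kernel_of_points A (x, y)) = kernel_of_points B (f x, g y)"
    have "implements A B \<Phi> u v"
      unfolding implements_def
    proof (intro allI impI)
      fix x y :: 'h assume "x \<noteq> 0" "y \<noteq> 0"
      then show "\<Phi> (kernel_on A (omega x y)) = kernel_on B (omega (u x) (v y))"
        using *[rule_format, OF cspan_projective_point cspan_projective_point, of x y]
        by (simp add: dom.kernel_of_points_cspan) (simp add: kernel_of_points_def u_def v_def)
    qed
    then show ?thesis ..
  next
    assume *: "\<forall>x\<in>projective_points. \<forall>y\<in>projective_points. \<Phi> (kernel_of_points A (x, y)) = kernel_of_points B (g y, f x)"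
    have "implements_flipped A B \<Phi> u v"
      unfolding implements_flipped_def
    proof (intro allI impI)
      fix x y :: 'h assume "x \<noteq> 0" "y \<noteq> 0"
      then show "\<Phi> (kernel_on A (omega x y)) = kernel_on B (omega (v y) (u x))"
        using *[rule_format, OF cspan_projective_point cspan_projective_point, of x y]
        by (simp add: dom.kernel_of_points_cspan) (simp add: kernel_of_points_def u_def v_def)
    qed
    then show ?thesis ..
  qed
  then show ?thesis by (rule that[of u v, rotated 2]) (rule nz, assumption)+
qed

end

text \<open>\<open>u\<close> and \<open>v\<close> are arbitrary nonvanishing choices on the image
  lines, without any linearity and with unspecified value at 0. The semilinear maps found later are
  further instances.\<close>

locale implemented_bijection = kernel_bijection A B \<Phi>
  for A :: "('h::complex_hilbert \<Rightarrow>\<^sub>L 'h) set" and B :: "('k::complex_hilbert \<Rightarrow>\<^sub>L 'k) set" and \<Phi> +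
  fixes u v :: "'h \<Rightarrow> 'k"
  assumes u_nz: "x \<noteq> 0 \<Longrightarrow> u x \<noteq> 0" and v_nz: "x \<noteq> 0 \<Longrightarrow> v x \<noteq> 0"
    and implements: "implements A B \<Phi> u v"
begin

lemma \<Phi>_kernel: "x \<noteq> 0 \<Longrightarrow> y \<noteq> 0 \<Longrightarrow> \<Phi> (kernel_on A (omega x y)) = kernel_on B (omega (u x) (v y))"
  using implements by (simp add: implements_def)

lemma nonzero_vector: obtains e :: 'h where "e \<noteq> 0"
proof -
  obtain a where "a \<in> A" "a \<noteq> 0" using dom.A_not_zero dom.zero_mem by blast
  then obtain z where "blinfun_apply a z \<noteq> 0" by (metis blinfun_eqI zero_blinfun.rep_eq)
  then show ?thesis using that by blast
qed

lemma row_image: "y \<noteq> 0 \<Longrightarrow> 0 \<notin> S \<Longrightarrow>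
    \<Phi> ` (\<lambda>s. kernel_on A (omega s y)) ` S = (\<lambda>s. kernel_on B (omega s (v y))) ` u ` S"
  and column_image: "x \<noteq> 0 \<Longrightarrow> 0 \<notin> S \<Longrightarrow>
    \<Phi> ` (\<lambda>s. kernel_on A (omega x s)) ` S = (\<lambda>s. kernel_on B (omega (u x) s)) ` v ` S"
  unfolding image_image by (rule image_cong[OF refl], metis \<Phi>_kernel)+

text \<open>Within one column of the grid a finite set of rays has its algebraic span as closure, on
  both sides of \<Phi>; the fixed second vector \<open>e\<close> serves only to select the
  column.\<close>

lemma u_cspan:
  assumes S: "finite S" "0 \<notin> S" and x: "x \<noteq> 0"
  shows "x \<in> cspan S \<longleftrightarrow> u x \<in> cspan (u ` S)"
proof -
  obtain e :: 'h where e: "e \<noteq> 0" by (rule nonzero_vector)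
  have "(\<lambda>s. kernel_on A (omega s e)) ` S \<subseteq> normal_part A" using S e by (auto intro!: kernel_normal_part)
  from finite_closure[OF finite_imageI[OF S(1)] this kernel_normal_part[OF x e]]
  show ?thesis
    unfolding row_image[OF e S(2)] \<Phi>_kernel[OF x e]
    by (simp only: dom.column_closure[OF e] cod.column_closure[OF v_nz[OF e]] closure_cspan_finite S finite_imageI)
qed

lemma v_cspan:
  assumes S: "finite S" "0 \<notin> S" and x: "x \<noteq> 0"
  shows "x \<in> cspan S \<longleftrightarrow> v x \<in> cspan (v ` S)"
proof -
  obtain e :: 'h where e: "e \<noteq> 0" by (rule nonzero_vector)
  have "(\<lambda>s. kernel_on A (omega e s)) ` S \<subseteq> normal_part A" using S e by (auto intro!: kernel_normal_part)
  from finite_closure[OF finite_imageI[OF S(1)] this kernel_normal_part[OF e x]]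
  show ?thesis
    unfolding column_image[OF e S(2)] \<Phi>_kernel[OF e x]
    by (simp only: dom.row_closure[OF e] cod.row_closure[OF u_nz[OF e]] closure_cspan_finite S finite_imageI)
qed

lemma u_v_onto:
  assumes "w \<noteq> 0" shows "\<exists>x. x \<noteq> 0 \<and> w \<in> cspan {u x}" "\<exists>x. x \<noteq> 0 \<and> w \<in> cspan {v x}"
proof -
  obtain x y where xy: "x \<noteq> 0" "y \<noteq> 0" "\<Phi> (kernel_on A (omega x y)) = kernel_on B (omega w w)"
    using \<Phi>_onto[OF kernel_normal_part[OF assms assms, of B]] by (auto simp: normal_part_def)
  then have "cspan {u x} = cspan {w} \<and> cspan {v y} = cspan {w}"
    using \<Phi>_kernel[OF xy(1,2)] cod.kernel_eq_iff[OF u_nz v_nz assms assms] by simp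
  then have "w \<in> cspan {u x}" "w \<in> cspan {v y}" by (auto intro: complex_vector.span_base)
  with xy show "\<exists>x. x \<noteq> 0 \<and> w \<in> cspan {u x}" "\<exists>x. x \<noteq> 0 \<and> w \<in> cspan {v x}" by blast+
qed

lemma semilinear_implementation:
  assumes "independent3 cspan (e :: 'h) f f'"
  obtains U V where "semilinear U" "bij U" "semilinear V" "bij V" "implements A B \<Phi> U V"
proof -
  interpret vs: vector_space_pair "scaleC :: complex \<Rightarrow> 'h \<Rightarrow> 'h" "scaleC :: complex \<Rightarrow> 'k \<Rightarrow> 'k"
    by unfold_locales
  have gen: "\<exists>U. semilinear U \<and> bij U \<and> (\<forall>x. x \<noteq> 0 \<longrightarrow> cspan {U x} = cspan {g x})"
    if nz: "\<And>x. x \<noteq> 0 \<Longrightarrow> g x \<noteq> 0"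
      and sp: "\<And>S x. finite S \<Longrightarrow> 0 \<notin> S \<Longrightarrow> x \<noteq> 0 \<Longrightarrow> x \<in> cspan S \<longleftrightarrow> g x \<in> cspan (g ` S)"
      and onto: "\<And>w. w \<noteq> 0 \<Longrightarrow> \<exists>x. x \<noteq> 0 \<and> w \<in> cspan {g x}" for g :: "'h \<Rightarrow> 'k"
  proof -
    have 1: "x \<in> cspan {y, z} \<longleftrightarrow> g x \<in> cspan {g y, g z}" if "x \<noteq> 0" "y \<noteq> 0" "z \<noteq> 0" for x y z
      using sp[of "{y, z}" x] that by simp
    show ?thesis
    proof (rule vs.fundamental_theorem_projective_geometry[of g e f f', unfolded module_span_scaleC, OF nz 1 onto assms])
      fix \<sigma> U
      assume "field_automorphism \<sigma>" "\<And>x y. U (x + y) = U x + U y"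
        "\<And>c x. U (c *\<^sub>C x) = \<sigma> c *\<^sub>C U x" "bij U" "\<And>x. x \<noteq> 0 \<Longrightarrow> cspan {U x} = cspan {g x}"
      then show "\<exists>U. semilinear U \<and> bij U \<and> (\<forall>x. x \<noteq> 0 \<longrightarrow> cspan {U x} = cspan {g x})"
        unfolding semilinear_def semilinear_wrt_def by blast
    qed
  qed
  obtain U where U: "semilinear U" "bij U" "\<And>x. x \<noteq> 0 \<Longrightarrow> cspan {U x} = cspan {u x}"
    using gen[OF u_nz u_cspan u_v_onto(1)] by blast
  obtain V where V: "semilinear V" "bij V" "\<And>x. x \<noteq> 0 \<Longrightarrow> cspan {V x} = cspan {v x}"
    using gen[OF v_nz v_cspan u_v_onto(2)] by blast
  have nz: "U x \<noteq> 0" "V x \<noteq> 0" if "x \<noteq> 0" for x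
  proof -
    have "u x \<in> cspan {U x}" "v x \<in> cspan {V x}"
      using U(3)[OF that] V(3)[OF that] by (auto intro: complex_vector.span_base)
    then show "U x \<noteq> 0" "V x \<noteq> 0" using u_nz[OF that] v_nz[OF that] by (auto simp: in_cspan_singleton)
  qed
  have "implements A B \<Phi> U V"
    unfolding implements_def using \<Phi>_kernel nz u_nz v_nz U(3) V(3) by (simp add: cod.kernel_eq_iff)
  then show ?thesis using that U V by blast
qed

end

section \<open>Automatic continuity\<close>

text \<open>Additivity spreads the bound to the unit disc, and \<sigma> fixes the integers. For real
  \<open>r\<close> the fractional part of \<open>n r\<close> stays in the unit disc, so that
  n(\<sigma>(r) - r) is bounded in \<open>n\<close>; hence \<sigma> fixes the reals, and only the
  sign of its value at \<i> remains free.\<close>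

lemma field_automorphism_bounded:
  fixes \<sigma> :: "complex \<Rightarrow> complex"
  assumes \<sigma>: "field_automorphism \<sigma>" and d: "d > 0" and bd: "\<And>c. cmod c \<le> d \<Longrightarrow> cmod (\<sigma> c) \<le> M"
  shows "\<sigma> = (\<lambda>c. c) \<or> \<sigma> = cnj"
proof -
  have add: "\<sigma> (a + b) = \<sigma> a + \<sigma> b" and mult: "\<sigma> (a * b) = \<sigma> a * \<sigma> b" and one: "\<sigma> 1 = 1" for a b
    using \<sigma> by (auto simp: field_automorphism_def)
  have zero: "\<sigma> 0 = 0" using add[of 0 0] by simp
  have diff: "\<sigma> (a - b) = \<sigma> a - \<sigma> b" for a b using add[of "a - b" b] by (simp add: algebra_simps)
  have nat: "\<sigma> (of_nat n) = of_nat n" for n by (induction n) (simp_all add: zero one add)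
  have int: "\<sigma> (of_int q) = of_int q" for q
    by (cases q rule: int_diff_cases) (simp add: diff nat)
  obtain k :: nat where k: "1 / d < real k" using reals_Archimedean2 by blast
  have k0: "k > 0" using k d by (metis divide_pos_pos gr_zeroI less_irrefl of_nat_0 order_less_trans zero_less_one)
  have unit: "cmod (\<sigma> c) \<le> real k * M" if "cmod c \<le> 1" for c
  proof -
    have "cmod (c / of_nat k) \<le> 1 / real k" using that k0 by (simp add: norm_divide divide_right_mono)
    also have "\<dots> \<le> d" using k d k0 by (simp add: field_simps)
    finally have "cmod (\<sigma> (c / of_nat k)) \<le> M" by (rule bd)
    moreover have "\<sigma> c = of_nat k * \<sigma> (c / of_nat k)"
      using mult[of "of_nat k" "c / of_nat k"] k0 by (simp add: nat)
    ultimately show ?thesis by (simp add: norm_mult mult_left_mono)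
  qed
  have real: "\<sigma> (of_real r) = of_real r" for r
  proof -
    define D where "D = \<sigma> (of_real r) - of_real r"
    have "real n * cmod D \<le> real k * M + 1" for n
    proof -
      define q where "q = \<lfloor>real n * r\<rfloor>"
      define s where "s = real n * r - of_int q"
      have s: "\<bar>s\<bar> \<le> 1" unfolding s_def q_def by linarith
      have s': "of_real s = of_nat n * of_real r - (of_int q :: complex)" by (simp add: s_def)
      have "\<sigma> (of_real s) - of_real s = of_nat n * D"
        unfolding s' by (simp add: diff mult nat int D_def algebra_simps)
      then have "real n * cmod D = cmod (\<sigma> (of_real s) - of_real s)" by (simp add: norm_mult)
      also have "\<dots> \<le> cmod (\<sigma> (of_real s)) + cmod (of_real s)" by (rule norm_triangle_ineq4)
      also have "\<dots> \<le> real k * M + 1" using s unit[of "of_real s"] by simp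
      finally show ?thesis .
    qed
    moreover have "\<exists>n. real k * M + 1 < real n * cmod D" if "cmod D > 0"
      using reals_Archimedean3[OF that] by blast
    ultimately have "\<not> cmod D > 0" by (meson not_less)
    then show ?thesis by (simp add: D_def)
  qed
  have "\<sigma> \<i> * \<sigma> \<i> = \<sigma> (- 1)" by (simp add: mult[symmetric])
  also have "\<dots> = - 1" using diff[of 0 1] by (simp add: zero one)
  finally have "(\<sigma> \<i> - \<i>) * (\<sigma> \<i> + \<i>) = 0" by (simp add: algebra_simps)
  then have "\<sigma> \<i> = \<i> \<or> \<sigma> \<i> = - \<i>" by (auto simp: eq_neg_iff_add_eq_0)
  moreover have form: "\<sigma> c = of_real (Re c) + \<sigma> \<i> * of_real (Im c)" for c
  proof -
    have "\<sigma> c = \<sigma> (of_real (Re c) + \<i> * of_real (Im c))" by (simp add: complex_eq[symmetric])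
    then show ?thesis by (simp add: add mult real)
  qed
  ultimately show ?thesis
  proof (elim disjE)
    assume "\<sigma> \<i> = \<i>"
    then have "\<sigma> c = c" for c using form[of c] by (simp add: complex_eq[symmetric])
    then show ?thesis by blast
  next
    assume "\<sigma> \<i> = - \<i>"
    then have "\<sigma> c = cnj c" for c using form[of c] by (simp add: complex_eq_iff)
    then show ?thesis by blast
  qed
qed

text \<open>The proof is a gliding hump argument.\<close>

lemma weakly_bounded_imp_bounded:
  fixes X :: "'a::{real_inner,banach} set"
  assumes weak: "\<And>k. \<exists>C. \<forall>x\<in>X. \<bar>inner x k\<bar> \<le> C"
  shows "\<exists>C. \<forall>x\<in>X. norm x \<le> C"
proof (rule ccontr)
  assume "\<not> (\<exists>C. \<forall>x\<in>X. norm x \<le> C)"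
  \<comment> \<open>The rates 4 and 1/3 are matched: humps of size (1/3)^n tested against norms
    above 4^n diverge, while all later humps together have at most half the size of the current
    one.\<close>
  then have "\<forall>n::nat. \<exists>x\<in>X. norm x > 4 ^ n" by (meson not_le)
  then obtain x where xX: "\<And>n::nat. x n \<in> X" and x4: "\<And>n. norm (x n) > 4 ^ n" by metis
  have x0: "norm (x n) > 0" for n using x4[of n] by (metis less_trans zero_less_numeral zero_less_power)
  \<comment> \<open>The sign keeps the new hump from cancelling against the partial sum.\<close>
  define sg :: "nat \<Rightarrow> 'a \<Rightarrow> real" where "sg n v = (if inner (x n) v \<ge> 0 then 1 else - 1)" for n v
  define s where "s n v = (sg n v * (1/3) ^ n / norm (x n)) *\<^sub>R x n" for n v
  define k where "k = rec_nat (0::'a) (\<lambda>n v. v + s n v)"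
  have k0: "k 0 = 0" and kS: "k (Suc n) = k n + s n (k n)" for n by (simp_all add: k_def)
  define f where "f n = s n (k n)" for n
  have kf: "k n = (\<Sum>m<n. f m)" for n by (induction n) (simp_all add: k0 kS f_def)
  have nf: "norm (f n) = (1/3) ^ n" for n using x0[of n] by (simp add: f_def s_def sg_def power_divide)
  have hump: "\<bar>inner (x n) (k (Suc n))\<bar> \<ge> (1/3) ^ n * norm (x n)" for n
  proof -
    have "inner (x n) (k (Suc n)) = inner (x n) (k n) + sg n (k n) * ((1/3) ^ n * norm (x n))"
      using x0[of n] by (simp add: kS s_def inner_add_right power2_norm_eq_inner[symmetric] power2_eq_square)
    moreover have "(1/3) ^ n * norm (x n) \<ge> 0" by simp
    ultimately show ?thesis by (simp add: sg_def split: if_splits)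
  qed
  have sumn: "summable (\<lambda>n. norm (f n))" unfolding nf by (intro summable_geometric) simp
  define K where "K = suminf f"
  have tail: "norm (K - k (Suc n)) \<le> (1/3) ^ n / 2" for n
  proof -
    have "K - k (Suc n) = (\<Sum>m. f (m + Suc n))"
      unfolding K_def kf using suminf_split_initial_segment[OF summable_norm_cancel[OF sumn], of "Suc n"] by simp
    also have "norm \<dots> \<le> (\<Sum>m. norm (f (m + Suc n)))"
      by (rule summable_norm) (use sumn in \<open>subst summable_iff_shift\<close>)
    also have "\<dots> = (\<Sum>m. (1/3) ^ Suc n * (1/3 :: real) ^ m)" by (simp add: nf power_add mult_ac)
    also have "\<dots> = (1/3) ^ Suc n * (1 / (1 - 1/3))"
      by (subst suminf_mult) (simp_all add: suminf_geometric summable_geometric)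
    finally show ?thesis by (simp add: field_simps)
  qed
  obtain C where C: "\<And>y. y \<in> X \<Longrightarrow> \<bar>inner y K\<bar> \<le> C" using weak by blast
  have "(4/3) ^ n / 2 \<le> C" for n :: nat
  proof -
    have "\<bar>inner (x n) (K - k (Suc n))\<bar> \<le> norm (x n) * ((1/3) ^ n / 2)"
      by (rule order_trans[OF Cauchy_Schwarz_ineq2]) (intro mult_left_mono tail norm_ge_zero)
    then have "\<bar>inner (x n) K - inner (x n) (k (Suc n))\<bar> \<le> (1/3) ^ n * norm (x n) / 2"
      by (simp only: inner_diff_right mult.commute times_divide_eq_right)
    moreover have "t / 2 \<le> \<bar>a\<bar>" if "\<bar>a - b\<bar> \<le> t / 2" "t \<le> \<bar>b\<bar>" for a b t :: real
      using that by linarith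
    ultimately have "\<bar>inner (x n) K\<bar> \<ge> (1/3) ^ n * norm (x n) / 2"
      using hump[of n] by blast
    moreover have "(1/3) ^ n * norm (x n) \<ge> (1/3) ^ n * 4 ^ n"
      using x4[of n] by (intro mult_left_mono) auto
    moreover have "(1/3 :: real) ^ n * 4 ^ n = (4/3) ^ n" by (simp add: power_mult_distrib[symmetric])
    ultimately show ?thesis using C[OF xX[of n]] by linarith
  qed
  moreover obtain n where "(4/3 :: real) ^ n > 2 * C" using real_arch_pow[of "4/3" "2 * C"] by auto
  ultimately show False by (metis divide_le_eq_numeral1(1) mult.commute not_le)
qed

text \<open>If \<open>\<sigma>\<close> were unbounded near zero, some \<open>w = (\<Sum>n. c n k n)\<close> with rapidly decreasing \<open>c n\<close> could
  not be a value of \<open>V\<close>.\<close>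

theorem semilinear_closed_span_bounded:
  fixes V :: "'h::complex_hilbert \<Rightarrow> 'k::complex_hilbert" and k :: "nat \<Rightarrow> 'k"
  assumes V: "semilinear V" "bij V"
    and cl: "\<And>S y. y \<in> closure (cspan S) \<Longrightarrow> V y \<in> closure (cspan (V ` S))"
    and k: "\<And>n. norm (k n) = 1" "\<And>m n. m \<noteq> n \<Longrightarrow> cinner (k m) (k n) = 0"
  shows "bounded_linear V" "clinear V \<or> conjugate_linear V"
proof -
  obtain \<tau> where \<tau>: "field_automorphism \<tau>" and lin: "semilinear_wrt \<tau> V" using V(1) by (auto simp: semilinear_def)
  have tb: "bij \<tau>" and t_mult: "\<And>a b. \<tau> (a * b) = \<tau> a * \<tau> b" and t_add: "\<And>a b. \<tau> (a + b) = \<tau> a + \<tau> b"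
    and t_one: "\<tau> 1 = 1"
    using \<tau> by (auto simp: field_automorphism_def)
  define \<sigma> where "\<sigma> = inv \<tau>"
  have ts: "\<tau> (\<sigma> c) = c" "\<sigma> (\<tau> c) = c" for c
    using tb by (simp_all add: \<sigma>_def bij_is_surj surj_f_inv_f bij_is_inj)
  have t0: "\<tau> 0 = 0" using t_add[of 0 0] by simp
  have V_add: "V (x + y) = V x + V y" and V_scale: "V (c *\<^sub>C x) = \<tau> c *\<^sub>C V x" for x y c
    using lin by (auto simp: semilinear_wrt_def)
  have V_diff: "V (x - y) = V x - V y" for x y using V_add[of "x - y" y] by (simp add: algebra_simps)
  have V0: "V 0 = 0" using V_add[of 0 0] by simp
  \<comment> \<open>A substitute for the Riesz representation before boundedness is known: the zero
    set \<open>N\<close> of the functional is closed because \<open>V\<close> carries closures of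
    spans into closures of spans, and a vector orthogonal to \<open>N\<close> represents the
    functional up to \<tau>.\<close>
  have rep: "\<exists>e. \<forall>v. cinner (V v) w = \<tau> (cinner v e)" for w
  proof -
    define N where "N = {v. cinner (V v) w = 0}"
    have Nsub: "csubspace N"
      by (rule complex_vector.subspaceI) (auto simp: N_def V0 V_add V_scale cinner_simps)
    have spanN: "cspan N = N" by (rule complex_vector.span_eq_iff[THEN iffD2, OF Nsub])
    have Ncl: "closure N \<subseteq> N"
    proof
      fix y assume "y \<in> closure N"
      then have "y \<in> closure (cspan N)" by (simp only: spanN)
      then have "V y \<in> closure (cspan (V ` N))" by (rule cl)
      then have "cinner w (V y) = 0"
        by (rule orthogonal_closure_cspan[rotated]) (auto simp: N_def cinner_eq_0_commute)
      then show "y \<in> N" by (simp add: N_def cinner_eq_0_commute)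
    qed
    show ?thesis
    proof (cases "N = UNIV")
      case True
      then have "\<forall>v. cinner (V v) w = \<tau> (cinner v 0)" by (auto simp: N_def t0)
      then show ?thesis ..
    next
      case False
      then obtain y where "y \<notin> N" by blast
      then have "y \<notin> closure N" using Ncl by blast
      then have "y \<notin> closure (cspan N)" unfolding spanN .
      then obtain z where z: "\<forall>s\<in>N. cinner z s = 0" "cinner z y \<noteq> 0"
        unfolding closure_cspan_orthogonal by blast
      have z0: "z \<noteq> 0" using z(2) by auto
      have zN: "z \<notin> N" using z(1) z0 by (metis cinner_self_eq_0_iff)
      define b where "b = cinner (V z) w"
      have b0: "b \<noteq> 0" using zN by (simp add: N_def b_def)
      define g where "g = \<sigma> b / cinner z z"
      have "cinner (V v) w = \<tau> (cinner v (cnj g *\<^sub>C z))" for v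
      proof -
        define c where "c = \<sigma> (cinner (V v) w / b)"
        have "v - c *\<^sub>C z \<in> N"
          using b0 by (simp add: N_def V_diff V_scale cinner_simps c_def ts b_def[symmetric])
        then have "cinner z (v - c *\<^sub>C z) = 0" using z(1) by blast
        then have "cinner (v - c *\<^sub>C z) z = 0" by (simp add: cinner_eq_0_commute)
        then have "cinner v z = c * cinner z z" by (simp add: cinner_simps)
        then have "cinner v (cnj g *\<^sub>C z) = c * \<sigma> b" using z0 by (simp add: cinner_scaleC_right g_def)
        then show ?thesis using b0 by (simp add: t_mult ts c_def)
      qed
      then show ?thesis by blast
    qed
  qed
  then obtain e where e: "\<And>w v. cinner (V v) w = \<tau> (cinner v (e w))" by metis
  have "\<exists>d M. d > 0 \<and> (\<forall>c. cmod c \<le> d \<longrightarrow> cmod (\<sigma> c) \<le> M)"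
  proof (rule ccontr)
    assume "\<nexists>d M. d > 0 \<and> (\<forall>c. cmod c \<le> d \<longrightarrow> cmod (\<sigma> c) \<le> M)"
    then have "\<forall>n::nat. \<exists>c. cmod c \<le> (1/2) ^ n \<and> cmod (\<sigma> c) > real n * (norm (e (k n)) + 1)"
      by (metis not_le zero_less_divide_1_iff zero_less_numeral zero_less_power)
    then obtain c where c: "\<And>n. cmod (c n) \<le> (1/2) ^ n" "\<And>n. cmod (\<sigma> (c n)) > real n * (norm (e (k n)) + 1)"
      by metis
    define f where "f n = c n *\<^sub>C k n" for n
    have "summable f"
      by (rule summable_comparison_test[OF _ summable_geometric[of "1/2 :: real"]])
        (auto simp: f_def norm_scaleC k c)
    then have lim: "(\<lambda>N. \<Sum>n<N. f n) \<longlonglongrightarrow> suminf f" by (rule summable_LIMSEQ)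
    \<comment> \<open>Surjectivity provides a preimage \<open>v\<close> of the series. Its pairing
      with \<open>e (k m)\<close> is \<open>\<sigma> (c m)\<close>, which outgrows what the
      Cauchy-Schwarz inequality permits for a fixed \<open>v\<close>.\<close>
    obtain v where v: "V v = suminf f" using V(2) by (metis bij_pointE)
    have coeff: "cinner (V v) (k m) = c m" for m
    proof (rule LIMSEQ_unique)
      show "(\<lambda>N. cinner (\<Sum>n<N. f n) (k m)) \<longlonglongrightarrow> cinner (V v) (k m)"
        unfolding v by (intro tendsto_intros lim)
      have "cinner (\<Sum>n<N. f n) (k m) = (if m < N then c m else 0)" for N
      proof (induction N)
        case (Suc N)
        have "cinner (f N) (k m) = (if m = N then c m else 0)"
          using k(2)[of N m] by (auto simp: f_def cinner_scaleC_left cinner_self k(1))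
        with Suc show ?case by (auto simp: cinner_add_left)
      qed simp
      then have "\<forall>\<^sub>F N in sequentially. cinner (\<Sum>n<N. f n) (k m) = c m"
        by (auto simp: eventually_sequentially intro!: exI[of _ "Suc m"])
      then show "(\<lambda>N. cinner (\<Sum>n<N. f n) (k m)) \<longlonglongrightarrow> c m" by (rule tendsto_eventually)
    qed
    obtain m :: nat where m: "norm v < real m" using reals_Archimedean2 by blast
    have "\<sigma> (c m) = cinner v (e (k m))" using e[of v "k m"] by (simp add: coeff ts)
    then have "cmod (\<sigma> (c m)) \<le> norm v * norm (e (k m))" by (simp add: cinner_norm_le)
    also have "\<dots> \<le> real m * (norm (e (k m)) + 1)" using m by (intro mult_mono) auto
    finally show False using c(2)[of m] by simp
  qed
  then obtain d M where dM: "d > 0" "\<And>c. cmod c \<le> d \<Longrightarrow> cmod (\<sigma> c) \<le> M" by blast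
  have "field_automorphism \<sigma>"
    unfolding field_automorphism_def
  proof (intro conjI allI)
    show "bij \<sigma>" using tb by (simp add: \<sigma>_def bij_imp_bij_inv)
    show "\<sigma> 1 = 1" using ts(2)[of 1] t_one by simp
    show "\<sigma> (a + b) = \<sigma> a + \<sigma> b" "\<sigma> (a * b) = \<sigma> a * \<sigma> b" for a b
      using ts(2)[of "\<sigma> a + \<sigma> b"] ts(2)[of "\<sigma> a * \<sigma> b"] by (simp_all add: t_add t_mult ts(1))
  qed
  then have s: "\<sigma> = (\<lambda>c. c) \<or> \<sigma> = cnj" by (rule field_automorphism_bounded[OF _ dM])
  then have "\<tau> = (\<lambda>c. c) \<or> \<tau> = cnj"
  proof
    assume "\<sigma> = (\<lambda>c. c)" then show ?thesis using ts(1) by auto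
  next
    assume "\<sigma> = cnj" then have "\<tau> c = cnj c" for c using ts(2)[of c] by (metis complex_cnj_cnj)
    then show ?thesis by auto
  qed
  then show type: "clinear V \<or> conjugate_linear V" using lin by auto
  have t_norm: "cmod (\<tau> c) = cmod c" for c using \<open>\<tau> = (\<lambda>c. c) \<or> \<tau> = cnj\<close> by auto
  have t_real: "\<tau> (of_real r) = of_real r" for r using \<open>\<tau> = (\<lambda>c. c) \<or> \<tau> = cnj\<close> by auto
  have V_scaleR: "V (r *\<^sub>R x) = r *\<^sub>R V x" for r x
    using V_scale[of "of_real r" x] by (simp add: t_real scaleC_of_real)
  \<comment> \<open>As \<tau> preserves the modulus, the vector \<open>e w\<close> bounds the image
    of the unit ball weakly against \<open>w\<close>, and the uniform boundedness argument
    applies.\<close>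
  have "\<exists>C. \<forall>x\<in>V ` {v. norm v \<le> 1}. norm x \<le> C"
  proof (rule weakly_bounded_imp_bounded)
    fix w
    have "\<bar>inner (V v) w\<bar> \<le> norm (e w)" if "norm v \<le> 1" for v
    proof -
      have "\<bar>inner (V v) w\<bar> \<le> cmod (cinner (V v) w)" by (simp add: Re_cinner[symmetric] abs_Re_le_cmod)
      also have "\<dots> \<le> norm v * norm (e w)" by (simp add: e t_norm cinner_norm_le)
      also have "\<dots> \<le> norm (e w)" using that by (simp add: mult_left_le_one_le)
      finally show ?thesis .
    qed
    then show "\<exists>C. \<forall>x\<in>V ` {v. norm v \<le> 1}. \<bar>inner x w\<bar> \<le> C" by auto
  qed
  then obtain C where C: "\<And>v. norm v \<le> 1 \<Longrightarrow> norm (V v) \<le> C" by auto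
  show "bounded_linear V"
  proof (rule bounded_linear_intro[where K = C])
    fix v
    show "norm (V v) \<le> norm v * C"
    proof (cases "v = 0")
      case False
      have "norm (V (inverse (norm v) *\<^sub>R v)) \<le> C" using False by (intro C) simp
      then show ?thesis using False by (simp add: V_scaleR field_simps)
    qed (simp add: V0)
  qed (simp_all add: V_add V_scaleR)
qed

section \<open>Orthonormal bases\<close>

definition orthonormal :: "'a::complex_hilbert set \<Rightarrow> bool" where
  "orthonormal E \<longleftrightarrow> (\<forall>e\<in>E. norm e = 1) \<and> (\<forall>e\<in>E. \<forall>f\<in>E. e \<noteq> f \<longrightarrow> cinner e f = 0)"

lemma is_orthonormal_basis_iff: "is_orthonormal_basis E \<longleftrightarrow> orthonormal E \<and> closure (cspan E) = UNIV"
  by (simp add: is_orthonormal_basis_def orthonormal_def)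

lemma orthonormal_nonzero: "orthonormal E \<Longrightarrow> e \<in> E \<Longrightarrow> e \<noteq> 0"
  by (auto simp: orthonormal_def)

lemma orthonormal_notin_cspan:
  assumes "orthonormal E" "F \<subseteq> E" "e \<in> E" "e \<notin> F"
  shows "e \<notin> cspan F"
proof
  assume "e \<in> cspan F"
  then have "e \<in> closure (cspan F)" using closure_subset by blast
  then have "cinner e e = 0"
    by (rule orthogonal_closure_cspan[rotated]) (use assms in \<open>metis orthonormal_def subsetD\<close>)
  then show False using orthonormal_nonzero[OF assms(1,3)] by simp
qed

lemma orthonormal_independent: "orthonormal E \<Longrightarrow> complex_vector.independent E"
  unfolding complex_vector.dependent_def using orthonormal_notin_cspan[of E "E - {_}"] by blast

lemma orthonormal_independent3:
  assumes "orthonormal E" "a \<in> E" "b \<in> E" "c \<in> E" "a \<noteq> b" "a \<noteq> c" "b \<noteq> c"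
  shows "independent3 cspan a b c"
  using orthonormal_notin_cspan[OF assms(1), of "{a}" b] orthonormal_notin_cspan[OF assms(1), of "{a, b}" c]
    orthonormal_nonzero[OF assms(1,2)] assms by (auto simp: independent3_def)

text \<open>A maximal orthonormal set spans densely, since a nonzero vector orthogonal to it could
  be normalized and added. The choice in \<open>hilbert_dim\<close> becomes meaningful through
  this.\<close>

lemma orthonormal_basis_exists: "\<exists>E :: 'a::complex_hilbert set. is_orthonormal_basis E"
proof -
  have "\<exists>E\<in>Collect orthonormal. \<forall>X\<in>Collect orthonormal. E \<subseteq> X \<longrightarrow> X = (E :: 'a set)"
  proof (rule subset_Zorn')
    fix C :: "'a set set" assume C: "subset.chain (Collect orthonormal) C"
    then have orth: "orthonormal X" if "X \<in> C" for X using that by (auto simp: subset_chain_def)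
    have "cinner e f = 0" if ef: "e \<in> \<Union>C" "f \<in> \<Union>C" "e \<noteq> f" for e f
    proof -
      obtain X Y where XY: "X \<in> C" "e \<in> X" "Y \<in> C" "f \<in> Y" using ef by blast
      then have "X \<subseteq> Y \<or> Y \<subseteq> X" using C by (auto simp: subset_chain_def)
      then obtain Z where "Z \<in> C" "e \<in> Z" "f \<in> Z" using XY by blast
      then show ?thesis using orth ef(3) by (auto simp: orthonormal_def)
    qed
    then show "\<Union>C \<in> Collect orthonormal" using orth by (auto simp: orthonormal_def)
  qed
  then obtain E :: "'a set" where E: "orthonormal E" and max: "\<And>X. orthonormal X \<Longrightarrow> E \<subseteq> X \<Longrightarrow> X = E" by auto
  have "y \<in> closure (cspan E)" for y
  proof (rule ccontr)
    assume "y \<notin> closure (cspan E)"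
    then obtain v where v: "\<forall>s\<in>E. cinner v s = 0" "cinner v y \<noteq> 0"
      unfolding closure_cspan_orthogonal by blast
    define e where "e = complex_of_real (inverse (norm v)) *\<^sub>C v"
    have v0: "v \<noteq> 0" using v(2) by auto
    have ne: "norm e = 1" using v0 by (simp add: e_def norm_scaleC norm_inverse)
    have eE: "cinner e s = 0" "cinner s e = 0" if "s \<in> E" for s
      using v(1) that cinner_eq_0_commute[of s v] by (auto simp: e_def cinner_simps)
    have "orthonormal (insert e E)" using E ne eE by (auto simp: orthonormal_def)
    then have "insert e E = E" by (rule max) auto
    then have "e \<in> E" by blast
    then have "cinner e e = 0" by (rule eE)
    then show False using ne by auto
  qed
  then show ?thesis using E by (auto simp: is_orthonormal_basis_iff)
qed

lemma hilbert_dim_basis: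
  obtains E :: "'a::complex_hilbert set" where "orthonormal E" "closure (cspan E) = UNIV" "(hilbert_dim :: 'a rel) = |E|"
proof -
  have "is_orthonormal_basis (SOME E :: 'a set. is_orthonormal_basis E)"
    by (rule someI_ex[OF orthonormal_basis_exists])
  then show ?thesis using that by (auto simp: is_orthonormal_basis_iff hilbert_dim_def)
qed

text \<open>Bessel's inequality leaves only finitely many squared coefficients above each bound
  \<open>1 / real (Suc n)\<close>.\<close>

lemma bessel_countable:
  fixes x :: "'a::complex_hilbert"
  assumes F: "orthonormal F"
  shows "countable {f \<in> F. cinner x f \<noteq> 0}"
proof -
  have bessel: "(\<Sum>f\<in>G. (cmod (cinner x f))\<^sup>2) \<le> (norm x)\<^sup>2" if G: "finite G" "G \<subseteq> F" for G
  proof -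
    \<comment> \<open>\<open>p\<close> is the partial Fourier sum over \<open>G\<close>; its
      orthogonality to the rest of \<open>F\<close> is carried along for the next induction
      step.\<close>
    have "\<exists>p. (norm (x - p))\<^sup>2 = (norm x)\<^sup>2 - (\<Sum>f\<in>G. (cmod (cinner x f))\<^sup>2) \<and> (\<forall>g\<in>F - G. cinner p g = 0)"
      using G
    proof (induction G rule: finite_induct)
      case empty then show ?case by (intro exI[of _ 0]) simp
    next
      case (insert f G)
      then obtain p where p: "(norm (x - p))\<^sup>2 = (norm x)\<^sup>2 - (\<Sum>f\<in>G. (cmod (cinner x f))\<^sup>2)"
        "\<And>g. g \<in> F - G \<Longrightarrow> cinner p g = 0" by auto
      define k where "k = cinner x f"
      have f: "f \<in> F - G" "norm f = 1" using insert F by (auto simp: orthonormal_def)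
      have "inner (x - p) (k *\<^sub>C f) = Re (cnj k * k)"
        using p(2)[OF f(1)] by (simp add: Re_cinner[symmetric] cinner_simps k_def)
      then have ip: "inner (x - p) (k *\<^sub>C f) = (cmod k)\<^sup>2"
        by (simp add: complex_norm_square[symmetric] mult.commute flip: of_real_power)
      have "(norm (x - (p + k *\<^sub>C f)))\<^sup>2 = (norm (x - p))\<^sup>2 - 2 * inner (x - p) (k *\<^sub>C f) + (norm (k *\<^sub>C f))\<^sup>2"
        unfolding power2_norm_eq_inner by (simp add: inner_diff_left inner_diff_right inner_add_left inner_add_right inner_commute[of "k *\<^sub>C f" x]
            inner_commute[of "k *\<^sub>C f" p])
      also have "\<dots> = (norm (x - p))\<^sup>2 - (cmod k)\<^sup>2" using f by (simp add: ip norm_scaleC)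
      finally have "(norm (x - (p + k *\<^sub>C f)))\<^sup>2 = (norm x)\<^sup>2 - (\<Sum>f\<in>insert f G. (cmod (cinner x f))\<^sup>2)"
        using insert by (simp add: p(1) k_def)
      moreover have "cinner (p + k *\<^sub>C f) g = 0" if "g \<in> F - insert f G" for g
      proof -
        have "cinner f g = 0" using that f F by (auto simp: orthonormal_def)
        then show ?thesis using p(2)[of g] that by (simp add: cinner_simps)
      qed
      ultimately show ?case by blast
    qed
    then obtain p where "(norm (x - p))\<^sup>2 = (norm x)\<^sup>2 - (\<Sum>f\<in>G. (cmod (cinner x f))\<^sup>2)" by blast
    then show ?thesis using zero_le_power2[of "norm (x - p)"] by linarith
  qed
  have "{f \<in> F. cinner x f \<noteq> 0} = (\<Union>n. {f \<in> F. (cmod (cinner x f))\<^sup>2 > 1 / real (Suc n)})"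
  proof -
    have "\<exists>n. 1 / real (Suc n) < r" if "r > 0" for r :: real
      using reals_Archimedean[OF that] by (simp add: inverse_eq_divide)
    then have "\<exists>n. 1 / real (Suc n) < (cmod (cinner x f))\<^sup>2" if "cinner x f \<noteq> 0" for f using that by simp
    moreover have "cinner x f \<noteq> 0" if "1 / real (Suc n) < (cmod (cinner x f))\<^sup>2" for f n
      using that by (auto simp: divide_less_0_iff)
    ultimately show ?thesis by blast
  qed
  moreover have "finite {f \<in> F. (cmod (cinner x f))\<^sup>2 > 1 / real (Suc n)}" for n
  proof (rule ccontr)
    let ?X = "{f \<in> F. (cmod (cinner x f))\<^sup>2 > 1 / real (Suc n)}"
    obtain N :: nat where N: "(norm x)\<^sup>2 * real (Suc n) < real N" using reals_Archimedean2 by blast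
    assume "infinite ?X"
    then obtain G where G: "finite G" "card G = N" "G \<subseteq> ?X" using infinite_arbitrarily_large by blast
    have "real N * (1 / real (Suc n)) = (\<Sum>f\<in>G. 1 / real (Suc n))" by (simp add: G)
    also have "\<dots> \<le> (\<Sum>f\<in>G. (cmod (cinner x f))\<^sup>2)" using G by (intro sum_mono) auto
    also have "\<dots> \<le> (norm x)\<^sup>2" using G by (intro bessel) auto
    finally show False using N by (simp add: field_simps)
  qed
  ultimately show ?thesis by (simp add: countable_finite)
qed

lemma card_of_countable_cover:
  assumes inf: "infinite E" and cover: "F \<subseteq> (\<Union>e\<in>E. X e)" and X: "\<And>e. e \<in> E \<Longrightarrow> countable (X e)"
  shows "|F| \<le>o |E|"
proof -
  have "|X e| \<le>o |E|" if "e \<in> E" for e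
  proof -
    have "|X e| \<le>o |UNIV :: nat set|" using X[OF that] unfolding countable_def card_of_ordLeq[symmetric] by blast
    then show ?thesis using inf infinite_iff_card_of_nat ordLeq_transitive by blast
  qed
  then have "|\<Union>e\<in>E. X e| \<le>o |E|"
    by (intro card_of_UNION_ordLeq_infinite inf ballI) (auto simp: card_of_refl ordIso_imp_ordLeq)
  then show ?thesis using card_of_mono1[OF cover] ordLeq_transitive by blast
qed

section \<open>Bounded isomorphisms\<close>

lemma bounded_isomorphismD:
  assumes "bounded_isomorphism U"
  shows "bij (blinfun_apply U)" "clinear (blinfun_apply U) \<or> conjugate_linear (blinfun_apply U)"
    "x \<noteq> 0 \<Longrightarrow> blinfun_apply U x \<noteq> 0"
  using assms by (auto simp: bounded_isomorphism_def bij_def inj_def)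

lemma adj_cinner:
  assumes "clinear (blinfun_apply V) \<or> conjugate_linear (blinfun_apply V)"
  shows "cinner (blinfun_apply (adj V) w) y =
    (if clinear (blinfun_apply V) then cinner w (blinfun_apply V y) else cinner (blinfun_apply V y) w)"
  using assms by (auto simp: adj_def linear_adjoint conjugate_linear_adjoint)

lemma adj_cinner_eq_0:
  assumes "clinear (blinfun_apply V) \<or> conjugate_linear (blinfun_apply V)"
  shows "cinner (blinfun_apply (adj V) w) y = 0 \<longleftrightarrow> cinner w (blinfun_apply V y) = 0"
  using cinner_eq_0_commute[of w "blinfun_apply V y"] by (simp add: adj_cinner[OF assms])

lemma adj_scaleC:
  assumes "clinear (blinfun_apply V) \<or> conjugate_linear (blinfun_apply V)"
  shows "blinfun_apply (adj V) (c *\<^sub>C w) = (if clinear (blinfun_apply V) then c else cnj c) *\<^sub>C blinfun_apply (adj V) w"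
  by (rule cinner_ext) (simp add: adj_cinner[OF assms] cinner_simps)

lemma adj_injective:
  assumes "bounded_isomorphism V" "blinfun_apply (adj V) w = 0"
  shows "w = 0"
proof -
  obtain y where "blinfun_apply V y = w" using bounded_isomorphismD(1)[OF assms(1)] by (metis bij_pointE)
  moreover have "cinner w (blinfun_apply V y) = 0"
    using adj_cinner_eq_0[OF bounded_isomorphismD(2)[OF assms(1)], of w y] assms(2) by simp
  ultimately show ?thesis by simp
qed

text \<open>A bounded isomorphism need not map a basis to a basis. Instead, each \<open>f\<close> in
  \<open>F\<close> has a nonzero coefficient against some \<open>U e\<close>, and each
  \<open>U e\<close> has only countably many nonzero coefficients, so that \<open>F\<close> is no
  larger than \<open>E\<close>; the adjoint gives the converse.\<close>

lemma bounded_isomorphism_basis_ordIso: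
  fixes U :: "'h::complex_hilbert \<Rightarrow>\<^sub>L 'k::complex_hilbert" and E :: "'h set" and F :: "'k set"
  assumes U: "bounded_isomorphism U"
    and E: "orthonormal E" "closure (cspan E) = UNIV" "infinite E"
    and F: "orthonormal F" "closure (cspan F) = UNIV" "infinite F"
  shows "|E| =o |F|"
proof -
  note lin = bounded_isomorphismD(2)[OF U]
  have "F \<subseteq> (\<Union>e\<in>E. {f \<in> F. cinner (blinfun_apply U e) f \<noteq> 0})"
  proof
    fix f assume f: "f \<in> F"
    have "\<exists>e\<in>E. cinner (blinfun_apply U e) f \<noteq> 0"
    proof (rule ccontr)
      assume "\<not> (\<exists>e\<in>E. cinner (blinfun_apply U e) f \<noteq> 0)"
      then have "cinner (blinfun_apply (adj U) f) e = 0" if "e \<in> E" for e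
        using that by (simp add: adj_cinner_eq_0[OF lin] cinner_eq_0_commute[of f])
      then have "cinner (blinfun_apply (adj U) f) z = 0" for z
        by (rule orthogonal_closure_cspan[of E]) (auto simp: E)
      then have "blinfun_apply (adj U) f = 0" by (intro cinner_ext) simp
      then show False using adj_injective[OF U] orthonormal_nonzero[OF F(1) f] by blast
    qed
    then show "f \<in> (\<Union>e\<in>E. {f \<in> F. cinner (blinfun_apply U e) f \<noteq> 0})" using f by blast
  qed
  then have "|F| \<le>o |E|" by (rule card_of_countable_cover[OF E(3)]) (rule bessel_countable[OF F(1)])
  have "E \<subseteq> (\<Union>f\<in>F. {e \<in> E. cinner (blinfun_apply (adj U) f) e \<noteq> 0})"
  proof
    fix e assume e: "e \<in> E"
    have "\<exists>f\<in>F. cinner (blinfun_apply (adj U) f) e \<noteq> 0"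
    proof (rule ccontr)
      assume "\<not> (\<exists>f\<in>F. cinner (blinfun_apply (adj U) f) e \<noteq> 0)"
      then have "cinner (blinfun_apply U e) f = 0" if "f \<in> F" for f
        using that by (simp add: adj_cinner_eq_0[OF lin] cinner_eq_0_commute[of _ f])
      then have "cinner (blinfun_apply U e) z = 0" for z
        by (rule orthogonal_closure_cspan[of F]) (auto simp: F)
      then have "blinfun_apply U e = 0" by (intro cinner_ext) simp
      then show False using bounded_isomorphismD(3)[OF U] orthonormal_nonzero[OF E(1) e] by blast
    qed
    then show "e \<in> (\<Union>f\<in>F. {e \<in> E. cinner (blinfun_apply (adj U) f) e \<noteq> 0})" using e by blast
  qed
  then have "|E| \<le>o |F|" by (rule card_of_countable_cover[OF F(3)]) (rule bessel_countable[OF E(1)])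
  with \<open>|F| \<le>o |E|\<close> show ?thesis by (simp add: ordIso_iff_ordLeq)
qed

section \<open>Zero sets of forms\<close>

lemma clinear_diff: "clinear T \<Longrightarrow> T (x - y) = T x - T y"
  using clinear_add[of T "x - y" y] by (simp add: algebra_simps)

lemma cinner_zero_multiple:
  fixes u v :: "'a::complex_hilbert"
  assumes "\<And>y. cinner u y = 0 \<Longrightarrow> cinner v y = 0"
  shows "\<exists>c. v = c *\<^sub>C u"
proof (cases "u = 0")
  case True
  then have "cinner v v = 0" by (intro assms) simp
  then show ?thesis by simp
next
  case False
  then have "v \<in> cspan {u}" using assms by (intro cspan_singletonI_orthogonal)
  then show ?thesis by (simp add: in_cspan_singleton)
qed

text \<open>The two maps are proportional at every point. Comparison at a sum of points with
  independent images shows that the factor is constant; dependent images are handled through the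
  null space of \<open>T\<close>.\<close>

lemma zero_set_linear:
  fixes T a :: "'h::complex_hilbert \<Rightarrow> 'h"
  assumes T: "clinear T" and a: "clinear a"
    and zero: "\<And>x y. cinner (T x) y = 0 \<Longrightarrow> cinner (a x) y = 0"
  shows "\<exists>c. \<forall>x. a x = c *\<^sub>C T x"
proof (cases "\<forall>x. T x = 0")
  case True
  then have "cinner (a x) (a x) = 0" for x by (intro zero) simp
  then show ?thesis by (intro exI[of _ 0]) simp
next
  case False
  then obtain x0 where x0: "T x0 \<noteq> 0" by blast
  have mult: "\<exists>c. a x = c *\<^sub>C T x" for x using zero by (rule cinner_zero_multiple)
  obtain c where c: "a x0 = c *\<^sub>C T x0" using mult by blast
  have "a x = c *\<^sub>C T x" for x
  proof (cases "T x \<in> cspan {T x0}")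
    case True
    then obtain l where l: "T x = l *\<^sub>C T x0" by (auto simp: in_cspan_singleton)
    have "T (x - l *\<^sub>C x0) = 0" by (simp add: clinear_diff[OF T] clinear_scale[OF T] l)
    moreover obtain d where "a (x - l *\<^sub>C x0) = d *\<^sub>C T (x - l *\<^sub>C x0)" using mult by blast
    ultimately have "a x = l *\<^sub>C a x0" by (simp add: clinear_diff[OF a] clinear_scale[OF a])
    then show ?thesis by (simp add: l c scaleC_scaleC mult.commute)
  next
    case False
    obtain d where d: "a x = d *\<^sub>C T x" using mult by blast
    obtain k where "a (x0 + x) = k *\<^sub>C T (x0 + x)" using mult by blast
    then have "c *\<^sub>C T x0 + d *\<^sub>C T x = k *\<^sub>C T x0 + k *\<^sub>C T x"
      by (simp add: clinear_add[OF a] clinear_add[OF T] c d scaleC_add_right)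
    then have "c = k \<and> d = k" by (rule complex_vector.independent2_coeff[OF x0 False])
    then show ?thesis using d by simp
  qed
  then show ?thesis by blast
qed

text \<open>A linear and a conjugate-linear map that are pointwise proportional differ in their behaviour
  under multiplication by \<open>\<i>\<close>, so that the factor vanishes.\<close>

lemma zero_set_conjugate_linear:
  fixes T a :: "'h::complex_hilbert \<Rightarrow> 'h"
  assumes T: "conjugate_linear T" and a: "clinear a"
    and zero: "\<And>x y. cinner (T x) y = 0 \<Longrightarrow> cinner (a x) y = 0"
    and indep: "T x1 \<noteq> 0" "T x2 \<notin> cspan {T x1}"
  shows "a x = 0"
proof (cases "T x = 0")
  case True
  then have "cinner (a x) (a x) = 0" by (intro zero) simp
  then show ?thesis by simp
next
  case False
  have T_add: "T (u + v) = T u + T v" and T_scale: "T (c *\<^sub>C u) = cnj c *\<^sub>C T u" for u v c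
    using T by (auto simp: semilinear_wrt_def)
  have mult: "\<exists>c. a u = c *\<^sub>C T u" for u using zero by (rule cinner_zero_multiple)
  obtain x' where x': "T x' \<notin> cspan {T x}"
  proof (cases "T x1 \<in> cspan {T x}")
    case True
    then have "cspan {T x1} = cspan {T x}" using cspan_singleton_eq_iff[OF indep(1) False] by simp
    then show ?thesis using that[of x2] indep(2) by simp
  qed blast
  obtain d where d: "a x' = d *\<^sub>C T x'" using mult by blast
  \<comment> \<open>The factor at any \<open>u\<close> whose image is independent of
    \<open>T x'\<close> equals the one at \<open>x'\<close>. Both \<open>x\<close> and
    \<open>\<i> *\<^sub>C x\<close> qualify, with opposite factors.\<close>
  have same: "c = d" if c: "a u = c *\<^sub>C T u" and u: "T u \<noteq> 0" "T x' \<notin> cspan {T u}" for u c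
  proof -
    obtain k where "a (u + x') = k *\<^sub>C T (u + x')" using mult by blast
    then have "c *\<^sub>C T u + d *\<^sub>C T x' = k *\<^sub>C T u + k *\<^sub>C T x'"
      by (simp add: clinear_add[OF a] T_add c d scaleC_add_right)
    then have "c = k \<and> d = k" by (rule complex_vector.independent2_coeff[OF u])
    then show ?thesis by simp
  qed
  obtain c where c: "a x = c *\<^sub>C T x" using mult by blast
  have "a (\<i> *\<^sub>C x) = (- c) *\<^sub>C T (\<i> *\<^sub>C x)"
    by (simp add: clinear_scale[OF a] T_scale c scaleC_scaleC mult.commute)
  moreover have "T (\<i> *\<^sub>C x) \<noteq> 0" using False by (simp add: T_scale)
  moreover have "cspan {T (\<i> *\<^sub>C x)} = cspan {T x}"
  proof -
    have "T (\<i> *\<^sub>C x) = (- \<i>) *\<^sub>C T x" by (simp add: T_scale)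
    then have "T (\<i> *\<^sub>C x) \<in> cspan {T x}" unfolding in_cspan_singleton by blast
    then show ?thesis using False \<open>T (\<i> *\<^sub>C x) \<noteq> 0\<close> by (simp add: cspan_singleton_eq_iff)
  qed
  ultimately have "- c = d" using same x' by simp
  moreover have "c = d" by (rule same[OF c False x'])
  ultimately have "c = 0" by simp
  then show ?thesis by (simp add: c)
qed

section \<open>Dimensions and continuity\<close>

text \<open>In contrast to the assumption of \<open>kernel_bijection\<close>, \<open>S\<close> may
  be infinite; its closure within a line of the grid is then a closed span.\<close>

definition kernel_continuous :: "('h::complex_hilbert \<Rightarrow>\<^sub>L 'h) set \<Rightarrow> ('k::complex_hilbert \<Rightarrow>\<^sub>L 'k) set \<Rightarrow>
    (('h \<Rightarrow>\<^sub>L 'h) set \<Rightarrow> ('k \<Rightarrow>\<^sub>L 'k) set) \<Rightarrow> bool" where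
  "kernel_continuous A B \<Phi> \<longleftrightarrow> (\<forall>S I. S \<subseteq> normal_part A \<longrightarrow> I \<in> normal_part A \<longrightarrow>
     A \<inter> \<Inter>S \<subseteq> I \<longrightarrow> B \<inter> \<Inter>(\<Phi> ` S) \<subseteq> \<Phi> I)"

text \<open>Continuity of the inverse, stated on the domain side so that no inverse function
  appears.\<close>

definition kernel_cocontinuous :: "('h::complex_hilbert \<Rightarrow>\<^sub>L 'h) set \<Rightarrow> ('k::complex_hilbert \<Rightarrow>\<^sub>L 'k) set \<Rightarrow>
    (('h \<Rightarrow>\<^sub>L 'h) set \<Rightarrow> ('k \<Rightarrow>\<^sub>L 'k) set) \<Rightarrow> bool" where
  "kernel_cocontinuous A B \<Phi> \<longleftrightarrow> (\<forall>S I. S \<subseteq> normal_part A \<longrightarrow> I \<in> normal_part A \<longrightarrow>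
     B \<inter> \<Inter>(\<Phi> ` S) \<subseteq> \<Phi> I \<longrightarrow> A \<inter> \<Inter>S \<subseteq> I)"

context implemented_bijection
begin

lemma v_closure:
  assumes cont: "kernel_continuous A B \<Phi>" and v0: "v 0 = 0" and y: "y \<in> closure (cspan S)"
  shows "v y \<in> closure (cspan (v ` S))"
proof (cases "y = 0")
  case True
  have "0 \<in> cspan (v ` S)" by (rule complex_vector.span_zero)
  then show ?thesis using True v0 closure_subset by auto
next
  case False
  obtain e :: 'h where e: "e \<noteq> 0" by (rule nonzero_vector)
  \<comment> \<open>Zero indexes no point of the normal part; removing it leaves the span
    unchanged.\<close>
  let ?S = "S - {0}"
  have S0: "0 \<notin> ?S" by simp
  have yS: "y \<in> closure (cspan ?S)" using y by simp
  have "(\<lambda>s. kernel_on A (omega e s)) ` ?S \<subseteq> normal_part A" using e by (auto intro!: kernel_normal_part)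
  then have "B \<inter> \<Inter>(\<Phi> ` (\<lambda>s. kernel_on A (omega e s)) ` ?S) \<subseteq> \<Phi> (kernel_on A (omega e y))"
    by (rule cont[unfolded kernel_continuous_def, rule_format, OF _ kernel_normal_part[OF e False]
          iffD2[OF dom.row_closure[OF e] yS]])
  then have "v y \<in> closure (cspan (v ` ?S))"
    unfolding column_image[OF e S0] \<Phi>_kernel[OF e False] cod.row_closure[OF u_nz[OF e]] .
  moreover have "cspan (v ` ?S) \<subseteq> cspan (v ` S)" by (rule complex_vector.span_mono) auto
  ultimately show ?thesis using closure_mono by blast
qed

lemma u_closure:
  assumes cont: "kernel_continuous A B \<Phi>" and u0: "u 0 = 0" and y: "y \<in> closure (cspan S)"
  shows "u y \<in> closure (cspan (u ` S))"
proof (cases "y = 0")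
  case True
  have "0 \<in> cspan (u ` S)" by (rule complex_vector.span_zero)
  then show ?thesis using True u0 closure_subset by auto
next
  case False
  obtain e :: 'h where e: "e \<noteq> 0" by (rule nonzero_vector)
  let ?S = "S - {0}"
  have S0: "0 \<notin> ?S" by simp
  have yS: "y \<in> closure (cspan ?S)" using y by simp
  have "(\<lambda>s. kernel_on A (omega s e)) ` ?S \<subseteq> normal_part A" using e by (auto intro!: kernel_normal_part)
  then have "B \<inter> \<Inter>(\<Phi> ` (\<lambda>s. kernel_on A (omega s e)) ` ?S) \<subseteq> \<Phi> (kernel_on A (omega y e))"
    by (rule cont[unfolded kernel_continuous_def, rule_format, OF _ kernel_normal_part[OF False e]
          iffD2[OF dom.column_closure[OF e] yS]])
  then have "u y \<in> closure (cspan (u ` ?S))"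
    unfolding row_image[OF e S0] \<Phi>_kernel[OF False e] cod.column_closure[OF v_nz[OF e]] .
  moreover have "cspan (u ` ?S) \<subseteq> cspan (u ` S)" by (rule complex_vector.span_mono) auto
  ultimately show ?thesis using closure_mono by blast
qed

text \<open>Although \<open>v\<close> may be far from linear, it carries a finite spanning set to a
  spanning set, and an orthonormal set, being independent, cannot be larger.\<close>

lemma basis_card_le:
  assumes E: "finite (E :: 'h set)" "closure (cspan E) = UNIV" "0 \<notin> E" and F: "orthonormal (F :: 'k set)"
  shows "finite F \<and> card F \<le> card E"
proof -
  have sE: "cspan E = UNIV" using E(1-3) closure_cspan_finite[OF E(1)] by simp
  have "w \<in> cspan (v ` E)" for w
  proof (cases "w = 0")
    case False
    then obtain x where x: "x \<noteq> 0" "w \<in> cspan {v x}" using u_v_onto(2) by blast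
    have "v x \<in> cspan (v ` E)" using v_cspan[OF E(1,3) x(1)] sE by simp
    then show ?thesis using x(2) complex_vector.span_one_trans by blast
  qed (simp add: complex_vector.span_zero)
  then have "F \<subseteq> cspan (v ` E)" by blast
  then have "finite F \<and> card F \<le> card (v ` E)"
    using complex_vector.independent_span_bound[OF finite_imageI[OF E(1)] orthonormal_independent[OF F]] by blast
  then show ?thesis using card_image_le[OF E(1), of v] by linarith
qed

lemma bounded_implementation:
  assumes cont: "kernel_continuous A B \<Phi>" and ind: "independent3 cspan (e :: 'h) f f'"
    and k: "\<And>n :: nat. norm (k n :: 'k) = 1" "\<And>m n. m \<noteq> n \<Longrightarrow> cinner (k m) (k n) = 0"
  obtains U V :: "'h \<Rightarrow>\<^sub>L 'k" where "bounded_isomorphism U" "bounded_isomorphism V"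
    "implements A B \<Phi> (blinfun_apply U) (blinfun_apply V)"
proof -
  obtain U V where UV: "semilinear U" "bij U" "semilinear V" "bij V" "implements A B \<Phi> U V"
    using semilinear_implementation[OF ind] by blast
  have z: "T 0 = 0" if "semilinear T" for T :: "'h \<Rightarrow> 'k"
  proof -
    have "T (0 + 0) = T 0 + T 0" using that unfolding semilinear_def semilinear_wrt_def by blast
    then show ?thesis by simp
  qed
  have nz: "T x \<noteq> 0" if "semilinear T" "bij T" "x \<noteq> 0" for T :: "'h \<Rightarrow> 'k" and x
    using z[OF that(1)] that(2,3) by (metis bij_is_inj injD)
  \<comment> \<open>The semilinear maps are themselves admissible representatives, and they vanish
    at 0, so that the statements on closures hold for them.\<close>
  interpret UV: implemented_bijection A B \<Phi> U V
    by unfold_locales (use UV nz in auto)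
  note cu = semilinear_closed_span_bounded[OF UV(1,2) UV.u_closure[OF cont z[OF UV(1)]] k]
  note cv = semilinear_closed_span_bounded[OF UV(3,4) UV.v_closure[OF cont z[OF UV(3)]] k]
  show ?thesis
    by (rule that[of "Blinfun U" "Blinfun V"])
      (use UV cu cv in \<open>simp_all add: bounded_isomorphism_def bounded_linear_Blinfun_apply\<close>)
qed

end

context kernel_bijection
begin

lemma adjoint_continuous:
  assumes "kernel_continuous A B \<Phi>" shows "kernel_continuous A B (\<lambda>I. adj ` \<Phi> I)"
  unfolding kernel_continuous_def
proof (intro allI impI)
  fix S I assume S: "S \<subseteq> normal_part A" and I: "I \<in> normal_part A" and cl: "A \<inter> \<Inter>S \<subseteq> I"
  have "\<Phi> ` S \<subseteq> normal_part B" using S \<Phi>_mem by auto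
  from cod.adj_image_closure[OF this \<Phi>_mem[OF I]]
  show "B \<inter> \<Inter>((\<lambda>I. adj ` \<Phi> I) ` S) \<subseteq> adj ` \<Phi> I"
    using assms S I cl unfolding kernel_continuous_def by (simp add: image_image)
qed

lemma adjoint_cocontinuous:
  assumes "kernel_cocontinuous A B \<Phi>" shows "kernel_cocontinuous A B (\<lambda>I. adj ` \<Phi> I)"
  unfolding kernel_cocontinuous_def
proof (intro allI impI)
  fix S I assume S: "S \<subseteq> normal_part A" and I: "I \<in> normal_part A"
    and cl: "B \<inter> \<Inter>((\<lambda>I. adj ` \<Phi> I) ` S) \<subseteq> adj ` \<Phi> I"
  have "\<Phi> ` S \<subseteq> normal_part B" using S \<Phi>_mem by auto
  from cod.adj_image_closure[OF this \<Phi>_mem[OF I]]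
  show "A \<inter> \<Inter>S \<subseteq> I"
    using assms S I cl unfolding kernel_cocontinuous_def by (simp add: image_image)
qed

lemma implemented_cases:
  assumes "(x :: 'h) \<noteq> 0" "y \<noteq> 0" "y \<notin> cspan {x}"
  obtains u v where "implemented_bijection A B \<Phi> u v" | u v where "implemented_bijection A B (\<lambda>I. adj ` \<Phi> I) u v"
proof -
  obtain u v where uv: "\<And>x. x \<noteq> 0 \<Longrightarrow> u x \<noteq> 0" "\<And>x. x \<noteq> 0 \<Longrightarrow> v x \<noteq> 0"
    "implements A B \<Phi> u v \<or> implements_flipped A B \<Phi> u v"
    using implementing_representatives[OF assms] by blast
  from uv(3) show ?thesis
  proof
    assume "implements A B \<Phi> u v"
    then have "implemented_bijection A B \<Phi> u v"
      by (intro implemented_bijection.intro implemented_bijection_axioms.intro kernel_bijection_axioms uv)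
    then show ?thesis by (rule that)
  next
    assume "implements_flipped A B \<Phi> u v"
    then have "implements A B (\<lambda>I. adj ` \<Phi> I) u v" by (simp add: implements_adjoint)
    then have "implemented_bijection A B (\<lambda>I. adj ` \<Phi> I) u v"
      by (intro implemented_bijection.intro implemented_bijection_axioms.intro adjoint uv)
    then show ?thesis by (rule that)
  qed
qed

lemma finite_basis_card_le:
  assumes E: "finite (E :: 'h set)" "orthonormal E" "closure (cspan E) = UNIV" and F: "orthonormal (F :: 'k set)"
  shows "finite F \<and> card F \<le> card E"
proof -
  have E0: "0 \<notin> E" using orthonormal_nonzero[OF E(2)] by blast
  have sE: "cspan E = UNIV" using E closure_cspan_finite[OF E(1)] by simp
  obtain a where "a \<in> A" "a \<noteq> 0" using dom.A_not_zero dom.zero_mem by blast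
  then obtain z where z: "blinfun_apply a z \<noteq> 0" by (metis blinfun_eqI zero_blinfun.rep_eq)
  have "E \<noteq> {}"
  proof
    assume "E = {}"
    then have "blinfun_apply a z \<in> {0}" using sE by simp
    then show False using z by simp
  qed
  then obtain e where e: "e \<in> E" by blast
  show ?thesis
  proof (cases "E = {e}")
    case False
    then obtain f where f: "f \<in> E" "f \<noteq> e" using e by blast
    have "f \<notin> cspan {e}" using orthonormal_notin_cspan[OF E(2), of "{e}" f] e f by simp
    then show ?thesis
      by (rule implemented_cases[OF orthonormal_nonzero[OF E(2) e] orthonormal_nonzero[OF E(2) f(1)]])
        (rule implemented_bijection.basis_card_le[OF _ E(1,3) E0 F], assumption)+
  next
    \<comment> \<open>In dimension one the normal part of \<open>A\<close> is a single point, hence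
      so is that of \<open>B\<close>, whereas two orthonormal vectors would give two points.\<close>
    case True
    have single: "I = kernel_on A (omega e e)" if I: "I \<in> normal_part A" for I
    proof -
      obtain x y where xy: "x \<noteq> 0" "y \<noteq> 0" "I = kernel_on A (omega x y)" using I by (auto simp: normal_part_def)
      have "e \<noteq> 0" using e E0 by blast
      moreover have "x \<in> cspan {e}" "y \<in> cspan {e}" using sE True by auto
      ultimately show ?thesis using xy by (simp add: dom.kernel_eq_iff cspan_singleton_eq_iff)
    qed
    have "f = g" if fg: "f \<in> F" "g \<in> F" for f g
    proof (rule ccontr)
      assume "f \<noteq> g"
      have nz: "f \<noteq> 0" "g \<noteq> 0" using fg orthonormal_nonzero[OF F] by auto
      obtain I J where "I \<in> normal_part A" "J \<in> normal_part A" "\<Phi> I = kernel_on B (omega f f)" "\<Phi> J = kernel_on B (omega g g)"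
        using \<Phi>_onto kernel_normal_part[of f f B] kernel_normal_part[of g g B] nz by metis
      then have "kernel_on B (omega f f) = kernel_on B (omega g g)" using single by metis
      then have "f \<in> cspan {g}" using nz by (simp add: cod.kernel_eq_iff cspan_singleton_eq_iff)
      then show False using orthonormal_notin_cspan[OF F, of "{g}" f] fg \<open>f \<noteq> g\<close> by simp
    qed
    then have "F \<subseteq> {f}" if "f \<in> F" for f using that by blast
    then have "\<exists>f. F \<subseteq> {f}" by blast
    then obtain f where "F \<subseteq> {f}" by blast
    then show ?thesis using True card_mono[of "{f}" F] finite_subset[of F "{f}"] by simp
  qed
qed

section \<open>The compressed algebra\<close>

text \<open>The kernels of the pairs in \<open>Z\<close> have intersection zero, so their closure is the whole normal part,
  and by continuity \<open>b\<close> lies in all kernels.\<close>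

lemma vanishing_form:
  assumes cont: "kernel_continuous A B \<Phi>" and impl: "implements A B \<Phi> U V"
    and b: "b \<in> B" "\<And>x y. Z x y \<Longrightarrow> cinner (blinfun_apply b (U x)) (V y) = 0"
    and Z: "\<And>x y. Z x y \<Longrightarrow> x \<noteq> 0 \<and> y \<noteq> 0"
    and trivial: "\<And>a. a \<in> A \<Longrightarrow> (\<And>x y. Z x y \<Longrightarrow> cinner (blinfun_apply a x) y = 0) \<Longrightarrow> a = 0"
  shows "b = 0"
proof -
  define S where "S = {kernel_on A (omega x y) | x y. Z x y}"
  have S: "S \<subseteq> normal_part A" using Z by (auto simp: S_def intro!: kernel_normal_part)
  have "a = 0" if "a \<in> A \<inter> \<Inter>S" for a
    using that by (intro trivial) (auto simp: S_def kernel_on_def omega_def)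
  moreover have "0 \<in> I" if "I \<in> normal_part A" for I
    using that dom.zero_mem by (auto simp: normal_part_def kernel_on_def omega_def)
  ultimately have sub: "A \<inter> \<Inter>S \<subseteq> I" if "I \<in> normal_part A" for I using that by blast
  have cl: "B \<inter> \<Inter>(\<Phi> ` S) \<subseteq> \<Phi> I" if "I \<in> normal_part A" for I
    by (rule cont[unfolded kernel_continuous_def, rule_format, OF S that sub[OF that]])
  have "b \<in> \<Phi> I" if "I \<in> S" for I
  proof -
    obtain x y where xy: "Z x y" "I = kernel_on A (omega x y)" using \<open>I \<in> S\<close> by (auto simp: S_def)
    then have "\<Phi> I = kernel_on B (omega (U x) (V y))" using impl Z by (simp add: implements_def)
    then show ?thesis using b xy(1) by (simp add: kernel_on_def omega_def)
  qed
  then have "b \<in> \<Phi> I" if "I \<in> normal_part A" for I using cl[OF that] b(1) by blast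
  then have bJ: "b \<in> J" if "J \<in> normal_part B" for J using \<Phi>_onto[OF that] by blast
  have "blinfun_apply b w = 0" for w
  proof (rule ccontr)
    assume nz: "blinfun_apply b w \<noteq> 0"
    then have "w \<noteq> 0" by auto
    then have "b \<in> kernel_on B (omega w (blinfun_apply b w))" using nz by (intro bJ kernel_normal_part)
    then show False using nz by (simp add: kernel_on_def omega_def)
  qed
  then show ?thesis by (intro blinfun_eqI) simp
qed

text \<open>Density provides an element close to the identity on two orthonormal vectors, and
  closeness preserves independence. Rank two is needed to refute the mixed case, as a
  conjugate-linear map of rank one can share its zero set with a linear one.\<close>

lemma rank_two_element:
  assumes w: "norm w1 = 1" "norm w2 = 1" "cinner w1 (w2 :: 'k) = 0"
  obtains b where "b \<in> B" "blinfun_apply b w1 \<noteq> 0" "blinfun_apply b w2 \<notin> cspan {blinfun_apply b w1}"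
proof -
  define X :: "'k^2" where "X = (\<chi> i. if i = 1 then w1 else w2)"
  have "(\<chi> i. X $ i) \<in> closure ((\<lambda>a. \<chi> i. blinfun_apply a (X $ i)) ` B)"
    using cod.density[of "\<lambda>x. x" X] by (simp add: semilinear_wrt_def)
  \<comment> \<open>One quarter suffices: \<open>q = c *\<^sub>C p\<close> would force
    \<open>cmod c < 1/3\<close>, while \<open>norm p \<le> 5/4\<close> and
    \<open>norm q \<ge> 3/4\<close>.\<close>
  then obtain b where b: "b \<in> B" "dist (\<chi> i. blinfun_apply b (X $ i)) X < 1/4"
    unfolding closure_approachable by (auto simp: dest!: spec[of _ "1/4 :: real"])
  define p where "p = blinfun_apply b w1"
  define q where "q = blinfun_apply b w2"
  have "norm (p - w1) < 1/4" "norm (q - w2) < 1/4"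
    using b(2) Finite_Cartesian_Product.norm_nth_le[of "(\<chi> i. blinfun_apply b (X $ i)) - X" 1]
      Finite_Cartesian_Product.norm_nth_le[of "(\<chi> i. blinfun_apply b (X $ i)) - X" 2]
    by (simp_all add: dist_norm p_def q_def X_def)
  then have pq: "norm (p - w1) < 1/4" "norm (q - w2) < 1/4" by simp_all
  have near: "cmod (cinner (v - u) w1) < 1/4" if "norm (v - u) < 1/4" for u v
    using cinner_norm_le[of "v - u" w1] w(1) that by simp
  have ww: "cinner w1 w1 = 1" "cinner w2 w1 = 0" using w cinner_eq_0_commute[of w2 w1] by (simp_all add: cinner_self)
  have "cmod (cinner p w1 - 1) < 1/4" "cmod (cinner q w1) < 1/4"
    using near[OF pq(1)] near[OF pq(2)] by (simp_all add: cinner_diff_left ww)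
  moreover have "1 - cmod (cinner p w1) \<le> cmod (cinner p w1 - 1)"
    using norm_triangle_ineq2[of 1 "cinner p w1"] by (simp add: norm_minus_commute)
  ultimately have pw: "cmod (cinner p w1) > 3/4" and qw: "cmod (cinner q w1) < 1/4" by simp_all
  have np: "norm p \<le> 5/4" using norm_triangle_ineq2[of p w1] pq(1) w(1) by simp
  have nq: "norm q \<ge> 3/4" using norm_triangle_ineq2[of w2 q] pq(2) w(2) by (simp add: norm_minus_commute)
  have "q \<noteq> c *\<^sub>C p" for c
  proof
    assume q: "q = c *\<^sub>C p"
    have "cmod c * (3/4) \<le> cmod c * cmod (cinner p w1)" using pw by (intro mult_left_mono) auto
    also have "\<dots> < 1/4" using qw by (simp add: q cinner_scaleC_left norm_mult)
    finally have "cmod c < 1/3" by simp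
    then have "cmod c * norm p \<le> 1/3 * (5/4)" using np by (intro mult_mono) auto
    then show False using nq by (simp add: q norm_scaleC)
  qed
  moreover have "p \<noteq> 0" using pw by auto
  ultimately show ?thesis using that[OF b(1)] by (auto simp: p_def q_def in_cspan_singleton)
qed

text \<open>The zero set of \<open>T b\<close> is that of \<open>b\<close> transported by
  \<open>U\<close> and \<open>V\<close>. An element of \<open>A\<close> vanishing wherever
  \<open>T b\<close> does is a multiple of \<open>T b\<close>, or zero when \<open>T b\<close> is
  conjugate-linear of rank at least two. If \<open>T b\<close> is not in \<open>A\<close>, only the
  zero element vanishes there, and continuity makes \<open>b\<close> zero. With a continuous inverse
  the same argument runs in the other direction.\<close>

lemma sandwich_properties:
  fixes U V :: "'h \<Rightarrow>\<^sub>L 'k"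
  assumes cont: "kernel_continuous A B \<Phi>" and impl: "implements A B \<Phi> (blinfun_apply U) (blinfun_apply V)"
    and U: "bounded_isomorphism U" and V: "bounded_isomorphism V"
    and w: "norm w1 = 1" "norm w2 = 1" "cinner w1 (w2 :: 'k) = 0"
  shows "clinear (blinfun_apply U) \<longleftrightarrow> clinear (blinfun_apply V)" "sandwich V B U \<subseteq> A"
    "kernel_cocontinuous A B \<Phi> \<Longrightarrow> sandwich V B U = A"
proof -
  note Ulin = bounded_isomorphismD(2)[OF U] and Vlin = bounded_isomorphismD(2)[OF V]
  define T where "T b = adj V o\<^sub>L b o\<^sub>L U" for b
  have T_app: "blinfun_apply (T b) x = blinfun_apply (adj V) (blinfun_apply b (blinfun_apply U x))" for b x
    by (simp add: T_def)
  have T_zero: "cinner (blinfun_apply (T b) x) y = 0 \<longleftrightarrow> cinner (blinfun_apply b (blinfun_apply U x)) (blinfun_apply V y) = 0" for b x y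
    by (simp add: T_app adj_cinner_eq_0[OF Vlin])
  have U_scale: "blinfun_apply U (c *\<^sub>C x) = (if clinear (blinfun_apply U) then c else cnj c) *\<^sub>C blinfun_apply U x" for c x
    using Ulin by (auto simp: semilinear_wrt_def)
  \<comment> \<open>The adjoint of \<open>V\<close> is of the same type as \<open>V\<close>, so that
    \<open>T b\<close> is linear or conjugate-linear according to whether the types of
    \<open>U\<close> and \<open>V\<close> agree.\<close>
  have T_lin: "semilinear_wrt (if clinear (blinfun_apply U) \<longleftrightarrow> clinear (blinfun_apply V) then (\<lambda>c. c) else cnj) (blinfun_apply (T b))"
    if "b \<in> B" for b
  proof -
    have "blinfun_apply (T b) (c *\<^sub>C x) =
        (if clinear (blinfun_apply U) \<longleftrightarrow> clinear (blinfun_apply V) then c else cnj c) *\<^sub>C blinfun_apply (T b) x" for c x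
      by (simp add: T_app U_scale cod.apply_simps[OF that] adj_scaleC[OF Vlin])
    then show ?thesis
      unfolding semilinear_wrt_def[of _ "blinfun_apply (T b)"] by (simp add: blinfun.add_right)
  qed
  define Z where "Z b x y \<longleftrightarrow> x \<noteq> 0 \<and> y \<noteq> 0 \<and> cinner (blinfun_apply (T b) x) y = 0" for b x y
  have zero: "cinner (blinfun_apply a x) y = 0"
    if "\<And>x y. Z b x y \<Longrightarrow> cinner (blinfun_apply a x) y = 0" "cinner (blinfun_apply (T b) x) y = 0" for a b x y
    using that by (cases "x = 0 \<or> y = 0") (auto simp: Z_def)
  have vanish: "b = 0" if b: "b \<in> B"
    and "\<And>a. a \<in> A \<Longrightarrow> (\<And>x y. cinner (blinfun_apply (T b) x) y = 0 \<Longrightarrow> cinner (blinfun_apply a x) y = 0) \<Longrightarrow> a = 0" for b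
  proof (rule vanishing_form[OF cont impl b, of "Z b"])
    show "cinner (blinfun_apply b (blinfun_apply U x)) (blinfun_apply V y) = 0" if "Z b x y" for x y
      using that by (simp add: Z_def T_zero)
    show "x \<noteq> 0 \<and> y \<noteq> 0" if "Z b x y" for x y using that by (simp add: Z_def)
    show "a = 0" if "a \<in> A" "\<And>x y. Z b x y \<Longrightarrow> cinner (blinfun_apply a x) y = 0" for a
      using that(1) zero[OF that(2)] by (rule \<open>\<And>a. a \<in> A \<Longrightarrow> (\<And>x y. cinner (blinfun_apply (T b) x) y = 0 \<Longrightarrow> cinner (blinfun_apply a x) y = 0) \<Longrightarrow> a = 0\<close>)
  qed
  show same: "clinear (blinfun_apply U) \<longleftrightarrow> clinear (blinfun_apply V)"
  proof (rule ccontr)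
    assume mixed: "\<not> (clinear (blinfun_apply U) \<longleftrightarrow> clinear (blinfun_apply V))"
    obtain b where b: "b \<in> B" "blinfun_apply b w1 \<noteq> 0" "blinfun_apply b w2 \<notin> cspan {blinfun_apply b w1}"
      using rank_two_element[OF w] by blast
    obtain x1 x2 where x: "blinfun_apply U x1 = w1" "blinfun_apply U x2 = w2"
      using bounded_isomorphismD(1)[OF U] by (metis bij_pointE)
    have conj: "conjugate_linear (blinfun_apply (T b))" using T_lin[OF b(1)] mixed by simp
    have "blinfun_apply (T b) x1 \<noteq> 0" using adj_injective[OF V] b(2) by (auto simp: T_app x)
    moreover have "blinfun_apply (T b) x2 \<notin> cspan {blinfun_apply (T b) x1}"
    proof
      assume "blinfun_apply (T b) x2 \<in> cspan {blinfun_apply (T b) x1}"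
      then obtain c where "blinfun_apply (adj V) (blinfun_apply b w2) = c *\<^sub>C blinfun_apply (adj V) (blinfun_apply b w1)"
        by (auto simp: in_cspan_singleton T_app x)
      also have "\<dots> = blinfun_apply (adj V) ((if clinear (blinfun_apply V) then c else cnj c) *\<^sub>C blinfun_apply b w1)"
        by (simp add: adj_scaleC[OF Vlin])
      finally have "blinfun_apply (adj V) (blinfun_apply b w2 - (if clinear (blinfun_apply V) then c else cnj c) *\<^sub>C blinfun_apply b w1) = 0"
        by (simp add: blinfun.diff_right)
      then have "blinfun_apply b w2 - (if clinear (blinfun_apply V) then c else cnj c) *\<^sub>C blinfun_apply b w1 = 0"
        by (rule adj_injective[OF V])
      then have "\<exists>c. blinfun_apply b w2 = c *\<^sub>C blinfun_apply b w1" unfolding right_minus_eq by blast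
      then show False using b(3) by (simp add: in_cspan_singleton)
    qed
    ultimately have "a = 0" if "a \<in> A" "\<And>x y. cinner (blinfun_apply (T b) x) y = 0 \<Longrightarrow> cinner (blinfun_apply a x) y = 0" for a
      using zero_set_conjugate_linear[OF conj dom.clinear_apply[OF that(1)] that(2)] by (intro blinfun_eqI) simp
    then have "b = 0" by (rule vanish[OF b(1)])
    then show False using b(2) by simp
  qed
  have Tb_lin: "clinear (blinfun_apply (T b))" if "b \<in> B" for b using T_lin[OF that] same by simp
  have multiple: "\<exists>c. a = c *\<^sub>C T b"
    if m: "b \<in> B" "a \<in> A" "\<And>x y. cinner (blinfun_apply (T b) x) y = 0 \<Longrightarrow> cinner (blinfun_apply a x) y = 0" for a b
  proof -
    obtain c where "\<forall>x. blinfun_apply a x = c *\<^sub>C blinfun_apply (T b) x"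
      using zero_set_linear[OF Tb_lin[OF m(1)] dom.clinear_apply[OF m(2)] m(3)] by blast
    then have "a = c *\<^sub>C T b" by (intro blinfun_eqI) (simp add: blinfun_apply_scaleC)
    then show ?thesis by blast
  qed
  have T_mem: "T b \<in> A" if b: "b \<in> B" for b
  proof (rule ccontr)
    assume nA: "T b \<notin> A"
    have "a = 0" if a: "a \<in> A" "\<And>x y. cinner (blinfun_apply (T b) x) y = 0 \<Longrightarrow> cinner (blinfun_apply a x) y = 0" for a
    proof -
      obtain c where c: "a = c *\<^sub>C T b" using multiple[OF b a] by blast
      have "c = 0"
      proof (rule ccontr)
        assume "c \<noteq> 0"
        then have "T b = inverse c *\<^sub>C a" by (simp add: c scaleC_scaleC)
        then show False using nA dom.scaleC_mem[OF a(1)] by simp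
      qed
      then show ?thesis using c by simp
    qed
    then have "b = 0" by (rule vanish[OF b])
    then have "T b = 0" by (intro blinfun_eqI) (simp add: T_app)
    then show False using nA dom.zero_mem by simp
  qed
  then show sub: "sandwich V B U \<subseteq> A" by (auto simp: sandwich_def T_def)
  show "sandwich V B U = A" if cocont: "kernel_cocontinuous A B \<Phi>"
  proof
    show "A \<subseteq> sandwich V B U"
    proof (rule ccontr)
      assume "\<not> A \<subseteq> sandwich V B U"
      then obtain a where a: "a \<in> A" "a \<notin> sandwich V B U" by blast
      have T0: "T 0 = 0" by (intro blinfun_eqI) (simp add: T_app)
      then have "0 \<in> sandwich V B U" unfolding sandwich_def using cod.zero_mem by (force simp: T_def)
      then have a0: "a \<noteq> 0" using a(2) by auto
      \<comment> \<open>The roles are exchanged: \<open>S\<close> consists of the points whose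
        kernels contain \<open>a\<close>. An element \<open>b\<close> in all image kernels has
        \<open>T b\<close> proportional to \<open>a\<close>, and as \<open>a\<close> is not in the
        compressed algebra, \<open>b\<close> is zero.\<close>
      define S where "S = {kernel_on A (omega x y) | x y. x \<noteq> 0 \<and> y \<noteq> 0 \<and> cinner (blinfun_apply a x) y = 0}"
      have S: "S \<subseteq> normal_part A" by (auto simp: S_def intro!: kernel_normal_part)
      have "b = 0" if b: "b \<in> B \<inter> \<Inter>(\<Phi> ` S)" for b
      proof -
        have bB: "b \<in> B" using b by blast
        have z: "cinner (blinfun_apply (T b) x) y = 0" if "cinner (blinfun_apply a x) y = 0" for x y
        proof (cases "x = 0 \<or> y = 0")
          case False
          then have "kernel_on A (omega x y) \<in> S" using that by (auto simp: S_def)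
          then have "b \<in> \<Phi> (kernel_on A (omega x y))" using b by blast
          then show ?thesis using impl False by (simp add: implements_def T_zero kernel_on_def omega_def)
        qed auto
        obtain c where "\<forall>x. blinfun_apply (T b) x = c *\<^sub>C blinfun_apply a x"
          using zero_set_linear[OF dom.clinear_apply[OF a(1)] Tb_lin[OF bB] z] by blast
        then have c: "T b = c *\<^sub>C a" by (intro blinfun_eqI) (simp add: blinfun_apply_scaleC)
        have "c = 0"
        proof (rule ccontr)
          assume "c \<noteq> 0"
          then have "a = inverse c *\<^sub>C T b" by (simp add: c scaleC_scaleC)
          also have "\<dots> = T ((if clinear (blinfun_apply V) then inverse c else cnj (inverse c)) *\<^sub>C b)"
            by (intro blinfun_eqI) (simp add: T_app blinfun_apply_scaleC adj_scaleC[OF Vlin])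
          also have "\<dots> \<in> sandwich V B U"
            unfolding sandwich_def T_def using cod.scaleC_mem[OF bB] by (intro imageI)
          finally show False using a(2) by simp
        qed
        then have "T b = 0" using c by simp
        then have "blinfun_apply b (blinfun_apply U x) = 0" for x
          using adj_injective[OF V] T_app[of b x] by simp
        then have "blinfun_apply b z = 0" for z using bounded_isomorphismD(1)[OF U] by (metis bij_pointE)
        then show ?thesis by (intro blinfun_eqI) simp
      qed
      moreover have "0 \<in> J" if "J \<in> normal_part B" for J
        using that cod.zero_mem by (auto simp: normal_part_def kernel_on_def omega_def)
      ultimately have sub: "B \<inter> \<Inter>(\<Phi> ` S) \<subseteq> \<Phi> I" if "I \<in> normal_part A" for I using \<Phi>_mem[OF that] by blast
      have cl: "A \<inter> \<Inter>S \<subseteq> I" if "I \<in> normal_part A" for I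
        by (rule cocont[unfolded kernel_cocontinuous_def, rule_format, OF S that sub[OF that]])
      have "a \<in> I" if "I \<in> S" for I using that a(1) by (auto simp: S_def kernel_on_def omega_def)
      then have aI: "a \<in> I" if "I \<in> normal_part A" for I using cl[OF that] a(1) by blast
      have "blinfun_apply a x = 0" for x
      proof (rule ccontr)
        assume nz: "blinfun_apply a x \<noteq> 0"
        then have "x \<noteq> 0" by auto
        then have "a \<in> kernel_on A (omega x (blinfun_apply a x))" using nz by (intro aI kernel_normal_part)
        then show False using nz by (simp add: kernel_on_def omega_def)
      qed
      then have "a = 0" by (intro blinfun_eqI) simp
      then show False using a0 by simp
    qed
  qed (rule sub)
qed

end

section \<open>Closure spaces of kernels\<close>

context irreducible_algebra
begin

text \<open>Extremality of the vector functionals enters here: the normal part lies in the structure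
  space, so that passing to the subspace merely restricts the points.\<close>

lemma normal_part_space: "normal_part_space A = (normal_part A, \<lambda>S. {I \<in> normal_part A. A \<inter> \<Inter>S \<subseteq> I})"
  using normal_part_subset_structure_set
  by (auto simp: normal_part_space_def cs_subspace_def structure_space_def fun_eq_iff)

end

lemma kernel_bijection_finite_homeomorphism:
  assumes "irreducible_algebra A" "irreducible_algebra B"
    and homeo: "cs_finite_homeomorphism (normal_part_space A) (normal_part_space B) \<Phi>"
  shows "kernel_bijection A B \<Phi>"
proof -
  interpret A: irreducible_algebra A by fact
  interpret B: irreducible_algebra B by fact
  let ?\<Psi> = "inv_into (normal_part A) \<Phi>"
  have bij: "bij_betw \<Phi> (normal_part A) (normal_part B)"
    and c1: "\<And>S. S \<subseteq> normal_part A \<Longrightarrow> finite S \<Longrightarrow>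
      \<Phi> ` {I \<in> normal_part A. A \<inter> \<Inter>S \<subseteq> I} \<subseteq> {J \<in> normal_part B. B \<inter> \<Inter>(\<Phi> ` S) \<subseteq> J}"
    and c2: "\<And>S. S \<subseteq> normal_part B \<Longrightarrow> finite S \<Longrightarrow>
      ?\<Psi> ` {J \<in> normal_part B. B \<inter> \<Inter>S \<subseteq> J} \<subseteq> {I \<in> normal_part A. A \<inter> \<Inter>(?\<Psi> ` S) \<subseteq> I}"
    using homeo by (simp_all add: cs_finite_homeomorphism_def cs_finitely_continuous_def A.normal_part_space B.normal_part_space)
  show ?thesis
  proof unfold_locales
    fix S I assume S: "finite S" "S \<subseteq> normal_part A" and I: "I \<in> normal_part A"
    have left_inv: "?\<Psi> (\<Phi> J) = J" if "J \<in> normal_part A" for J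
      using bij_betw_inv_into_left[OF bij that] .
    have "?\<Psi> ` \<Phi> ` S = (\<lambda>J. J) ` S"
      unfolding image_image by (rule image_cong[OF refl left_inv]) (use S in blast)
    then have bS: "?\<Psi> ` \<Phi> ` S = S" by simp
    show "A \<inter> \<Inter>S \<subseteq> I \<longleftrightarrow> B \<inter> \<Inter>(\<Phi> ` S) \<subseteq> \<Phi> I"
    proof
      assume "A \<inter> \<Inter>S \<subseteq> I" then show "B \<inter> \<Inter>(\<Phi> ` S) \<subseteq> \<Phi> I" using c1[OF S(2,1)] I by blast
    next
      assume cl: "B \<inter> \<Inter>(\<Phi> ` S) \<subseteq> \<Phi> I"
      have "\<Phi> ` S \<subseteq> normal_part B" "\<Phi> I \<in> normal_part B" using bij_betwE[OF bij] S I by auto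
      then have "?\<Psi> (\<Phi> I) \<in> {I \<in> normal_part A. A \<inter> \<Inter>(?\<Psi> ` \<Phi> ` S) \<subseteq> I}"
        using c2[of "\<Phi> ` S"] finite_imageI[OF S(1)] cl by blast
      then show "A \<inter> \<Inter>S \<subseteq> I" by (simp add: bS left_inv[OF I])
    qed
  qed (rule bij)
qed

context kernel_bijection
begin

lemma kernel_continuousI:
  assumes "cs_continuous (normal_part_space A) (normal_part_space B) \<Phi>"
  shows "kernel_continuous A B \<Phi>"
proof -
  have "\<Phi> ` {I \<in> normal_part A. A \<inter> \<Inter>S \<subseteq> I} \<subseteq> {J \<in> normal_part B. B \<inter> \<Inter>(\<Phi> ` S) \<subseteq> J}"
    if "S \<subseteq> normal_part A" for S
    using assms that by (simp add: cs_continuous_def dom.normal_part_space cod.normal_part_space)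
  then show ?thesis unfolding kernel_continuous_def by blast
qed

lemma kernel_cocontinuousI:
  assumes "cs_homeomorphism (normal_part_space A) (normal_part_space B) \<Phi>"
  shows "kernel_cocontinuous A B \<Phi>"
  unfolding kernel_cocontinuous_def
proof (intro allI impI)
  let ?\<Psi> = "inv_into (normal_part A) \<Phi>"
  fix S I assume S: "S \<subseteq> normal_part A" and I: "I \<in> normal_part A" and cl: "B \<inter> \<Inter>(\<Phi> ` S) \<subseteq> \<Phi> I"
  have left_inv: "?\<Psi> (\<Phi> J) = J" if "J \<in> normal_part A" for J
    using bij_betw_inv_into_left[OF bij that] .
  have "?\<Psi> ` \<Phi> ` S = (\<lambda>J. J) ` S"
    unfolding image_image by (rule image_cong[OF refl left_inv]) (use S in blast)
  then have bS: "?\<Psi> ` \<Phi> ` S = S" by simp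
  have c2: "?\<Psi> ` {J \<in> normal_part B. B \<inter> \<Inter>S \<subseteq> J} \<subseteq> {I \<in> normal_part A. A \<inter> \<Inter>(?\<Psi> ` S) \<subseteq> I}"
    if "S \<subseteq> normal_part B" for S
    using assms that by (simp add: cs_homeomorphism_def cs_continuous_def dom.normal_part_space cod.normal_part_space)
  have "\<Phi> ` S \<subseteq> normal_part B" "\<Phi> I \<in> normal_part B" using \<Phi>_mem S I by auto
  then have "?\<Psi> (\<Phi> I) \<in> {I \<in> normal_part A. A \<inter> \<Inter>(?\<Psi> ` \<Phi> ` S) \<subseteq> I}"
    using c2[of "\<Phi> ` S"] cl by blast
  then show "A \<inter> \<Inter>S \<subseteq> I" by (simp add: bS left_inv[OF I])
qed

lemma semilinear_implementation_cases:
  assumes ind: "independent3 cspan (e :: 'h) f f'"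
  shows "\<exists>U V. semilinear U \<and> bij U \<and> semilinear V \<and> bij V \<and> (implements A B \<Phi> U V \<or> implements_flipped A B \<Phi> U V)"
proof -
  have "e \<noteq> 0" "f \<notin> cspan {e}" using ind by (auto simp: independent3_def)
  moreover from this have "f \<noteq> 0" using complex_vector.span_zero by metis
  ultimately consider u v where "implemented_bijection A B \<Phi> u v"
    | u v where "implemented_bijection A B (\<lambda>I. adj ` \<Phi> I) u v"
    using implemented_cases by metis
  then show ?thesis
  proof cases
    case 1
    obtain U V where "semilinear U" "bij U" "semilinear V" "bij V" "implements A B \<Phi> U V"
      using implemented_bijection.semilinear_implementation[OF 1 ind] by blast
    then show ?thesis by blast
  next
    case 2
    obtain U V where "semilinear U" "bij U" "semilinear V" "bij V" "implements A B (\<lambda>I. adj ` \<Phi> I) U V"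
      using implemented_bijection.semilinear_implementation[OF 2 ind] by blast
    then show ?thesis unfolding implements_adjoint by blast
  qed
qed

lemma bounded_implementation_cases:
  assumes cont: "kernel_continuous A B \<Phi>" and ind: "independent3 cspan (e :: 'h) f f'"
    and k: "\<And>n :: nat. norm (k n :: 'k) = 1" "\<And>m n. m \<noteq> n \<Longrightarrow> cinner (k m) (k n) = 0"
  shows "\<exists>(U :: 'h \<Rightarrow>\<^sub>L 'k) (V :: 'h \<Rightarrow>\<^sub>L 'k). bounded_isomorphism U \<and> bounded_isomorphism V \<and>
    (implements A B \<Phi> (blinfun_apply U) (blinfun_apply V) \<or> implements_flipped A B \<Phi> (blinfun_apply U) (blinfun_apply V))"
proof -
  have "e \<noteq> 0" "f \<notin> cspan {e}" using ind by (auto simp: independent3_def)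
  moreover from this have "f \<noteq> 0" using complex_vector.span_zero by metis
  ultimately consider u v where "implemented_bijection A B \<Phi> u v"
    | u v where "implemented_bijection A B (\<lambda>I. adj ` \<Phi> I) u v"
    using implemented_cases by metis
  then show ?thesis
  proof cases
    case 1
    obtain U V :: "'h \<Rightarrow>\<^sub>L 'k" where "bounded_isomorphism U" "bounded_isomorphism V"
      "implements A B \<Phi> (blinfun_apply U) (blinfun_apply V)"
      by (rule implemented_bijection.bounded_implementation[OF 1 cont ind k])
    then show ?thesis by blast
  next
    case 2
    obtain U V :: "'h \<Rightarrow>\<^sub>L 'k" where "bounded_isomorphism U" "bounded_isomorphism V"
      "implements A B (\<lambda>I. adj ` \<Phi> I) (blinfun_apply U) (blinfun_apply V)"
      by (rule implemented_bijection.bounded_implementation[OF 2 adjoint_continuous[OF cont] ind k])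
    then show ?thesis unfolding implements_adjoint by blast
  qed
qed

lemma sandwich_cases:
  fixes U V :: "'h \<Rightarrow>\<^sub>L 'k"
  assumes cont: "kernel_continuous A B \<Phi>" and U: "bounded_isomorphism U" and V: "bounded_isomorphism V"
    and impl: "implements A B \<Phi> (blinfun_apply U) (blinfun_apply V) \<or> implements_flipped A B \<Phi> (blinfun_apply U) (blinfun_apply V)"
    and w: "norm w1 = 1" "norm w2 = 1" "cinner w1 (w2 :: 'k) = 0"
  shows "(clinear (blinfun_apply U) \<longleftrightarrow> clinear (blinfun_apply V)) \<and> sandwich V B U \<subseteq> A \<and>
    (kernel_cocontinuous A B \<Phi> \<longrightarrow> sandwich V B U = A)"
  using impl
proof
  assume "implements A B \<Phi> (blinfun_apply U) (blinfun_apply V)"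
  from sandwich_properties[OF cont this U V w] show ?thesis by blast
next
  assume "implements_flipped A B \<Phi> (blinfun_apply U) (blinfun_apply V)"
  then have "implements A B (\<lambda>I. adj ` \<Phi> I) (blinfun_apply U) (blinfun_apply V)"
    by (simp add: implements_adjoint)
  from kernel_bijection.sandwich_properties[OF adjoint adjoint_continuous[OF cont] this U V w]
  show ?thesis using adjoint_cocontinuous by blast
qed

end

theorem theorem6p18:
  fixes A :: "('h::complex_hilbert \<Rightarrow>\<^sub>L 'h) set"
    and B :: "('k::complex_hilbert \<Rightarrow>\<^sub>L 'k) set"
    and \<Phi> :: "('h \<Rightarrow>\<^sub>L 'h) set \<Rightarrow> ('k \<Rightarrow>\<^sub>L 'k) set"
  assumes "irreducible_cstar_algebra A" and "irreducible_cstar_algebra B"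
    and "cs_finite_homeomorphism (normal_part_space A) (normal_part_space B) \<Phi>"
  shows
    "(finite_dimensional TYPE('h) \<or> finite_dimensional TYPE('k) \<longrightarrow>
        (hilbert_dim :: 'h rel) =o (hilbert_dim :: 'k rel))
     \<and>
     ((hilbert_dim :: 'h rel) =o (hilbert_dim :: 'k rel) \<and>
        |{..<3::nat}| \<le>o (hilbert_dim :: 'h rel) \<longrightarrow>
        (\<exists>(U :: 'h \<Rightarrow> 'k) (V :: 'h \<Rightarrow> 'k).
           semilinear U \<and> bij U \<and> semilinear V \<and> bij V \<and>
           (implements A B \<Phi> U V \<or> implements_flipped A B \<Phi> U V)))
     \<and>
     (\<not> finite_dimensional TYPE('h) \<and> \<not> finite_dimensional TYPE('k) \<and>
        cs_continuous (normal_part_space A) (normal_part_space B) \<Phi> \<longrightarrow>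
        (\<exists>(U :: 'h \<Rightarrow>\<^sub>L 'k) (V :: 'h \<Rightarrow>\<^sub>L 'k).
           bounded_isomorphism U \<and> bounded_isomorphism V \<and>
           (implements A B \<Phi> (blinfun_apply U) (blinfun_apply V) \<or>
            implements_flipped A B \<Phi> (blinfun_apply U) (blinfun_apply V))) \<and>
        (\<forall>(U :: 'h \<Rightarrow>\<^sub>L 'k) (V :: 'h \<Rightarrow>\<^sub>L 'k).
           bounded_isomorphism U \<and> bounded_isomorphism V \<and>
           (implements A B \<Phi> (blinfun_apply U) (blinfun_apply V) \<or>
            implements_flipped A B \<Phi> (blinfun_apply U) (blinfun_apply V)) \<longrightarrow>
           (clinear (blinfun_apply U) \<longleftrightarrow> clinear (blinfun_apply V)) \<and>
           sandwich V B U \<subseteq> A \<and>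
           (cs_homeomorphism (normal_part_space A) (normal_part_space B) \<Phi> \<longrightarrow> sandwich V B U = A)) \<and>
        (hilbert_dim :: 'h rel) =o (hilbert_dim :: 'k rel))"
proof -
  interpret kernel_bijection A B \<Phi>
    by (rule kernel_bijection_finite_homeomorphism[OF irreducible_algebra.intro irreducible_algebra.intro])
      (fact assms)+
  interpret inverse: kernel_bijection B A "inv_into (normal_part A) \<Phi>" by (rule inverse)
  obtain E :: "'h set" where E: "orthonormal E" "closure (cspan E) = UNIV" "(hilbert_dim :: 'h rel) = |E|"
    by (rule hilbert_dim_basis)
  obtain F :: "'k set" where F: "orthonormal F" "closure (cspan F) = UNIV" "(hilbert_dim :: 'k rel) = |F|"
    by (rule hilbert_dim_basis)
  have fd: "finite_dimensional TYPE('h) \<longleftrightarrow> finite E" "finite_dimensional TYPE('k) \<longleftrightarrow> finite F"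
    by (simp_all add: finite_dimensional_def E(3) F(3) finite_iff_ordLess_natLeq)
  \<comment> \<open>Finiteness passes from either basis to the other by applying the bound both to
    \<Phi> and to its inverse.\<close>
  have a: "|E| =o |F|" if "finite E \<or> finite F"
  proof -
    have "finite E \<and> finite F"
      using that finite_basis_card_le[OF _ E(1,2) F(1)] inverse.finite_basis_card_le[OF _ F(1,2) E(1)] by blast
    moreover from this have "card E = card F"
      using finite_basis_card_le[OF _ E(1,2) F(1)] inverse.finite_basis_card_le[OF _ F(1,2) E(1)] by (simp add: le_antisym)
    ultimately show ?thesis using finite_same_card_bij card_of_ordIso by metis
  qed
  have b: "\<exists>U V. semilinear U \<and> bij U \<and> semilinear V \<and> bij V \<and> (implements A B \<Phi> U V \<or> implements_flipped A B \<Phi> U V)"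
    if three: "|{..<3::nat}| \<le>o |E|"
  proof -
    obtain g where g: "inj_on g {..<3::nat}" "g ` {..<3::nat} \<subseteq> E"
      using three unfolding card_of_ordLeq[symmetric] by blast
    have "g 0 \<in> E" "g 1 \<in> E" "g 2 \<in> E" using g(2) by auto
    moreover have "g 0 \<noteq> g 1" "g 0 \<noteq> g 2" "g 1 \<noteq> g 2" using inj_on_eq_iff[OF g(1)] by simp_all
    ultimately have "independent3 cspan (g 0) (g 1) (g 2)" by (intro orthonormal_independent3[OF E(1)])
    then show ?thesis by (rule semilinear_implementation_cases)
  qed
  have c: "(\<exists>(U :: 'h \<Rightarrow>\<^sub>L 'k) (V :: 'h \<Rightarrow>\<^sub>L 'k).
           bounded_isomorphism U \<and> bounded_isomorphism V \<and>
           (implements A B \<Phi> (blinfun_apply U) (blinfun_apply V) \<or>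
            implements_flipped A B \<Phi> (blinfun_apply U) (blinfun_apply V))) \<and>
        (\<forall>(U :: 'h \<Rightarrow>\<^sub>L 'k) (V :: 'h \<Rightarrow>\<^sub>L 'k).
           bounded_isomorphism U \<and> bounded_isomorphism V \<and>
           (implements A B \<Phi> (blinfun_apply U) (blinfun_apply V) \<or>
            implements_flipped A B \<Phi> (blinfun_apply U) (blinfun_apply V)) \<longrightarrow>
           (clinear (blinfun_apply U) \<longleftrightarrow> clinear (blinfun_apply V)) \<and>
           sandwich V B U \<subseteq> A \<and>
           (cs_homeomorphism (normal_part_space A) (normal_part_space B) \<Phi> \<longrightarrow> sandwich V B U = A)) \<and>
        |E| =o |F|"
    if inf: "infinite E" "infinite F" and cs: "cs_continuous (normal_part_space A) (normal_part_space B) \<Phi>"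
  proof -
    have cont: "kernel_continuous A B \<Phi>" by (rule kernel_continuousI[OF cs])
    obtain g :: "nat \<Rightarrow> 'h" where g: "inj g" "range g \<subseteq> E" using infinite_countable_subset[OF inf(1)] by blast
    \<comment> \<open>The sequence in \<open>F\<close> is used twice: as the test sequence for the
      field automorphisms, and with its first two members as the orthonormal pair in the analysis of
      the compressed algebra.\<close>
    obtain k :: "nat \<Rightarrow> 'k" where k: "inj k" "range k \<subseteq> F" using infinite_countable_subset[OF inf(2)] by blast
    have gE: "g n \<in> E" and kF: "k n \<in> F" for n using g(2) k(2) by auto
    have kn: "norm (k n) = 1" for n using F(1) kF by (simp add: orthonormal_def)
    have ko: "cinner (k m) (k n) = 0" if "m \<noteq> n" for m n
      using F(1) kF that inj_eq[OF k(1)] by (simp add: orthonormal_def)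
    have ind: "independent3 cspan (g 0) (g 1) (g 2)"
      by (rule orthonormal_independent3[OF E(1) gE gE gE]) (simp_all add: inj_eq[OF g(1)])
    have ex: "\<exists>(U :: 'h \<Rightarrow>\<^sub>L 'k) (V :: 'h \<Rightarrow>\<^sub>L 'k). bounded_isomorphism U \<and> bounded_isomorphism V \<and>
        (implements A B \<Phi> (blinfun_apply U) (blinfun_apply V) \<or>
         implements_flipped A B \<Phi> (blinfun_apply U) (blinfun_apply V))"
      by (rule bounded_implementation_cases[OF cont ind, of k]) (rule kn, rule ko)
    obtain U V :: "'h \<Rightarrow>\<^sub>L 'k" where "bounded_isomorphism U"
      using ex by (elim exE conjE) (rule that)
    then have dim: "|E| =o |F|" by (rule bounded_isomorphism_basis_ordIso[OF _ E(1,2) inf(1) F(1,2) inf(2)])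
    have orth: "cinner (k 0) (k 1) = 0" by (rule ko) simp
    have "(clinear (blinfun_apply U) \<longleftrightarrow> clinear (blinfun_apply V)) \<and> sandwich V B U \<subseteq> A \<and>
        (cs_homeomorphism (normal_part_space A) (normal_part_space B) \<Phi> \<longrightarrow> sandwich V B U = A)"
      if UV: "bounded_isomorphism U \<and> bounded_isomorphism V \<and>
           (implements A B \<Phi> (blinfun_apply U) (blinfun_apply V) \<or>
            implements_flipped A B \<Phi> (blinfun_apply U) (blinfun_apply V))" for U V :: "'h \<Rightarrow>\<^sub>L 'k"
    proof -
      note s = sandwich_cases[OF cont UV[THEN conjunct1] UV[THEN conjunct2, THEN conjunct1]
          UV[THEN conjunct2, THEN conjunct2] kn kn orth]
      show ?thesis
        by (intro conjI impI conjunct1[OF s] s[THEN conjunct2, THEN conjunct1]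
            s[THEN conjunct2, THEN conjunct2, THEN mp] kernel_cocontinuousI)
    qed
    then show ?thesis by (intro conjI[OF ex conjI[OF _ dim]] allI impI)
  qed
  show ?thesis
    unfolding E(3) F(3) fd
  proof (rule conjI[OF impI[OF a] conjI[OF impI impI]])
    assume "|E| =o |F| \<and> |{..<3::nat}| \<le>o |E|"
    from b[OF conjunct2[OF this]]
    show "\<exists>U V. semilinear U \<and> bij U \<and> semilinear V \<and> bij V \<and> (implements A B \<Phi> U V \<or> implements_flipped A B \<Phi> U V)" .
  qed (assumption, elim conjE, rule c)
qed

end
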